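(* Consider the BPSD-id with block size $\widetilde k$ and preconditioner $K=(H-\sigma S)^{-1}$, where $\sigma<\lambda_i$. Denote by $\theta_1^{(\ell)}\le\cdots\le\theta_{\widetilde k}^{(\ell)}$ the Ritz values of $(H,S)$ in the $\ell$th subspace $\mathrm{span}\{Z^{(\ell)}\}$. Then, for $t\in\{1,\ldots,\widetilde k\}$ and all $\ell$, $$\frac{\theta_t^{(\ell)}-\lambda_{i-1+t}}{\lambda_n-\theta_t^{(\ell)}}\le\left(\frac{\kappa}{2-\kappa}\right)^{2\ell}\frac{\lambda_{i-1+t}-\sigma}{\lambda_n-\sigma}\,\tau\quad\text{with}\quad \kappa=\left(\frac{\lambda_{i-1+t}-\sigma}{\lambda_{i+\widetilde k}-\sigma}\right)\left(\frac{\lambda_n-\lambda_{i+\widetilde k}}{\lambda_n-\lambda_{i-1+t}}\right)$$ and a constant $\tau>0$ depending on the initial subspace $\mathrm{span}\{Z^{(0)}\}$ (and not on $\ell$).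
   Context: Setting. $H,S\in\mathbb{C}^{n\times n}$ are Hermitian, $S$ is positive definite, and $\lambda_1\le\cdots\le\lambda_n$ are the (real) eigenvalues of the pair $(H,S)$, i.e. of $Hu=\lambda Su$. Fix an index $i$. Let $u_1,\ldots,u_n$ be an $S$-orthonormal basis of $\mathbb{C}^n$ with $Hu_l=\lambda_lSu_l$, and set $U=[u_1,\ldots,u_{i-1}]$ (the already computed eigenvectors, assumed exact) and $V=[u_i,\ldots,u_n]$; $\mathrm{span}\{V\}$ is the $S$-orthogonal complement of $\mathrm{span}\{U\}$. Here $\mathrm{span}\{\cdot\}$ denotes the span of all columns of the listed matrices. Ritz pairs. For a subspace with basis matrix $W$, the Ritz values of $(H,S)$ in it are the eigenvalues of the pair $(W^*HW,W^*SW)$ (counted with multiplicity), and the vectors $Wg$ with $g$ a corresponding eigenvector are the associated Ritz vectors. BPSD-id (block preconditioned steepest descent with implicit deflation), block size $\widetilde k$. Each iterate $Z^{(\ell)}\in\mathbb{C}^{n\times\widetilde k}$, $\ell=0,1,2,\ldots$, has full rank, its columns belong to $\mathrm{span}\{V\}$, and they are $S$-orthonormal Ritz vectors of $(H,S)$ in $\mathrm{span}\{Z^{(\ell)}\}$. With the preconditioner $K$, let $R^{(\ell)}=HZ^{(\ell)}-SZ^{(\ell)}\big((Z^{(\ell)})^*HZ^{(\ell)}\big)$ and $P^{(\ell)}=KR^{(\ell)}$. The next iterate $Z^{(\ell+1)}$ consists of $S$-orthonormal Ritz vectors associated with the $i$th to the $(i-1+\widetilde k)$th smallest Ritz values of $(H,S)$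 in $\mathrm{span}\{U,Z^{(\ell)},P^{(\ell)}\}$, where the columns of $U$ serve as Ritz vectors for the $i-1$ smallest Ritz values and the columns of $Z^{(\ell+1)}$ are $S$-orthogonal to them.
   Formalization: Added assumption on span{Z^(0)}: θ_t^(0)<λ_n whenever λ_{i-1+t}<λ_n, and at some step, uniformly over runs, every θ_t with λ_{i-1+t}<λ_{i+k̃} lies below λ_{i+k̃}; otherwise no finite τ exists (stagnation, e.g. H=diag(1,2,3), S=I, σ=0, i=k̃=1, Z^(0)=e_2). *)

theory Defs
  imports
    "Jordan_Normal_Form.DL_Rank"
    "Jordan_Normal_Form.Schur_Decomposition"
begin

definition hermitian_mat :: "complex mat \<Rightarrow> bool" where
  "hermitian_mat A \<longleftrightarrow> dim_row A = dim_col A \<and> mat_adjoint A = A"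

definition posdef_mat :: "complex mat \<Rightarrow> bool" where
  "posdef_mat A \<longleftrightarrow> hermitian_mat A \<and>
     (\<forall>x \<in> carrier_vec (dim_row A). x \<noteq> 0\<^sub>v (dim_row A) \<longrightarrow> Re ((A *\<^sub>v x) \<bullet>c x) > 0)"

(* det (A - x B) as a polynomial in x *)
definition pencil_poly :: "complex mat \<Rightarrow> complex mat \<Rightarrow> complex poly" where
  "pencil_poly A B =
     det (mat (dim_row A) (dim_row A) (\<lambda>(r, c). [: A $$ (r, c), - B $$ (r, c) :]))"

(* The eigenvalues of A g = x B g in nondecreasing order, repeated according to multiplicity.
   Intended for Hermitian A and positive definite B: the roots are then real, so that Re loses
   nothing, and algebraic and geometric multiplicities agree. *)
definition pair_eigvals :: "complex mat \<Rightarrow> complex mat \<Rightarrow> real list" where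
  "pair_eigvals A B = sorted_list_of_multiset (image_mset Re (proots (pencil_poly A B)))"

(* l-th smallest eigenvalue, counted from 1 *)
definition pair_eigval :: "complex mat \<Rightarrow> complex mat \<Rightarrow> nat \<Rightarrow> real" where
  "pair_eigval A B l = pair_eigvals A B ! (l - 1)"

abbreviation col_span :: "nat \<Rightarrow> complex mat \<Rightarrow> complex vec set" where
  "col_span n W \<equiv> vec_space.col_space n W"

definition full_col_rank :: "nat \<Rightarrow> complex mat \<Rightarrow> bool" where
  "full_col_rank n W \<longleftrightarrow> W \<in> carrier_mat n (dim_col W) \<and> vec_space.rank n W = dim_col W"

definition basis_matrix :: "nat \<Rightarrow> complex mat \<Rightarrow> complex vec set \<Rightarrow> bool" where
  "basis_matrix n W X \<longleftrightarrow> full_col_rank n W \<and> col_span n W = X"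

definition orthonormal_cols :: "complex mat \<Rightarrow> complex mat \<Rightarrow> bool" where
  "orthonormal_cols S W \<longleftrightarrow> mat_adjoint W * S * W = 1\<^sub>m (dim_col W)"

(* t-th smallest Ritz value of (H, S) in the subspace with basis matrix W, counted from 1 *)
definition ritz_value :: "complex mat \<Rightarrow> complex mat \<Rightarrow> complex mat \<Rightarrow> nat \<Rightarrow> real" where
  "ritz_value H S W t = pair_eigval (mat_adjoint W * H * W) (mat_adjoint W * S * W) t"

definition ritz_pair ::
  "complex mat \<Rightarrow> complex mat \<Rightarrow> complex mat \<Rightarrow> real \<Rightarrow> complex vec \<Rightarrow> bool" where
  "ritz_pair H S W \<theta> x \<longleftrightarrow>
     (\<exists>g \<in> carrier_vec (dim_col W). g \<noteq> 0\<^sub>v (dim_col W) \<and>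
        (mat_adjoint W * H * W) *\<^sub>v g
          = complex_of_real \<theta> \<cdot>\<^sub>v ((mat_adjoint W * S * W) *\<^sub>v g) \<and>
        x = W *\<^sub>v g)"

definition hcat3 :: "nat \<Rightarrow> complex mat \<Rightarrow> complex mat \<Rightarrow> complex mat \<Rightarrow> complex mat" where
  "hcat3 n A B C = mat_of_cols n (cols A @ cols B @ cols C)"

definition bpsd_residual :: "complex mat \<Rightarrow> complex mat \<Rightarrow> complex mat \<Rightarrow> complex mat" where
  "bpsd_residual H S Z = H * Z - S * Z * (mat_adjoint Z * H * Z)"

(* Standing properties of an iterate; V spans the S-orthogonal complement of span U. *)
definition bpsd_iterate ::
  "nat \<Rightarrow> complex mat \<Rightarrow> complex mat \<Rightarrow> complex mat \<Rightarrow> nat \<Rightarrow> complex mat \<Rightarrow> bool" where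
  "bpsd_iterate n H S V k Z \<longleftrightarrow>
     Z \<in> carrier_mat n k \<and> full_col_rank n Z \<and>
     set (cols Z) \<subseteq> col_span n V \<and>
     orthonormal_cols S Z \<and>
     (\<forall>j < k. \<exists>\<theta>. ritz_pair H S Z \<theta> (col Z j))"

(* One step, with i - 1 = dim_col U. Ritz values and Ritz vectors depend only on the subspace,
   so the choice of the basis matrix W is immaterial; its number of columns may be smaller than
   dim_col U + 2 * k. The permutation p leaves the order of the columns of Z' free. *)
definition bpsd_id_step ::
  "nat \<Rightarrow> complex mat \<Rightarrow> complex mat \<Rightarrow> complex mat \<Rightarrow> complex mat \<Rightarrow> nat \<Rightarrow>
   complex mat \<Rightarrow> complex mat \<Rightarrow> bool" where
  "bpsd_id_step n H S K U k Z Z' \<longleftrightarrow>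
     (\<exists>W p. basis_matrix n W (col_span n (hcat3 n U Z (K * bpsd_residual H S Z))) \<and>
        p permutes {..<k} \<and>
        (\<forall>j < k. ritz_pair H S W (ritz_value H S W (dim_col U + 1 + p j)) (col Z' j))) \<and>
     orthonormal_cols S Z' \<and>
     mat_adjoint U * S * Z' = 0\<^sub>m (dim_col U) k"

(* Z 0, Z 1, ... is a run of the iteration started in the subspace X. The eigenvectors are
   u 1, ..., u n. *)
definition bpsd_id_run ::
  "nat \<Rightarrow> complex mat \<Rightarrow> complex mat \<Rightarrow> complex mat \<Rightarrow> (nat \<Rightarrow> complex vec) \<Rightarrow> nat \<Rightarrow> nat \<Rightarrow>
   complex vec set \<Rightarrow> (nat \<Rightarrow> complex mat) \<Rightarrow> bool" where
  "bpsd_id_run n H S K u i k X Z \<longleftrightarrow>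
     col_span n (Z 0) = X \<and>
     (\<forall>l. bpsd_iterate n H S (mat_of_cols n (map u [i..<n + 1])) k (Z l)) \<and>
     (\<forall>l. bpsd_id_step n H S K (mat_of_cols n (map u [1..<i])) k (Z l) (Z (Suc l)))"

(* The initial subspaces for which a constant tau can exist at all. A run may stagnate in an
   invariant subspace other than the target one, even if X contains no vector that is
   S-orthogonal to span {u i, ..., u (i - 1 + k)}: take H = diag (1, 2, 3, 4, 5), S = 1,
   sigma = 0, i = 1, k = 2 and X spanned by (1, 0, 1, 0, 0) and (0, e, 0, 1, 1) with small e > 0;
   the first step yields span {e1, e3}, where the iteration stops.
   First condition: the fractions (theta - lambda) / (lambda n - theta) are finite at the start.
   Second condition: some iterate (possibly the initial one) has the Ritz values that approximate
   eigenvalues below lambda (i + k) themselves below lambda (i + k), uniformly over the runs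
   from X (the subspaces of two runs can differ only if Ritz values coincide).
   Both conditions are necessary for the asserted bound: kappa < 1 for these indices, so the bound
   drives the Ritz values to their eigenvalues, at a rate depending on X only. The k-th initial
   Ritz value being below lambda (i + k) is sufficient for both (take m = 0). *)
definition admissible_start ::
  "nat \<Rightarrow> complex mat \<Rightarrow> complex mat \<Rightarrow> complex mat \<Rightarrow> (nat \<Rightarrow> complex vec) \<Rightarrow> nat \<Rightarrow> nat \<Rightarrow>
   complex vec set \<Rightarrow> bool" where
  "admissible_start n H S K u i k X \<longleftrightarrow>
     (\<forall>Z. bpsd_id_run n H S K u i k X Z \<longrightarrow>
        (\<forall>t \<in> {1..k}. pair_eigval H S (i - 1 + t) < pair_eigval H S n \<longrightarrow>
           ritz_value H S (Z 0) t < pair_eigval H S n)) \<and>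
     (\<exists>m c. c < pair_eigval H S (i + k) \<and>
        (\<forall>Z. bpsd_id_run n H S K u i k X Z \<longrightarrow>
           (\<forall>t \<in> {1..k}. pair_eigval H S (i - 1 + t) < pair_eigval H S (i + k) \<longrightarrow>
              ritz_value H S (Z m) t \<le> c)))"

end

(* Let B be the operator (H - sigma S)^-1 S, restricted to span V and diagonalised by the u_l, with
   eigenvalues beta_j = 1 / (lambda_(i-1+j) - sigma). Since K R = Z - K S Z (Theta - sigma), one step
   replaces span Z by the best Ritz subspace of span {Z, B Z}, and a Ritz value theta of (H, S) turns
   into the Ritz value eta = 1 / (theta - sigma) of B.

   Let q be the number of indices t <= k with lambda_(i-1+t) < lambda_(i+k), and Y the span of the
   first q Ritz vectors. As soon as eta_q > beta_(q+1), Y is the graph of a linear map W over the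
   leading q coordinates. The Chebyshev filter p of degree 1 for [beta_N, beta_(q+1)] damps the tail
   of a vector relative to its leading part by kappa / (2 - kappa). For t = q this bounds the next
   Ritz value directly. For t < q it has to be applied to vectors of Y with leading part in the
   first t coordinates, whose Rayleigh quotients may lie below eta_t; the defect is of relative
   order |W|^2. A downward induction on t shows that |W|^2 decays geometrically, so the defects
   multiply up to a bounded factor, which is absorbed by tau. *)
theory Submission
  imports Defs
begin

section \<open>Homogeneous linear systems and weighted sums of squares\<close>

text \<open>Why the first \<open>t\<close> Ritz vectors do not suffice for t < q: a filter
  normalised at beta_t damps the coordinates t+1, ..., q far less than the tail, and letting them
  pass would give a rate governed by lambda_(i+t) instead of lambda_(i+k). They are removed by
  linear constraints on the whole block, and the price is that the constrained vectors no longer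
  inherit the Ritz inequality with eta_t. The constant tau may depend on the initial subspace only,
  whereas Ritz vectors, and with multiple Ritz values even the iterates, are not determined by it.
  Every asymptotic statement therefore fixes its constants before the run; only a threshold
  \<open>b\<close> for the Ritz values of B is taken from the start. Two degenerate situations need
  arguments of their own. A zero rate leaves no room for a constant that compensates a late start.
  If beta_t = beta_(t+1), then eta_t never exceeds beta_(t+1), on which the comparison with Ritz
  vectors relies; the result is then inherited from t+1.\<close>

lemma homogeneous_system_nontrivial:
  fixes \<phi> :: "'e \<Rightarrow> 'j \<Rightarrow> 'a::field"
  assumes "finite E" "finite J" "card E < card J"
  shows "\<exists>c. (\<exists>j\<in>J. c j \<noteq> 0) \<and> (\<forall>e\<in>E. (\<Sum>j\<in>J. \<phi> e j * c j) = 0)"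
  using assms
proof (induction E arbitrary: J \<phi> rule: finite_induct)
  case empty
  then have "J \<noteq> {}" by auto
  then show ?case by (intro exI[of _ "\<lambda>_. 1"]) auto
next
  case (insert e E)
  show ?case
  proof (cases "\<forall>j\<in>J. \<phi> e j = 0")
    case True
    have "card E < card J" using insert by auto
    from insert.IH[OF \<open>finite J\<close> this, of \<phi>] obtain c where
      c: "\<exists>j\<in>J. c j \<noteq> 0" "\<forall>f\<in>E. (\<Sum>j\<in>J. \<phi> f j * c j) = 0" by (elim exE conjE)
    have "(\<Sum>j\<in>J. \<phi> e j * c j) = 0" using True by (intro sum.neutral) simp
    with c show ?thesis by (intro exI[of _ c]) simp
  next
    case False
    then obtain p where p: "p \<in> J" "\<phi> e p \<noteq> 0" by auto
    define J' where "J' = J - {p}"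
    have "finite J'" "card E < card J'" using insert p by (auto simp: J'_def)
    from insert.IH[OF this, of "\<lambda>f j. \<phi> f j - \<phi> f p * \<phi> e j / \<phi> e p"]
    obtain c where c: "\<exists>j\<in>J'. c j \<noteq> 0"
      "\<forall>f\<in>E. (\<Sum>j\<in>J'. (\<phi> f j - \<phi> f p * \<phi> e j / \<phi> e p) * c j) = 0" by (elim exE conjE)
    define s where "s = (\<Sum>j\<in>J'. \<phi> e j * c j)"
    \<comment> \<open>Back substitution: equation \<open>e\<close> determines the unknown at the
      pivot \<open>p\<close>, which has been eliminated from the equations in
      \<open>E\<close>.\<close>
    define d where "d = c(p := - s / \<phi> e p)"
    have sums: "(\<Sum>j\<in>J. \<phi> f j * d j) = - \<phi> f p * s / \<phi> e p + (\<Sum>j\<in>J'. \<phi> f j * c j)" for f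
    proof -
      have "(\<Sum>j\<in>J'. \<phi> f j * d j) = (\<Sum>j\<in>J'. \<phi> f j * c j)"
        by (intro sum.cong) (auto simp: d_def J'_def)
      then show ?thesis using p \<open>finite J\<close> by (subst sum.remove[of _ p]) (auto simp: d_def J'_def)
    qed
    have "(\<Sum>j\<in>J. \<phi> f j * d j) = 0" if "f \<in> insert e E" for f
    proof (cases "f = e")
      case True
      then show ?thesis using p by (simp add: sums s_def)
    next
      case False
      with that have "f \<in> E" by auto
      from bspec[OF c(2) this] show ?thesis
        by (simp add: sums s_def left_diff_distrib sum_subtractf sum_distrib_left sum_divide_distrib
            mult.assoc sum_negf)
    qed
    moreover have "\<exists>j\<in>J. d j \<noteq> 0" using c(1) by (auto simp: d_def J'_def)
    ultimately show ?thesis by (intro exI[of _ d]) simp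
  qed
qed

text \<open>Takes the place of every dimension argument below, such as the intersection of subspaces
  in a min-max proof: the unknowns are coefficients, and each linear constraint costs one of
  them.\<close>

lemma nontrivial_solution:
  fixes \<phi> :: "'e \<Rightarrow> 'j \<Rightarrow> 'a::field"
  assumes "finite E" "finite J" "card E < card J"
  obtains c where "\<exists>j\<in>J. c j \<noteq> 0" "\<forall>e\<in>E. (\<Sum>j\<in>J. \<phi> e j * c j) = 0"
  using homogeneous_system_nontrivial[OF assms, of \<phi>] by blast

text \<open>\<open>y j i\<close> is coordinate \<open>i\<close> of the \<open>j\<close>th block
  vector. Subspaces of a block are never formed; they appear as conditions on the coefficients
  \<open>c\<close>.\<close>

definition comb :: "(nat \<Rightarrow> nat \<Rightarrow> complex) \<Rightarrow> (nat \<Rightarrow> complex) \<Rightarrow> nat \<Rightarrow> nat \<Rightarrow> complex" where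
  "comb y c m i = (\<Sum>j\<in>{1..m}. c j * y j i)"

lemma comb_diff: "comb y (\<lambda>j. c j - d j) m i = comb y c m i - comb y d m i"
  by (simp add: comb_def sum_subtractf algebra_simps)

lemma comb_scale: "comb y (\<lambda>j. a * c j) m i = a * comb y c m i"
  by (simp add: comb_def sum_distrib_left algebra_simps)

lemma comb_restrict:
  assumes "m \<le> m'"
  shows "comb y (\<lambda>j. if j \<le> m then c j else 0) m' i = comb y c m i"
proof -
  have "(\<Sum>j\<in>{1..m'}. (if j \<le> m then c j else 0) * y j i) = (\<Sum>j\<in>{1..m}. c j * y j i)"
    using assms by (intro sum.mono_neutral_cong_right) auto
  then show ?thesis by (simp add: comb_def)
qed

definition wsum :: "(nat \<Rightarrow> real) \<Rightarrow> nat set \<Rightarrow> (nat \<Rightarrow> complex) \<Rightarrow> real" where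
  "wsum w I v = (\<Sum>i\<in>I. w i * (cmod (v i))\<^sup>2)"

abbreviation sqs :: "nat set \<Rightarrow> (nat \<Rightarrow> complex) \<Rightarrow> real" where
  "sqs \<equiv> wsum (\<lambda>_. 1)"

lemma wsum_mono: "(\<And>i. i \<in> I \<Longrightarrow> w i \<le> w' i) \<Longrightarrow> wsum w I v \<le> wsum w' I v"
  unfolding wsum_def by (intro sum_mono mult_right_mono) auto

lemma wsum_cong: "(\<And>i. i \<in> I \<Longrightarrow> v i = v' i) \<Longrightarrow> wsum w I v = wsum w I v'"
  unfolding wsum_def by (intro sum.cong) auto

lemma wsum_scale: "wsum (\<lambda>i. a * w i) I v = a * wsum w I v"
  unfolding wsum_def by (simp add: sum_distrib_left mult.assoc)

lemma wsum_const: "wsum (\<lambda>i. a) I v = a * sqs I v"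
  using wsum_scale[of a "\<lambda>_. 1" I v] by simp

lemma wsum_diff: "wsum (\<lambda>i. w i - w' i) I v = wsum w I v - wsum w' I v"
  unfolding wsum_def by (simp add: sum_subtractf left_diff_distrib)

lemma wsum_const_diff:
  "wsum (\<lambda>i. x - w i) I v = x * sqs I v - wsum w I v"
  "wsum (\<lambda>i. w i - x) I v = wsum w I v - x * sqs I v"
  using wsum_diff[of "\<lambda>_. x" w I v] wsum_diff[of w "\<lambda>_. x" I v] wsum_const[of x I v] by simp_all

lemma wsum_zero: "(\<And>i. i \<in> I \<Longrightarrow> v i = 0) \<Longrightarrow> wsum w I v = 0"
  unfolding wsum_def by (intro sum.neutral) auto

lemma wsum_nonneg: "(\<And>i. i \<in> I \<Longrightarrow> 0 \<le> w i) \<Longrightarrow> 0 \<le> wsum w I v"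
  unfolding wsum_def by (intro sum_nonneg) auto

lemma wsum_split:
  assumes "t \<le> q" "q \<le> N"
  shows "wsum w {1..N} v = wsum w {1..t} v + wsum w {t<..q} v + wsum w {q<..N} v"
proof -
  have "{1..N} = {1..t} \<union> ({t<..q} \<union> {q<..N})" using assms by auto
  moreover have "{1..t} \<inter> ({t<..q} \<union> {q<..N}) = {}" "{t<..q} \<inter> {q<..N} = {}"
    using assms by auto
  ultimately show ?thesis unfolding wsum_def by (simp add: sum.union_disjoint del: One_nat_def)
qed

lemma sqs_eq_0D: "finite I \<Longrightarrow> sqs I v \<le> 0 \<Longrightarrow> i \<in> I \<Longrightarrow> v i = 0"
  unfolding wsum_def using sum_nonneg_eq_0_iff[of I "\<lambda>i. (cmod (v i))\<^sup>2"]
    sum_nonneg[of I "\<lambda>i. (cmod (v i))\<^sup>2"] by fastforce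

text \<open>The weight \<open>s\<close> distributes the error: \<open>ritz_comparison\<close> takes
  it proportional to the size of the tail, so that the factor of the main term tends to 1.\<close>

lemma young_cmod:
  assumes "s > 0"
  shows "(cmod a)\<^sup>2 \<le> (1 + s) * (cmod (a + b))\<^sup>2 + (1 + 1 / s) * (cmod b)\<^sup>2"
proof -
  let ?x = "cmod (a + b)" and ?y = "cmod b"
  have "cmod a \<le> ?x + ?y" using norm_triangle_ineq4[of "a + b" b] by simp
  then have "(cmod a)\<^sup>2 \<le> (?x + ?y)\<^sup>2" by (intro power_mono) auto
  also have "\<dots> \<le> (1 + s) * ?x\<^sup>2 + (1 + 1 / s) * ?y\<^sup>2"
  proof -
    have "0 \<le> (s * ?x - ?y)\<^sup>2 / s" using assms by simp
    also have "\<dots> = s * ?x\<^sup>2 - 2 * ?x * ?y + ?y\<^sup>2 / s"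
      using assms by (simp add: field_simps power2_eq_square)
    finally show ?thesis using assms by (simp add: field_simps power2_eq_square)
  qed
  finally show ?thesis .
qed

text \<open>Since 1 + x \<le> exp x, the perturbing factors multiply up to at most the exponential
  of a geometric series. The recursion may set in late: before step \<open>L\<close> only the bound
  \<open>A\<close> is available, which is compensated by the division by \<open>\<rho> ^ L\<close>.
  This is why \<open>\<rho>\<close> has to be positive.\<close>

lemma perturbed_geometric_recursion:
  fixes a :: "nat \<Rightarrow> real"
  assumes rec: "\<And>l. L \<le> l \<Longrightarrow> a (Suc l) \<le> \<rho> * (1 + C * r ^ l) * a l"
    and nn: "\<And>l. 0 \<le> a l" and bd: "\<And>l. a l \<le> A"
    and "0 < \<rho>" "\<rho> \<le> 1" "0 \<le> C" "0 \<le> r" "r < 1"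
  shows "a l \<le> A * exp (C / (1 - r)) / \<rho> ^ L * \<rho> ^ l"
proof -
  have A: "0 \<le> A" using nn[of 0] bd[of 0] by linarith
  have main: "a (L + m) \<le> A * \<rho> ^ m * exp (C * (\<Sum>j<m. r ^ (L + j)))" for m
  proof (induction m)
    case 0 then show ?case using bd by simp
  next
    case (Suc m)
    have "a (L + Suc m) \<le> \<rho> * (1 + C * r ^ (L + m)) * a (L + m)" using rec[of "L + m"] by simp
    also have "\<dots> \<le> \<rho> * exp (C * r ^ (L + m)) * (A * \<rho> ^ m * exp (C * (\<Sum>j<m. r ^ (L + j))))"
      using assms A by (intro mult_mono Suc.IH nn mult_nonneg_nonneg exp_ge_add_one_self) auto
    also have "\<dots> = A * \<rho> ^ Suc m * exp (C * (\<Sum>j<Suc m. r ^ (L + j)))"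
      by (simp add: exp_add distrib_left algebra_simps)
    finally show ?case .
  qed
  have sum_le: "(\<Sum>j<m. r ^ (L + j)) \<le> 1 / (1 - r)" for m
  proof -
    have "(\<Sum>j<m. r ^ (L + j)) \<le> (\<Sum>j<m. r ^ j)"
      using assms by (intro sum_mono power_decreasing) auto
    also have "\<dots> \<le> (\<Sum>j. r ^ j)" using assms by (intro sum_le_suminf summable_geometric) auto
    also have "\<dots> = 1 / (1 - r)" using assms by (intro suminf_geometric) auto
    finally show ?thesis .
  qed
  have ge1: "1 \<le> exp (C / (1 - r))" using assms by simp
  show ?thesis
  proof (cases "L \<le> l")
    case True
    define m where "m = l - L"
    have l: "l = L + m" using True by (simp add: m_def)
    have "C * (\<Sum>j<m. r ^ (L + j)) \<le> C / (1 - r)"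
      using mult_left_mono[OF sum_le \<open>0 \<le> C\<close>] by (simp add: divide_inverse)
    then have "a l \<le> A * \<rho> ^ m * exp (C / (1 - r))"
      using main[of m] assms A l
      by (smt (verit) exp_le_cancel_iff mult_left_mono mult_nonneg_nonneg zero_le_power)
    then show ?thesis using l assms by (simp add: power_add mult.commute mult.left_commute)
  next
    case False
    have "\<rho> ^ L \<le> \<rho> ^ l" using False assms by (intro power_decreasing) auto
    then have "1 \<le> \<rho> ^ l / \<rho> ^ L" using assms by simp
    from mult_mono[OF ge1 this] have "1 \<le> exp (C / (1 - r)) * (\<rho> ^ l / \<rho> ^ L)" by simp
    from mult_left_mono[OF this A] bd[of l] show ?thesis by (simp add: mult.assoc)
  qed
qed


section \<open>Block iteration with a diagonal operator\<close>

text \<open>\<open>b\<close> is a threshold above \<open>\<beta> (q + 1)\<close> that the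
  \<open>q\<close>th Ritz value reaches at the start. All constants obtained in this locale depend
  on its parameters alone and are thus common to all runs.\<close>

locale block_iteration =
  fixes N q :: nat and \<beta> :: "nat \<Rightarrow> real" and b :: real
  assumes q: "1 \<le> q" "q < N"
    and antimono: "\<And>i j. 1 \<le> i \<Longrightarrow> i \<le> j \<Longrightarrow> j \<le> N \<Longrightarrow> \<beta> j \<le> \<beta> i"
    and b: "\<beta> (q + 1) < b" "b \<le> \<beta> q"
begin

text \<open>Half the length of the interval from \<open>\<beta> N\<close> to
  \<open>\<beta> (q + 1)\<close>, divided by the distance of \<open>\<beta> t\<close> from its
  centre: the maximal modulus on the interval of the affine polynomial that is 1 at
  \<open>\<beta> t\<close> and vanishes at the centre.\<close>

definition rate :: "nat \<Rightarrow> real" where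
  "rate t = (\<beta> (q + 1) - \<beta> N) / (2 * \<beta> t - \<beta> N - \<beta> (q + 1))"

text \<open>\<open>y l\<close> stands for Ritz vectors in eigencoordinates and
  \<open>\<eta> l\<close> for their Ritz values with respect to B. The last condition is the min-max
  principle for the next iterate: the trial space contains the image of the block under every affine
  filter, and m - t constraints on m coefficients leave at least t dimensions. The restriction
  \<open>x \<le> \<beta> 1\<close> makes room for the deflated eigenvectors in the test space of
  \<open>step_bound\<close>.\<close>

definition is_run :: "(nat \<Rightarrow> nat \<Rightarrow> nat \<Rightarrow> complex) \<Rightarrow> (nat \<Rightarrow> nat \<Rightarrow> real) \<Rightarrow> bool" where
  "is_run y \<eta> \<longleftrightarrow>
     b \<le> \<eta> 0 q \<and>
     (\<forall>l s t. 1 \<le> s \<and> s \<le> t \<and> t \<le> q \<longrightarrow> \<eta> l t \<le> \<eta> l s) \<and>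
     (\<forall>l c. (\<forall>i\<in>{1..N}. comb (y l) c q i = 0) \<longrightarrow> (\<forall>j\<in>{1..q}. c j = 0)) \<and>
     (\<forall>l t c. 1 \<le> t \<and> t \<le> q \<longrightarrow>
        \<eta> l t * sqs {1..N} (comb (y l) c t) \<le> wsum \<beta> {1..N} (comb (y l) c t)) \<and>
     (\<forall>l t m p0 p1 x. 1 \<le> t \<and> t \<le> m \<and> m \<le> q \<and> x \<le> \<beta> 1 \<and>
        (\<forall>c v. (\<exists>j\<in>{1..m}. c j \<noteq> 0) \<and> (\<forall>i\<in>{t<..m}. comb (y l) c m i = 0) \<and>
            v = (\<lambda>i. complex_of_real (p0 + p1 * \<beta> i) * comb (y l) c m i) \<longrightarrow>
            (\<exists>i\<in>{1..N}. v i \<noteq> 0) \<and> x * sqs {1..N} v \<le> wsum \<beta> {1..N} v) \<longrightarrow>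
        x \<le> \<eta> (Suc l) t)"

lemma
  assumes "is_run y \<eta>"
  shows run_start: "b \<le> \<eta> 0 q"
    and run_mono: "\<And>l s t. 1 \<le> s \<Longrightarrow> s \<le> t \<Longrightarrow> t \<le> q \<Longrightarrow> \<eta> l t \<le> \<eta> l s"
    and run_indep: "\<And>l c j. (\<And>i. i \<in> {1..N} \<Longrightarrow> comb (y l) c q i = 0) \<Longrightarrow> j \<in> {1..q} \<Longrightarrow> c j = 0"
    and run_ritz: "\<And>l t c. 1 \<le> t \<Longrightarrow> t \<le> q \<Longrightarrow>
        \<eta> l t * sqs {1..N} (comb (y l) c t) \<le> wsum \<beta> {1..N} (comb (y l) c t)"
  using assms unfolding is_run_def by blast+

lemma run_step:
  assumes "is_run y \<eta>" "1 \<le> t" "t \<le> m" "m \<le> q" "x \<le> \<beta> 1"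
    and "\<And>c v. (\<exists>j\<in>{1..m}. c j \<noteq> 0) \<Longrightarrow> (\<And>i. i \<in> {t<..m} \<Longrightarrow> comb (y l) c m i = 0) \<Longrightarrow>
            v = (\<lambda>i. complex_of_real (p0 + p1 * \<beta> i) * comb (y l) c m i) \<Longrightarrow>
            (\<exists>i\<in>{1..N}. v i \<noteq> 0) \<and> x * sqs {1..N} v \<le> wsum \<beta> {1..N} v"
  shows "x \<le> \<eta> (Suc l) t"
proof -
  have "\<forall>l t m p0 p1 x. 1 \<le> t \<and> t \<le> m \<and> m \<le> q \<and> x \<le> \<beta> 1 \<and>
        (\<forall>c v. (\<exists>j\<in>{1..m}. c j \<noteq> 0) \<and> (\<forall>i\<in>{t<..m}. comb (y l) c m i = 0) \<and>
            v = (\<lambda>i. complex_of_real (p0 + p1 * \<beta> i) * comb (y l) c m i) \<longrightarrow>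
            (\<exists>i\<in>{1..N}. v i \<noteq> 0) \<and> x * sqs {1..N} v \<le> wsum \<beta> {1..N} v) \<longrightarrow>
        x \<le> \<eta> (Suc l) t"
    using assms(1) unfolding is_run_def by blast
  then show ?thesis using assms by blast
qed

lemma gap: "\<beta> (q + 1) < \<beta> q" using b by simp

lemma beta_bounds:
  assumes "1 \<le> t" "t \<le> q"
  shows "\<beta> (q + 1) < \<beta> t" "\<beta> q \<le> \<beta> t" "\<beta> N \<le> \<beta> (q + 1)" "\<beta> t \<le> \<beta> 1" "b \<le> \<beta> t"
  using antimono[of t q] antimono[of "q + 1" N] antimono[of 1 t] assms q gap b by auto

lemma rate_bounds:
  assumes "1 \<le> t" "t \<le> q"
  shows "0 \<le> rate t" "rate t < 1" "rate t \<le> rate q"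
proof -
  note * = beta_bounds[OF assms] beta_bounds[of q] q
  then show "0 \<le> rate t" "rate t < 1" by (auto simp: rate_def divide_simps)
  show "rate t \<le> rate q" unfolding rate_def using * by (intro divide_left_mono mult_pos_pos) auto
qed

lemma rate_sq_le:
  assumes "1 \<le> t" "t \<le> q"
  shows "(rate t)\<^sup>2 \<le> (rate q)\<^sup>2" "(rate t)\<^sup>2 < 1"
  using rate_bounds[OF assms] by (auto intro!: power_mono simp: abs_square_less_1)

lemma comb_nonzero:
  assumes "is_run y \<eta>" "m \<le> q" "\<exists>j\<in>{1..m}. c j \<noteq> 0"
  shows "\<exists>i\<in>{1..N}. comb (y l) c m i \<noteq> 0"
proof (rule ccontr)
  assume "\<not> ?thesis"
  then have "comb (y l) (\<lambda>j. if j \<le> m then c j else 0) q i = 0" if "i \<in> {1..N}" for i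
    using that comb_restrict[OF assms(2)] by auto
  from run_indep[OF assms(1) this] assms show False by fastforce
qed

text \<open>Some nontrivial combination of the first \<open>t\<close> block vectors vanishes in the
  first t - 1 coordinates. Its Rayleigh quotient is at most \<open>\<beta> t\<close>, but at least
  the Ritz value.\<close>

lemma run_le_beta:
  assumes "is_run y \<eta>" "1 \<le> t" "t \<le> q"
  shows "\<eta> l t \<le> \<beta> t"
proof -
  have card: "card {1..<t} < card {1..t}" using assms by simp
  obtain c where c: "\<exists>j\<in>{1..t}. c j \<noteq> 0"
    "\<forall>i\<in>{1..<t}. (\<Sum>j\<in>{1..t}. y l j i * c j) = 0"
    by (rule nontrivial_solution[OF finite_atLeastLessThan finite_atLeastAtMost card,
          of "\<lambda>i j. y l j i"])
  define v where "v = comb (y l) c t"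
  have v0: "v i = 0" if "i \<in> {1..<t}" for i
    using bspec[OF c(2) that] by (simp add: v_def comb_def mult.commute)
  have "wsum \<beta> {1..N} v \<le> \<beta> t * sqs {1..N} v"
    unfolding wsum_def sum_distrib_left
  proof (intro sum_mono)
    fix i assume "i \<in> {1..N}"
    then show "\<beta> i * (cmod (v i))\<^sup>2 \<le> \<beta> t * (1 * (cmod (v i))\<^sup>2)"
      using v0[of i] antimono[of t i] assms by (cases "i < t") (auto intro!: mult_right_mono)
  qed
  with run_ritz[OF assms, of l c] have "\<eta> l t * sqs {1..N} v \<le> \<beta> t * sqs {1..N} v"
    by (simp add: v_def)
  moreover have "0 < sqs {1..N} v"
    using comb_nonzero[OF assms(1,3) c(1), of l] sqs_eq_0D[of "{1..N}" v]
    unfolding v_def[symmetric] by (meson finite_atLeastAtMost not_le)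
  ultimately show ?thesis by simp
qed

text \<open>The constant filter 1 shows that the trial space contains the current block.\<close>

lemma run_increasing:
  assumes "is_run y \<eta>" "1 \<le> t" "t \<le> q"
  shows "\<eta> l t \<le> \<eta> (Suc l) t"
proof (rule run_step[OF assms(1,2) order_refl assms(3), where ?p0.0 = 1 and ?p1.0 = 0])
  show "\<eta> l t \<le> \<beta> 1" using run_le_beta[OF assms, of l] beta_bounds[OF assms(2,3)] by simp
  fix c v
  assume c: "\<exists>j\<in>{1..t}. c j \<noteq> 0" and
    v: "v = (\<lambda>i. complex_of_real (1 + 0 * \<beta> i) * comb (y l) c t i)"
  then have "v = comb (y l) c t" by auto
  then show "(\<exists>i\<in>{1..N}. v i \<noteq> 0) \<and> \<eta> l t * sqs {1..N} v \<le> wsum \<beta> {1..N} v"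
    using run_ritz[OF assms, of l c] comb_nonzero[OF assms(1,3) c] by auto
qed

lemma run_increasing':
  assumes "is_run y \<eta>" "1 \<le> t" "t \<le> q" "l \<le> l'"
  shows "\<eta> l t \<le> \<eta> l' t"
  using lift_Suc_mono_le[of "\<lambda>l. \<eta> l t"] run_increasing assms by blast

lemma run_ge_b:
  assumes "is_run y \<eta>" "1 \<le> t" "t \<le> q"
  shows "b \<le> \<eta> l t"
  using run_start[OF assms(1)] run_increasing'[OF assms(1) q(1) order_refl le0, of l]
    run_mono[OF assms(1,2,3) order_refl, of l] by linarith

lemma run_ritz_q:
  assumes "is_run y \<eta>" "x \<le> \<eta> l q"
  shows "x * sqs {1..N} (comb (y l) c q) \<le> wsum \<beta> {1..N} (comb (y l) c q)"
proof -
  have "0 \<le> sqs {1..N} (comb (y l) c q)" by (intro wsum_nonneg) auto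
  from mult_right_mono[OF assms(2) this] run_ritz[OF assms(1) q(1) order_refl, of l c]
  show ?thesis by linarith
qed

text \<open>A Rayleigh quotient bound becomes a comparison of tail and leading part with nonnegative
  weights when \<open>x\<close> lies between them. In this form the filter can act on both sides
  separately.\<close>

lemma wsum_shift_le:
  assumes "x * sqs {1..N} v \<le> wsum \<beta> {1..N} v" "t \<le> q" "\<And>i. i \<in> {t<..q} \<Longrightarrow> v i = 0"
  shows "wsum (\<lambda>i. x - \<beta> i) {q<..N} v \<le> wsum (\<lambda>i. \<beta> i - x) {1..t} v"
proof -
  have "wsum w {t<..q} v = 0" for w using assms(3) by (intro wsum_zero) auto
  then show ?thesis
    using assms(1) wsum_split[OF assms(2), of N \<beta> v] wsum_split[OF assms(2), of N "\<lambda>_. 1" v] q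
    by (simp add: wsum_const_diff algebra_simps)
qed

lemma wsum_shift_ge:
  assumes "wsum (\<lambda>i. x - \<beta> i) {q<..N} v \<le> wsum (\<lambda>i. \<beta> i - x) {1..t} v"
    "t \<le> q" "\<And>i. i \<in> {t<..q} \<Longrightarrow> v i = 0"
  shows "x * sqs {1..N} v \<le> wsum \<beta> {1..N} v"
proof -
  have "wsum w {t<..q} v = 0" for w using assms(3) by (intro wsum_zero) auto
  then show ?thesis
    using assms(1) wsum_split[OF assms(2), of N \<beta> v] wsum_split[OF assms(2), of N "\<lambda>_. 1" v] q
    by (simp add: wsum_const_diff algebra_simps)
qed

text \<open>The a priori bound on the graph map W of the block: a Rayleigh quotient above
  \<open>\<beta> (q + 1)\<close> cannot come from the tail alone.\<close>

lemma tail_bound: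
  assumes "is_run y \<eta>"
  shows "(b - \<beta> (q + 1)) * sqs {q<..N} (comb (y l) c q) \<le> (\<beta> 1 - b) * sqs {1..q} (comb (y l) c q)"
proof -
  let ?v = "comb (y l) c q"
  have "wsum (\<lambda>i. b - \<beta> i) {q<..N} ?v \<le> wsum (\<lambda>i. \<beta> i - b) {1..q} ?v"
    using wsum_shift_le[OF run_ritz_q[OF assms run_ge_b[OF assms q(1) order_refl]], of q] by auto
  moreover have "wsum (\<lambda>i. b - \<beta> (q + 1)) {q<..N} ?v \<le> wsum (\<lambda>i. b - \<beta> i) {q<..N} ?v"
    using antimono by (intro wsum_mono) auto
  moreover have "wsum (\<lambda>i. \<beta> i - b) {1..q} ?v \<le> wsum (\<lambda>i. \<beta> 1 - b) {1..q} ?v"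
    using antimono q by (intro wsum_mono) auto
  ultimately show ?thesis unfolding wsum_const[of "b - _"] wsum_const[of "_ - b"] by linarith
qed

lemma comb_injective:
  assumes "is_run y \<eta>" "\<And>i. i \<in> {1..q} \<Longrightarrow> comb (y l) c q i = 0" "j \<in> {1..q}"
  shows "c j = 0"
proof (rule run_indep[OF assms(1) _ assms(3)])
  fix i assume i: "i \<in> {1..N}"
  have "sqs {1..q} (comb (y l) c q) = 0" using assms(2) by (intro wsum_zero) auto
  with tail_bound[OF assms(1), of l c] b have "sqs {q<..N} (comb (y l) c q) \<le> 0"
    by (simp add: mult_le_0_iff)
  from sqs_eq_0D[OF _ this, of i] assms(2)[of i] i show "comb (y l) c q i = 0" by force
qed

text \<open>An injective linear map between spaces of dimension \<open>q\<close> is onto. Unknown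
  number 0 is the factor of \<open>f\<close>, so that \<open>q\<close> equations meet q + 1
  unknowns; injectivity excludes that this factor vanishes, and division by it gives the
  preimage.\<close>

lemma comb_interpolate:
  assumes "is_run y \<eta>"
  shows "\<exists>c. \<forall>i\<in>{1..q}. comb (y l) c q i = f i"
proof -
  have card: "card {1..q} < card {0..q}" by simp
  obtain d where d: "\<exists>j\<in>{0..q}. d j \<noteq> 0"
    "\<forall>i\<in>{1..q}. (\<Sum>j\<in>{0..q}. (if j = 0 then f i else y l j i) * d j) = 0"
    by (rule nontrivial_solution[OF finite_atLeastAtMost finite_atLeastAtMost card,
          of "\<lambda>i j. if j = 0 then f i else y l j i"])
  have eq: "f i * d 0 + comb (y l) d q i = 0" if "i \<in> {1..q}" for i
  proof -
    have "(\<Sum>j\<in>{0..q}. (if j = 0 then f i else y l j i) * d j)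
        = f i * d 0 + (\<Sum>j\<in>{1..q}. (if j = 0 then f i else y l j i) * d j)"
      by (subst sum.atLeast_Suc_atMost) auto
    also have "(\<Sum>j\<in>{1..q}. (if j = 0 then f i else y l j i) * d j) = comb (y l) d q i"
      unfolding comb_def by (intro sum.cong) auto
    finally show ?thesis using bspec[OF d(2) that] by simp
  qed
  have "d 0 \<noteq> 0"
  proof
    assume "d 0 = 0"
    then have z: "comb (y l) d q i = 0" if "i \<in> {1..q}" for i using eq[OF that] by simp
    have "d j = 0" if "j \<in> {1..q}" for j by (rule comb_injective[OF assms z that])
    with \<open>d 0 = 0\<close> d(1) show False by (metis atLeastAtMost_iff less_one not_le)
  qed
  have "comb (y l) (\<lambda>j. (- 1 / d 0) * d j) q i = f i" if "i \<in> {1..q}" for i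
  proof -
    have "comb (y l) d q i = - (f i * d 0)" using eq[OF that] by (rule minus_unique[symmetric])
    then show ?thesis unfolding comb_scale using \<open>d 0 \<noteq> 0\<close> by simp
  qed
  then show ?thesis by blast
qed

text \<open>The filter is the linear Chebyshev polynomial of the interval
  \<open>[\<beta> N, \<beta> (q + 1)]\<close>, normalised to 1 at \<open>\<beta> t\<close>.\<close>

lemma filter_step:
  assumes run: "is_run y \<eta>" and t: "1 \<le> t" "t \<le> q"
    and \<xi>: "\<beta> (q + 1) < \<xi>" "\<xi> \<le> \<beta> t" and A: "0 \<le> A" "(rate t)\<^sup>2 * A \<le> 1"
    and hyp: "\<And>c. (\<And>i. i \<in> {t<..q} \<Longrightarrow> comb (y l) c q i = 0) \<Longrightarrow>
      wsum (\<lambda>i. \<xi> - \<beta> i) {q<..N} (comb (y l) c q)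
        \<le> A * wsum (\<lambda>i. \<beta> i - \<xi>) {1..t} (comb (y l) c q)"
  shows "(\<beta> t - \<eta> (Suc l) t) * (\<xi> - \<beta> (q + 1))
    \<le> (rate t)\<^sup>2 * A * (\<beta> t - \<xi>) * (\<eta> (Suc l) t - \<beta> (q + 1))"
proof -
  note bb = beta_bounds[OF t]
  \<comment> \<open>\<open>x\<close> is the value that turns the claim into an equality when it
    replaces \<open>\<eta> (Suc l) t\<close>. The claim is monotone in that quantity, so
    \<open>x \<le> \<eta> (Suc l) t\<close> suffices.\<close>
  define R where "R = (rate t)\<^sup>2 * A"
  define X where "X = R * (\<beta> t - \<xi>) / (\<xi> - \<beta> (q + 1))"
  define x where "x = (\<beta> t + X * \<beta> (q + 1)) / (1 + X)"
  have R: "0 \<le> R" "R \<le> 1" using A by (auto simp: R_def)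
  have X: "0 \<le> X" using R \<xi> by (simp add: X_def)
  have x1: "\<beta> t - x = X * (\<beta> t - \<beta> (q + 1)) / (1 + X)"
    and x2: "x - \<beta> (q + 1) = (\<beta> t - \<beta> (q + 1)) / (1 + X)"
    using X by (auto simp: x_def field_simps)
  have eq: "\<beta> t - x = X * (x - \<beta> (q + 1))" by (simp only: x1 x2 times_divide_eq_right)
  have "x \<le> \<beta> t" using x1 X bb by (smt (verit) divide_nonneg_pos mult_nonneg_nonneg)
  have "\<beta> (q + 1) < x" using x2 X bb by (smt (verit) divide_pos_pos)
  \<comment> \<open>\<open>k\<close> is the total factor by which the filter shrinks the tail side.
    On the leading side \<open>k * (\<beta> i - \<xi>) \<le> \<beta> i - x\<close> is required; by
    \<open>kx\<close> this is an equality at \<open>\<beta> t\<close>, and it extends to larger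
    \<open>\<beta> i\<close> because \<open>k \<le> 1\<close>.\<close>
  define k where "k = R * (x - \<beta> (q + 1)) / (\<xi> - \<beta> (q + 1))"
  have k0: "0 \<le> k" using R \<open>\<beta> (q + 1) < x\<close> \<xi> by (simp add: k_def)
  have kx: "\<beta> t - x = k * (\<beta> t - \<xi>)" using \<xi> by (simp add: eq X_def k_def)
  \<comment> \<open>Here the bound \<open>R \<le> 1\<close> enters: the step must not lose ground
    against \<open>\<xi>\<close>.\<close>
  have "\<xi> \<le> x"
  proof -
    have "X * (\<xi> - \<beta> (q + 1)) \<le> \<beta> t - \<xi>"
      using \<xi> R mult_left_le_one_le[of "\<beta> t - \<xi>" R] by (simp add: X_def)
    then have "0 \<le> (\<beta> t - \<xi>) - X * (\<xi> - \<beta> (q + 1))" by simp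
    also have "\<dots> = (x - \<xi>) * (1 + X)" using X by (simp add: x_def field_simps)
    finally show ?thesis using X by (simp add: zero_le_mult_iff)
  qed
  have k1: "k \<le> 1"
  proof (cases "\<xi> = \<beta> t")
    case True
    then have "x = \<xi>" using \<open>\<xi> \<le> x\<close> \<open>x \<le> \<beta> t\<close> by simp
    then show ?thesis using R \<xi> by (simp add: k_def)
  next
    case False
    then have "0 < \<beta> t - \<xi>" using \<xi> by simp
    moreover have "k * (\<beta> t - \<xi>) \<le> 1 * (\<beta> t - \<xi>)" unfolding kx[symmetric] using \<open>\<xi> \<le> x\<close> by simp
    ultimately show ?thesis by (rule mult_right_le_imp_le[rotated])
  qed
  define mid where "mid = (\<beta> N + \<beta> (q + 1)) / 2"
  have mid: "0 < \<beta> t - mid" using bb by (simp add: mid_def)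
  define p where "p i = - mid / (\<beta> t - mid) + 1 / (\<beta> t - mid) * \<beta> i" for i
  have p_eq: "p i = (\<beta> i - mid) / (\<beta> t - mid)" for i by (simp add: p_def diff_divide_distrib)
  have p_low: "1 \<le> p i" if "i \<in> {1..t}" for i
    using antimono[of i t] that t q mid by (simp add: p_eq)
  have p_high: "(p i)\<^sup>2 \<le> (rate t)\<^sup>2" if "i \<in> {q<..N}" for i
  proof -
    have "\<beta> i \<le> \<beta> (q + 1)" "\<beta> N \<le> \<beta> i" using antimono that by auto
    then have "\<bar>\<beta> i - mid\<bar> \<le> (\<beta> (q + 1) - \<beta> N) / 2" by (simp add: mid_def abs_if field_simps)
    from divide_right_mono[OF this less_imp_le[OF mid]]
    have "\<bar>p i\<bar> \<le> (\<beta> (q + 1) - \<beta> N) / 2 / (\<beta> t - mid)"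
      unfolding p_eq abs_divide using mid by simp
    also have "\<dots> = rate t" by (simp add: rate_def mid_def algebra_simps)
    finally show ?thesis using abs_le_square_iff[of "p i" "rate t"] rate_bounds[OF t] by simp
  qed
  have "x \<le> \<eta> (Suc l) t"
  proof (rule run_step[OF run t order_refl, where ?p0.0 = "- mid / (\<beta> t - mid)" and ?p1.0 = "1 / (\<beta> t - mid)"])
    show "x \<le> \<beta> 1" using \<open>x \<le> \<beta> t\<close> bb by simp
    fix c v
    assume c: "\<exists>j\<in>{1..q}. c j \<noteq> 0" "\<And>i. i \<in> {t<..q} \<Longrightarrow> comb (y l) c q i = 0"
      and "v = (\<lambda>i. complex_of_real (- mid / (\<beta> t - mid) + 1 / (\<beta> t - mid) * \<beta> i) * comb (y l) c q i)"
    define w where "w = comb (y l) c q"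
    have v: "v i = complex_of_real (p i) * w i" for i by (simp add: \<open>v = _\<close> p_def w_def)
    have w0: "w i = 0" if "i \<in> {t<..q}" for i using c(2)[OF that] by (simp add: w_def)
    note hyp_w = hyp[OF c(2), folded w_def]
    have "\<exists>i\<in>{1..t}. w i \<noteq> 0"
    proof (rule ccontr)
      assume "\<not> ?thesis"
      then have z: "w i = 0" if "i \<in> {1..q}" for i using w0[of i] that by force
      from comb_injective[OF run, of l c] z c(1) show False unfolding w_def by blast
    qed
    then obtain i where "i \<in> {1..t}" "w i \<noteq> 0" by blast
    then have "i \<in> {1..N}" "v i \<noteq> 0" using p_low[of i] t q by (auto simp: v)
    then have nz: "\<exists>i\<in>{1..N}. v i \<noteq> 0" by blast
    \<comment> \<open>As \<open>\<xi> \<le> x\<close>, the quotient of \<open>x - \<beta> i\<close>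
      and \<open>\<xi> - \<beta> i\<close> is largest at i = q + 1. The filter contributes the
      square of the rate.\<close>
    have "wsum (\<lambda>i. x - \<beta> i) {q<..N} v \<le> (rate t)\<^sup>2 * ((x - \<beta> (q + 1)) / (\<xi> - \<beta> (q + 1)))
        * wsum (\<lambda>i. \<xi> - \<beta> i) {q<..N} w"
      unfolding wsum_def sum_distrib_left
    proof (intro sum_mono)
      fix i assume i: "i \<in> {q<..N}"
      have bi: "\<beta> i \<le> \<beta> (q + 1)" using antimono i by auto
      have "0 \<le> (x - \<xi>) * (\<beta> (q + 1) - \<beta> i)" using bi \<open>\<xi> \<le> x\<close> by simp
      then have "(x - \<beta> i) * (\<xi> - \<beta> (q + 1)) \<le> (x - \<beta> (q + 1)) * (\<xi> - \<beta> i)"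
        by (simp add: algebra_simps)
      then have *: "x - \<beta> i \<le> (x - \<beta> (q + 1)) / (\<xi> - \<beta> (q + 1)) * (\<xi> - \<beta> i)"
        using \<xi> by (simp add: field_simps)
      have "(x - \<beta> i) * (cmod (v i))\<^sup>2 = (p i)\<^sup>2 * (x - \<beta> i) * (cmod (w i))\<^sup>2"
        by (simp add: v norm_mult power_mult_distrib)
      also have "\<dots> \<le> (rate t)\<^sup>2 * ((x - \<beta> (q + 1)) / (\<xi> - \<beta> (q + 1)) * (\<xi> - \<beta> i)) * (cmod (w i))\<^sup>2"
        using * p_high[OF i] bi \<open>\<beta> (q + 1) < x\<close> by (intro mult_right_mono mult_mono) auto
      finally show "(x - \<beta> i) * (cmod (v i))\<^sup>2
        \<le> (rate t)\<^sup>2 * ((x - \<beta> (q + 1)) / (\<xi> - \<beta> (q + 1))) * ((\<xi> - \<beta> i) * (cmod (w i))\<^sup>2)"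
        by (simp add: mult.assoc)
    qed
    also have "\<dots> \<le> (rate t)\<^sup>2 * ((x - \<beta> (q + 1)) / (\<xi> - \<beta> (q + 1)))
        * (A * wsum (\<lambda>i. \<beta> i - \<xi>) {1..t} w)"
      using hyp_w \<open>\<beta> (q + 1) < x\<close> \<xi> by (intro mult_left_mono) auto
    also have "\<dots> = k * wsum (\<lambda>i. \<beta> i - \<xi>) {1..t} w" by (simp add: k_def R_def)
    also have "\<dots> \<le> wsum (\<lambda>i. \<beta> i - x) {1..t} v"
      unfolding wsum_def sum_distrib_left
    proof (intro sum_mono)
      fix i assume i: "i \<in> {1..t}"
      have bi: "\<beta> t \<le> \<beta> i" using antimono i t q by auto
      have "0 \<le> (1 - k) * (\<beta> i - \<beta> t)" using bi k1 by simp
      then have "k * (\<beta> i - \<xi>) \<le> \<beta> i - x" using kx by (simp add: algebra_simps)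
      also have "\<dots> \<le> (p i)\<^sup>2 * (\<beta> i - x)"
        using p_low[OF i] bi \<open>x \<le> \<beta> t\<close> mult_right_mono[of 1 "(p i)\<^sup>2" "\<beta> i - x"] by simp
      finally have "k * (\<beta> i - \<xi>) * (cmod (w i))\<^sup>2 \<le> (p i)\<^sup>2 * (\<beta> i - x) * (cmod (w i))\<^sup>2"
        by (intro mult_right_mono) auto
      then show "k * ((\<beta> i - \<xi>) * (cmod (w i))\<^sup>2) \<le> (\<beta> i - x) * (cmod (v i))\<^sup>2"
        by (simp add: v norm_mult power_mult_distrib mult.assoc mult.left_commute)
    qed
    finally have "x * sqs {1..N} v \<le> wsum \<beta> {1..N} v"
      using w0 t by (intro wsum_shift_ge) (auto simp: v)
    with nz show "(\<exists>i\<in>{1..N}. v i \<noteq> 0) \<and> x * sqs {1..N} v \<le> wsum \<beta> {1..N} v" ..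
  qed
  then have "\<beta> t - \<eta> (Suc l) t \<le> X * (\<eta> (Suc l) t - \<beta> (q + 1))"
    using eq mult_left_mono[of "x - \<beta> (q + 1)" "\<eta> (Suc l) t - \<beta> (q + 1)" X, OF _ X] by linarith
  then have "(\<beta> t - \<eta> (Suc l) t) * (\<xi> - \<beta> (q + 1))
      \<le> X * (\<eta> (Suc l) t - \<beta> (q + 1)) * (\<xi> - \<beta> (q + 1))"
    using \<xi> by (intro mult_right_mono) auto
  also have "\<dots> = R * (\<beta> t - \<xi>) * (\<eta> (Suc l) t - \<beta> (q + 1))" using \<xi> by (simp add: X_def)
  finally show ?thesis by (simp add: R_def)
qed

end

lemma wsum_split2:
  assumes "q \<le> N"
  shows "wsum w {1..N} v = wsum w {1..q} v + wsum w {q<..N} v"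
  using wsum_split[of q q N w v] assms by (simp add: wsum_def)

section \<open>Downward induction over the indices of the Ritz values\<close>

context block_iteration
begin

text \<open>A contraction factor that serves all indices at once. The value 1/2 keeps it positive
  when the tail interval is a point and the rate is 0, since the recursion divides by its
  powers.\<close>

definition contr :: real where "contr = max ((rate q)\<^sup>2) (1 / 2)"

lemma contr: "0 < contr" "contr < 1"
  using rate_sq_le[OF q(1) order_refl] by (auto simp: contr_def)

lemma rate_le_contr: "1 \<le> t \<Longrightarrow> t \<le> q \<Longrightarrow> (rate t)\<^sup>2 \<le> contr"
  using rate_sq_le by (force simp: contr_def)

lemma contr_eventually_small:
  assumes "0 < (e::real)"
  obtains L where "\<And>l. L \<le> l \<Longrightarrow> C * contr ^ l \<le> e"
proof -
  have "(\<lambda>l. C * contr ^ l) \<longlonglongrightarrow> C * 0"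
    using contr by (intro tendsto_mult_left LIMSEQ_power_zero) auto
  then have "eventually (\<lambda>l. C * contr ^ l < e) sequentially"
    using assms by (intro order_tendstoD(2)) auto
  then show ?thesis using that by (meson eventually_sequentially less_imp_le)
qed

text \<open>The error measure that a step multiplies by the squared rate. It has
  \<open>\<beta> (q + 1)\<close> where the final estimate has \<open>\<beta> N\<close>, hence it is
  the larger one, and it is finite because Ritz values stay above \<open>b\<close>.\<close>

definition ratio :: "(nat \<Rightarrow> nat \<Rightarrow> real) \<Rightarrow> nat \<Rightarrow> nat \<Rightarrow> real" where
  "ratio \<eta> t l = (\<beta> t - \<eta> l t) / (\<eta> l t - \<beta> (q + 1))"

definition ratio_max :: real where "ratio_max = (\<beta> 1 - \<beta> (q + 1)) / (b - \<beta> (q + 1))"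

lemma ratio_bounds:
  assumes "is_run y \<eta>" "1 \<le> t" "t \<le> q"
  shows "0 \<le> ratio \<eta> t l" "ratio \<eta> t l \<le> ratio_max"
proof -
  have *: "b \<le> \<eta> l t" "\<eta> l t \<le> \<beta> t" "\<beta> t \<le> \<beta> 1"
    using run_ge_b run_le_beta beta_bounds assms by auto
  then show "0 \<le> ratio \<eta> t l" using b by (simp add: ratio_def)
  show "ratio \<eta> t l \<le> ratio_max"
    unfolding ratio_def ratio_max_def using * b by (intro frac_le) auto
qed

text \<open>The constant precedes the run, so that it can later serve all runs from the same initial
  subspace.\<close>

definition fast :: "nat \<Rightarrow> bool" where
  "fast t \<longleftrightarrow> (\<exists>C>0. \<forall>y \<eta> l. is_run y \<eta> \<longrightarrow> ratio \<eta> t l \<le> C * (rate t) ^ (2 * l))"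

text \<open>Concerns exactly the vectors to which the filter is applied. They are in general no
  combinations of the first \<open>t\<close> Ritz vectors, so this is not contained in the
  convergence of the Ritz value.\<close>

definition ritz_lower :: "nat \<Rightarrow> bool" where
  "ritz_lower t \<longleftrightarrow> (\<exists>C\<ge>0. \<exists>L. \<forall>y \<eta> l c. is_run y \<eta> \<longrightarrow> L \<le> l \<longrightarrow>
     (\<forall>i\<in>{t<..q}. comb (y l) c q i = 0) \<longrightarrow>
     (\<beta> t - C * contr ^ l) * sqs {1..N} (comb (y l) c q) \<le> wsum \<beta> {1..N} (comb (y l) c q))"

text \<open>Decay of the squared norm of the graph map W, restricted to the coordinates t+1, ...,
  q.\<close>

definition tail_small :: "nat \<Rightarrow> bool" where
  "tail_small t \<longleftrightarrow> (\<exists>C\<ge>0. \<exists>L. \<forall>y \<eta> l c. is_run y \<eta> \<longrightarrow> L \<le> l \<longrightarrow>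
     (\<forall>i\<in>{1..t}. comb (y l) c q i = 0) \<longrightarrow>
     sqs {q<..N} (comb (y l) c q) \<le> C * contr ^ l * sqs {t<..q} (comb (y l) c q))"

text \<open>The sharp rate is available only when it is positive; \<open>contr\<close> always is,
  and its geometric decay is all that the induction needs.\<close>

lemma ratio_recursion:
  assumes t: "1 \<le> t" "t \<le> q" and "0 \<le> C"
    and step: "\<And>y \<eta> l. is_run y \<eta> \<Longrightarrow> L \<le> l \<Longrightarrow>
      (\<beta> t - \<eta> (Suc l) t) * (\<eta> l t - \<beta> (q + 1))
        \<le> (rate t)\<^sup>2 * (1 + C * contr ^ l) * (\<beta> t - \<eta> l t) * (\<eta> (Suc l) t - \<beta> (q + 1))"
  shows "0 < rate t \<Longrightarrow> fast t"
    and "\<exists>C\<ge>0. \<forall>y \<eta> l. is_run y \<eta> \<longrightarrow> \<beta> t - \<eta> l t \<le> C * contr ^ l"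
proof -
  have rec: "ratio \<eta> t (Suc l) \<le> (rate t)\<^sup>2 * (1 + C * contr ^ l) * ratio \<eta> t l"
    if run: "is_run y \<eta>" and l: "L \<le> l" for y \<eta> l
  proof -
    have "0 < \<eta> l t - \<beta> (q + 1)" "0 < \<eta> (Suc l) t - \<beta> (q + 1)"
      using run_ge_b[OF run t, of l] run_ge_b[OF run t, of "Suc l"] b by auto
    with step[OF run l] show ?thesis
      by (simp add: ratio_def divide_simps mult.commute mult.left_commute)
  qed
  let ?E = "exp (C / (1 - contr))"
  have rm: "0 \<le> ratio_max" unfolding ratio_max_def using b beta_bounds[of 1] q by simp
  show "fast t" if r0: "0 < rate t"
    unfolding fast_def
  proof (intro exI[of _ "ratio_max * ?E / ((rate t)\<^sup>2) ^ L + 1"] conjI allI impI)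
    show "0 < ratio_max * ?E / ((rate t)\<^sup>2) ^ L + 1" using rm by (intro add_nonneg_pos) auto
    fix y \<eta> l assume run: "is_run y \<eta>"
    have "ratio \<eta> t l \<le> ratio_max * ?E / ((rate t)\<^sup>2) ^ L * ((rate t)\<^sup>2) ^ l"
      using rate_sq_le[OF t] r0 \<open>0 \<le> C\<close> contr
      by (intro perturbed_geometric_recursion[OF rec[OF run] ratio_bounds[OF run t]]) auto
    also have "\<dots> \<le> (ratio_max * ?E / ((rate t)\<^sup>2) ^ L + 1) * ((rate t)\<^sup>2) ^ l"
      by (intro mult_right_mono) auto
    finally show "ratio \<eta> t l \<le> (ratio_max * ?E / ((rate t)\<^sup>2) ^ L + 1) * (rate t) ^ (2 * l)"
      by (simp add: power_mult)
  qed
  show "\<exists>C\<ge>0. \<forall>y \<eta> l. is_run y \<eta> \<longrightarrow> \<beta> t - \<eta> l t \<le> C * contr ^ l"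
  proof (intro exI[of _ "(\<beta> 1 - \<beta> (q + 1)) * (ratio_max * ?E / contr ^ L)"] conjI allI impI)
    have b1: "0 \<le> \<beta> 1 - \<beta> (q + 1)" using beta_bounds[of 1] q by simp
    then show "0 \<le> (\<beta> 1 - \<beta> (q + 1)) * (ratio_max * ?E / contr ^ L)"
      using rm contr by simp
    fix y \<eta> l assume run: "is_run y \<eta>"
    have "ratio \<eta> t (Suc m) \<le> contr * (1 + C * contr ^ m) * ratio \<eta> t m" if "L \<le> m" for m
    proof -
      have "(rate t)\<^sup>2 * ((1 + C * contr ^ m) * ratio \<eta> t m) \<le> contr * ((1 + C * contr ^ m) * ratio \<eta> t m)"
        using rate_le_contr[OF t] ratio_bounds(1)[OF run t] contr \<open>0 \<le> C\<close>
        by (intro mult_right_mono mult_nonneg_nonneg) auto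
      with rec[OF run that] show ?thesis by (simp add: mult.assoc)
    qed
    then have le: "ratio \<eta> t l \<le> ratio_max * ?E / contr ^ L * contr ^ l"
      using contr \<open>0 \<le> C\<close>
      by (intro perturbed_geometric_recursion[OF _ ratio_bounds[OF run t]]) auto
    have g: "0 < \<eta> l t - \<beta> (q + 1)" "\<eta> l t - \<beta> (q + 1) \<le> \<beta> 1 - \<beta> (q + 1)"
      using run_ge_b[OF run t, of l] run_le_beta[OF run t, of l] beta_bounds[OF t] b by auto
    have "\<beta> t - \<eta> l t = (\<eta> l t - \<beta> (q + 1)) * ratio \<eta> t l" using g by (simp add: ratio_def)
    also have "\<dots> \<le> (\<beta> 1 - \<beta> (q + 1)) * (ratio_max * ?E / contr ^ L * contr ^ l)"
      using g le ratio_bounds(1)[OF run t] by (intro mult_mono) auto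
    finally show "\<beta> t - \<eta> l t \<le> (\<beta> 1 - \<beta> (q + 1)) * (ratio_max * ?E / contr ^ L) * contr ^ l"
      by (simp add: mult.assoc)
  qed
qed

text \<open>For t = q there is no constraint, and the Ritz inequality with \<open>\<eta> l q\<close>
  holds on the whole block: the recursion has no perturbation.\<close>

lemma base_case: "ritz_lower q" "0 < rate q \<Longrightarrow> fast q"
proof -
  have step: "(\<beta> q - \<eta> (Suc l) q) * (\<eta> l q - \<beta> (q + 1))
        \<le> (rate q)\<^sup>2 * (1 + 0 * contr ^ l) * (\<beta> q - \<eta> l q) * (\<eta> (Suc l) q - \<beta> (q + 1))"
    if run: "is_run y \<eta>" for y \<eta> l
    using filter_step[OF run q(1) order_refl, of "\<eta> l q" 1 l] wsum_shift_le[OF run_ritz_q[OF run order_refl], of q l]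
      run_ge_b[OF run q(1) order_refl, of l] b run_le_beta[OF run q(1) order_refl]
      rate_sq_le[OF q(1) order_refl] by simp
  show "0 < rate q \<Longrightarrow> fast q"
    by (rule ratio_recursion(1)[OF q(1) order_refl, of 0 0]) (use step in auto)
  have "\<exists>C\<ge>0. \<forall>y \<eta> l. is_run y \<eta> \<longrightarrow> \<beta> q - \<eta> l q \<le> C * contr ^ l"
    by (rule ratio_recursion(2)[OF q(1) order_refl, of 0 0]) (use step in auto)
  then obtain C where C: "0 \<le> C" "\<And>y \<eta> l. is_run y \<eta> \<Longrightarrow> \<beta> q - C * contr ^ l \<le> \<eta> l q"
    by (auto simp: algebra_simps)
  then show "ritz_lower q" unfolding ritz_lower_def using run_ritz_q by blast
qed

text \<open>Rate 0 means that the tail has a single eigenvalue. The filter then annihilates the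
  tail, and one step produces \<open>\<beta> t\<close> exactly; the weaker Ritz inequality with
  \<open>\<eta> m q\<close> is sufficient input.\<close>

lemma fast_rate_0:
  assumes t: "1 \<le> t" "t \<le> q" and r: "rate t = 0"
  shows "fast t"
proof -
  have "ratio \<eta> t l \<le> (ratio_max + 1) * rate t ^ (2 * l)" if run: "is_run y \<eta>" for y \<eta> l
  proof (cases l)
    case 0
    then show ?thesis using ratio_bounds(2)[OF run t, of 0] by simp
  next
    case (Suc m)
    have \<xi>: "\<beta> (q + 1) < \<eta> m q" "\<eta> m q \<le> \<beta> t"
      using run_ge_b[OF run q(1) order_refl, of m] b run_le_beta[OF run q(1) order_refl, of m]
        beta_bounds[OF t] by auto
    have "(\<beta> t - \<eta> l t) * (\<eta> m q - \<beta> (q + 1)) \<le> 0"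
      using filter_step[OF run t \<xi>, of 1 m] wsum_shift_le[OF run_ritz_q[OF run order_refl], of t m] t r Suc
      by simp
    then have "\<beta> t \<le> \<eta> l t" using \<xi> by (simp add: mult_le_0_iff)
    then have "ratio \<eta> t l = 0" using run_le_beta[OF run t, of l] by (simp add: ratio_def)
    then show ?thesis using r Suc by simp
  qed
  moreover have "0 < ratio_max + 1"
    unfolding ratio_max_def using b beta_bounds[of 1] q by (intro add_nonneg_pos) auto
  ultimately show ?thesis unfolding fast_def by blast
qed

lemma tail_small_top: "tail_small q"
proof -
  have "sqs {q<..N} (comb (y l) c q) \<le> 0 * contr ^ l * sqs {q<..q} (comb (y l) c q)"
    if run: "is_run y \<eta>" and "\<forall>i\<in>{1..q}. comb (y l) c q i = 0" for y \<eta> l c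
  proof -
    have "sqs {1..q} (comb (y l) c q) = 0" using that by (intro wsum_zero) auto
    with tail_bound[OF run, of l c] b show ?thesis by (simp add: mult_le_0_iff)
  qed
  then show ?thesis unfolding tail_small_def by blast
qed

text \<open>The block vector \<open>w\<close> over the unit vector t+1 has Rayleigh quotient close
  to \<open>\<beta> (Suc t)\<close>. Its tail has quotient at most \<open>\<beta> (q + 1)\<close>
  and would pull it down, so the tail is small. Subtracting a multiple of \<open>w\<close> removes
  coordinate t+1 and leads to the hypothesis for t+1.\<close>

lemma tail_small_Suc:
  assumes t: "Suc t \<le> q" and low: "ritz_lower (Suc t)" and tail: "tail_small (Suc t)"
  shows "tail_small t"
proof -
  from low obtain C1 L1 where C1: "0 \<le> C1" "\<And>y \<eta> l c. is_run y \<eta> \<Longrightarrow> L1 \<le> l \<Longrightarrow>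
     \<forall>i\<in>{Suc t<..q}. comb (y l) c q i = 0 \<Longrightarrow>
     (\<beta> (Suc t) - C1 * contr ^ l) * sqs {1..N} (comb (y l) c q) \<le> wsum \<beta> {1..N} (comb (y l) c q)"
    unfolding ritz_lower_def by blast
  from tail obtain C2 L2 where C2: "0 \<le> C2" "\<And>y \<eta> l c. is_run y \<eta> \<Longrightarrow> L2 \<le> l \<Longrightarrow>
     \<forall>i\<in>{1..Suc t}. comb (y l) c q i = 0 \<Longrightarrow>
     sqs {q<..N} (comb (y l) c q) \<le> C2 * contr ^ l * sqs {Suc t<..q} (comb (y l) c q)"
    unfolding tail_small_def by blast
  \<comment> \<open>A bound for the squared norm of W from \<open>tail_bound\<close>. It is used for
    the factor 1 + s, where \<open>s\<close> is the squared tail of \<open>w\<close> before its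
    decay is known.\<close>
  define T where "T = (\<beta> 1 - b) / (b - \<beta> (q + 1))"
  define C3 where "C3 = C1 * (1 + T) / (\<beta> (Suc t) - \<beta> (q + 1))"
  have bb: "\<beta> (q + 1) < \<beta> (Suc t)" "b \<le> \<beta> 1" using beta_bounds[of "Suc t"] t by auto
  then have T: "0 \<le> T" and C3: "0 \<le> C3" using b C1 by (auto simp: T_def C3_def)
  have "sqs {q<..N} (comb (y l) c q) \<le> (2 * C3 + 2 * C2) * contr ^ l * sqs {t<..q} (comb (y l) c q)"
    if run: "is_run y \<eta>" and l: "max L1 L2 \<le> l" and v0: "\<forall>i\<in>{1..t}. comb (y l) c q i = 0" for y \<eta> l c
  proof -
    define v where "v = comb (y l) c q"
    obtain d where d: "\<forall>i\<in>{1..q}. comb (y l) d q i = (if i = Suc t then 1 else 0)"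
      using comb_interpolate[OF run, of l "\<lambda>i. if i = Suc t then 1 else 0"] by blast
    define w where "w = comb (y l) d q"
    define c' where "c' = (\<lambda>j. c j - v (Suc t) * d j)"
    define v' where "v' = comb (y l) c' q"
    have v'_eq: "v' i = v i - v (Suc t) * w i" for i
      unfolding v'_def c'_def comb_diff comb_scale by (simp add: v_def w_def)
    have w_q: "w i = (if i = Suc t then 1 else 0)" if "i \<in> {1..q}" for i
      using d that by (auto simp: w_def)
    define s where "s = sqs {q<..N} w"
    have s0: "0 \<le> s" unfolding s_def by (intro wsum_nonneg) auto
    have w1: "wsum f {1..q} w = f (Suc t)" for f
    proof -
      have "wsum f {1..q} w = (\<Sum>i\<in>{1..q}. if i = Suc t then f i else 0)"
        unfolding wsum_def using w_q by (intro sum.cong) auto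
      then show ?thesis using t by simp
    qed
    have "s \<le> T"
      using tail_bound[OF run, of l d] w1[of "\<lambda>_. 1"] b unfolding w_def[symmetric] s_def T_def
      by (simp add: field_simps)
    have "(\<beta> (Suc t) - C1 * contr ^ l) * sqs {1..N} w \<le> wsum \<beta> {1..N} w"
      using C1(2)[OF run, of l d] l w_q unfolding w_def[symmetric] by auto
    moreover have "wsum \<beta> {q<..N} w \<le> \<beta> (q + 1) * s"
      using wsum_mono[of "{q<..N}" \<beta> "\<lambda>_. \<beta> (q + 1)" w] antimono
      unfolding s_def wsum_const[of "\<beta> (q + 1)"] by auto
    ultimately have "(\<beta> (Suc t) - C1 * contr ^ l) * (1 + s) \<le> \<beta> (Suc t) + \<beta> (q + 1) * s"
      using wsum_split2[of q N _ w] q w1 by (simp add: s_def)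
    then have "(\<beta> (Suc t) - \<beta> (q + 1)) * s \<le> C1 * contr ^ l * (1 + s)"
      by (simp add: algebra_simps)
    also have "\<dots> \<le> C1 * contr ^ l * (1 + T)"
      using \<open>s \<le> T\<close> C1 contr by (intro mult_left_mono) auto
    finally have s_le: "s \<le> C3 * contr ^ l"
      using bb by (simp add: C3_def field_simps)
    have v'0: "v' i = 0" if "i \<in> {1..Suc t}" for i
      using that v0 w_q[of i] w_q[of "Suc t"] t by (cases "i = Suc t") (auto simp: v'_eq v_def)
    have "sqs {q<..N} v' \<le> C2 * contr ^ l * sqs {Suc t<..q} v'"
      using C2(2)[OF run, of l c'] l v'0 unfolding v'_def[symmetric] by auto
    also have "sqs {Suc t<..q} v' = sqs {Suc t<..q} v"
      using w_q by (intro wsum_cong) (auto simp: v'_eq)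
    finally have v'_le: "sqs {q<..N} v' \<le> C2 * contr ^ l * sqs {Suc t<..q} v" .
    have "sqs {q<..N} v \<le> 2 * (cmod (v (Suc t)))\<^sup>2 * s + 2 * sqs {q<..N} v'"
      unfolding wsum_def s_def sum_distrib_left sum.distrib[symmetric]
    proof (intro sum_mono)
      fix i
      have "(cmod (v i))\<^sup>2 \<le> 2 * (cmod (v i + - (v (Suc t) * w i)))\<^sup>2 + 2 * (cmod (- (v (Suc t) * w i)))\<^sup>2"
        using young_cmod[of 1 "v i" "- (v (Suc t) * w i)"] by simp
      then show "1 * (cmod (v i))\<^sup>2 \<le> 2 * (cmod (v (Suc t)))\<^sup>2 * (1 * (cmod (w i))\<^sup>2) + 2 * (1 * (cmod (v' i))\<^sup>2)"
        by (simp add: v'_eq norm_mult power_mult_distrib)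
    qed
    also have "\<dots> \<le> 2 * (cmod (v (Suc t)))\<^sup>2 * (C3 * contr ^ l) + 2 * (C2 * contr ^ l * sqs {Suc t<..q} v)"
      using s_le v'_le by (intro add_mono mult_left_mono) auto
    also have "\<dots> \<le> (2 * C3 + 2 * C2) * contr ^ l * ((cmod (v (Suc t)))\<^sup>2 + sqs {Suc t<..q} v)"
    proof -
      have "0 \<le> C2 * contr ^ l * (cmod (v (Suc t)))\<^sup>2" "0 \<le> C3 * contr ^ l * sqs {Suc t<..q} v"
        using C2 C3 contr by (auto intro!: mult_nonneg_nonneg wsum_nonneg)
      then show ?thesis by (simp add: algebra_simps)
    qed
    also have "(cmod (v (Suc t)))\<^sup>2 + sqs {Suc t<..q} v = sqs {t<..q} v"
    proof -
      have "{t<..q} = insert (Suc t) {Suc t<..q}" using t by auto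
      then show ?thesis by (simp add: wsum_def)
    qed
    finally show ?thesis by (simp add: v_def)
  qed
  moreover have "0 \<le> 2 * C3 + 2 * C2" using C2 C3 by simp
  ultimately show ?thesis unfolding tail_small_def by blast
qed

text \<open>By \<open>ritz_lower\<close> at t+1 the filter can start from a value only slightly
  below \<open>\<beta> (Suc t)\<close>. One step contracts the distance to \<open>\<beta> t\<close>
  by a fixed factor below 1 and so passes \<open>\<beta> (Suc t)\<close> by a definite
  amount.\<close>

lemma ritz_gap:
  assumes t: "1 \<le> t" "Suc t \<le> q" and lt: "\<beta> (Suc t) < \<beta> t" and low: "ritz_lower (Suc t)"
  obtains \<gamma> L where "0 < \<gamma>" "\<And>y \<eta> l. is_run y \<eta> \<Longrightarrow> L \<le> l \<Longrightarrow> \<beta> (Suc t) + \<gamma> \<le> \<eta> l t"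
proof -
  have t': "t \<le> q" using t by simp
  from low obtain C1 L1 where C1: "0 \<le> C1" "\<And>y \<eta> l c. is_run y \<eta> \<Longrightarrow> L1 \<le> l \<Longrightarrow>
     \<forall>i\<in>{Suc t<..q}. comb (y l) c q i = 0 \<Longrightarrow>
     (\<beta> (Suc t) - C1 * contr ^ l) * sqs {1..N} (comb (y l) c q) \<le> wsum \<beta> {1..N} (comb (y l) c q)"
    unfolding ritz_lower_def by blast
  define G where "G = \<beta> t - \<beta> (Suc t)"
  define D where "D = \<beta> (Suc t) - \<beta> (q + 1)"
  define \<rho> where "\<rho> = (rate t)\<^sup>2"
  have G: "0 < G" and D: "0 < D" and \<rho>: "0 \<le> \<rho>" "\<rho> < 1"
    using lt beta_bounds[of "Suc t"] t rate_sq_le[OF t(1) t'] by (auto simp: G_def D_def \<rho>_def)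
  \<comment> \<open>\<open>X * D < G\<close> amounts to
    \<open>e * (\<rho> * D + G) < G * D * (1 - \<rho>)\<close>. This \<open>e\<close> is half of
    what the slightly stronger condition with \<open>D + G\<close> admits.\<close>
  define e where "e = G * D * (1 - \<rho>) / (2 * (G + D))"
  have e: "0 < e" using G D \<rho> by (simp add: e_def)
  have e_eq: "e * (G + D) = G * D * (1 - \<rho>) / 2" using G D by (simp add: e_def field_simps)
  have "e < D"
  proof -
    have "e * (G + D) < D * (G + D)"
    proof -
      have "G * D * (1 - \<rho>) \<le> G * D * 1" using G D \<rho> by (intro mult_left_mono) auto
      moreover have "0 < G * D" "0 < D * D" using G D by auto
      ultimately have "G * D * (1 - \<rho>) / 2 < D * (G + D)" by (simp add: distrib_left mult.commute)
      then show ?thesis by (simp only: e_eq)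
    qed
    then show ?thesis using G D by simp
  qed
  define X where "X = \<rho> * (G + e) / (D - e)"
  have X: "0 \<le> X" using \<rho> G e \<open>e < D\<close> by (simp add: X_def)
  have "X * D < G"
  proof -
    have "e * (\<rho> * D + G) \<le> e * (G + D)"
      using e D \<rho> mult_left_le_one_le[of D \<rho>] by (intro mult_left_mono) auto
    also have "\<dots> < G * D * (1 - \<rho>)" unfolding e_eq using G D \<rho> by simp
    finally have "\<rho> * (G + e) * D < G * (D - e)" by (simp add: algebra_simps)
    then show ?thesis using \<open>e < D\<close> by (simp add: X_def field_simps)
  qed
  \<comment> \<open>Solves \<open>G - \<gamma> = X * (\<gamma> + D)\<close>, the outcome of the
    filter step written relative to \<open>\<beta> (Suc t)\<close>.\<close>
  define \<gamma> where "\<gamma> = (G - X * D) / (1 + X)"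
  have "0 < \<gamma>" using \<open>X * D < G\<close> X by (simp add: \<gamma>_def)
  obtain L2 where L2: "\<And>l. L2 \<le> l \<Longrightarrow> C1 * contr ^ l \<le> e"
    using contr_eventually_small[OF e, of C1] by blast
  show ?thesis
  proof (rule that[OF \<open>0 < \<gamma>\<close>])
    fix y \<eta> l assume run: "is_run y \<eta>" and "Suc (max L1 L2) \<le> l"
    then obtain m where l: "l = Suc m" and m: "L1 \<le> m" "L2 \<le> m" by (cases l) auto
    define \<xi> where "\<xi> = \<beta> (Suc t) - e"
    have \<xi>: "\<beta> (q + 1) < \<xi>" "\<xi> \<le> \<beta> t" using \<open>e < D\<close> e G by (auto simp: \<xi>_def D_def G_def)
    have "wsum (\<lambda>i. \<xi> - \<beta> i) {q<..N} (comb (y m) c q) \<le> 1 * wsum (\<lambda>i. \<beta> i - \<xi>) {1..t} (comb (y m) c q)"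
      if z: "\<And>i. i \<in> {t<..q} \<Longrightarrow> comb (y m) c q i = 0" for c
    proof -
      have "\<xi> * sqs {1..N} (comb (y m) c q) \<le> (\<beta> (Suc t) - C1 * contr ^ m) * sqs {1..N} (comb (y m) c q)"
        using L2[OF m(2)] by (intro mult_right_mono wsum_nonneg) (auto simp: \<xi>_def)
      also have "\<dots> \<le> wsum \<beta> {1..N} (comb (y m) c q)" using z by (intro C1(2)[OF run m(1)]) auto
      finally show ?thesis using wsum_shift_le[of \<xi> "comb (y m) c q" t] z t' by simp
    qed
    from filter_step[OF run t(1) t' \<xi> _ _ this] rate_sq_le[OF t(1) t']
    have "(\<beta> t - \<eta> l t) * (\<xi> - \<beta> (q + 1)) \<le> \<rho> * (\<beta> t - \<xi>) * (\<eta> l t - \<beta> (q + 1))"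
      by (simp add: l \<rho>_def)
    then have "\<beta> t - \<eta> l t \<le> X * (\<eta> l t - \<beta> (q + 1))"
      using \<open>e < D\<close> by (simp add: X_def \<xi>_def G_def D_def field_simps)
    then have "G - X * D \<le> (\<eta> l t - \<beta> (Suc t)) * (1 + X)"
      by (simp add: G_def D_def algebra_simps)
    then have "\<gamma> \<le> \<eta> l t - \<beta> (Suc t)" using X by (simp add: \<gamma>_def pos_divide_le_eq)
    then show "\<beta> (Suc t) + \<gamma> \<le> \<eta> l t" by simp
  qed
qed

text \<open>Comparison of a vector of the block whose leading part lies in the first \<open>t\<close> coordinates
  with the combination of the first \<open>t\<close> Ritz vectors that has the same first \<open>t\<close> coordinates.\<close>

lemma ritz_comparison:
  assumes run: "is_run y \<eta>" and t: "1 \<le> t" "Suc t \<le> q"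
    and \<gamma>: "0 < \<gamma>" "\<beta> (Suc t) + \<gamma> \<le> \<eta> l t" and \<epsilon>: "0 < \<epsilon>"
    and tail: "\<And>c. \<forall>i\<in>{1..t}. comb (y l) c q i = 0 \<Longrightarrow>
      sqs {q<..N} (comb (y l) c q) \<le> \<epsilon> * sqs {t<..q} (comb (y l) c q)"
    and v0: "\<And>i. i \<in> {t<..q} \<Longrightarrow> comb (y l) c q i = 0"
  shows "wsum (\<lambda>i. \<eta> l t - \<beta> i) {q<..N} (comb (y l) c q)
    \<le> (1 + (\<beta> 1 - \<beta> N) * \<epsilon> / \<gamma>) * wsum (\<lambda>i. \<beta> i - \<eta> l t) {1..t} (comb (y l) c q)"
proof -
  have t': "t \<le> q" using t by simp
  define v where "v = comb (y l) c q"
  define \<xi> where "\<xi> = \<eta> l t"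
  have card: "card {1..t} < card {0..t}" by simp
  obtain d where d: "\<exists>j\<in>{0..t}. d j \<noteq> 0"
    "\<forall>i\<in>{1..t}. (\<Sum>j\<in>{0..t}. (if j = 0 then v i else y l j i) * d j) = 0"
    by (rule nontrivial_solution[OF finite_atLeastAtMost finite_atLeastAtMost card,
          of "\<lambda>i j. if j = 0 then v i else y l j i"])
  define z where "z = comb (y l) d t"
  have eq: "v i * d 0 + z i = 0" if "i \<in> {1..t}" for i
  proof -
    have "(\<Sum>j\<in>{0..t}. (if j = 0 then v i else y l j i) * d j)
        = v i * d 0 + (\<Sum>j\<in>{1..t}. (if j = 0 then v i else y l j i) * d j)"
      by (subst sum.atLeast_Suc_atMost) auto
    also have "(\<Sum>j\<in>{1..t}. (if j = 0 then v i else y l j i) * d j) = z i"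
      unfolding comb_def z_def by (intro sum.cong) auto
    finally show ?thesis using bspec[OF d(2) that] by simp
  qed
  have ritz: "\<xi> * sqs {1..N} (comb (y l) a t) \<le> wsum \<beta> {1..N} (comb (y l) a t)" for a
    unfolding \<xi>_def by (rule run_ritz[OF run t(1) t'])
  have le_Suc: "\<beta> i \<le> \<beta> (Suc t)" if "i \<in> {t<..N}" for i using antimono[of "Suc t" i] that by simp
  \<comment> \<open>Otherwise \<open>z\<close> would be a nonzero combination of the first
    \<open>t\<close> Ritz vectors without leading part. Its Rayleigh quotient would be at most
    \<open>\<beta> (Suc t)\<close>, against the gap \<open>\<gamma>\<close>.\<close>
  have "d 0 \<noteq> 0"
  proof
    assume "d 0 = 0"
    then have z0: "z i = 0" if "i \<in> {1..t}" for i using eq[OF that] by simp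
    have "wsum \<beta> {1..N} z \<le> \<beta> (Suc t) * sqs {1..N} z"
      unfolding wsum_def sum_distrib_left
    proof (intro sum_mono)
      fix i assume "i \<in> {1..N}"
      then show "\<beta> i * (cmod (z i))\<^sup>2 \<le> \<beta> (Suc t) * (1 * (cmod (z i))\<^sup>2)"
        using z0[of i] le_Suc[of i] by (cases "i \<le> t") (auto intro!: mult_right_mono)
    qed
    with ritz[of d] have "\<xi> * sqs {1..N} z \<le> \<beta> (Suc t) * sqs {1..N} z" by (simp add: z_def)
    moreover have "0 < sqs {1..N} z"
    proof -
      have "\<exists>j\<in>{1..t}. d j \<noteq> 0" using d(1) \<open>d 0 = 0\<close>
        by (metis atLeastAtMost_iff less_one not_le)
      from comb_nonzero[OF run t' this, of l] show ?thesis
        unfolding z_def[symmetric] using sqs_eq_0D[of "{1..N}" z] by (meson finite_atLeastAtMost not_le)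
    qed
    ultimately have "\<xi> \<le> \<beta> (Suc t)" by simp
    then show False using \<gamma> by (simp add: \<xi>_def)
  qed
  define a where "a = (\<lambda>j. (- 1 / d 0) * d j)"
  define x where "x = comb (y l) a t"
  have x_eq: "x i = v i" if "i \<in> {1..t}" for i
  proof -
    have "z i = - (v i * d 0)" using eq[OF that] by (rule minus_unique[symmetric])
    then show ?thesis unfolding x_def a_def comb_scale z_def[symmetric] using \<open>d 0 \<noteq> 0\<close> by simp
  qed
  \<comment> \<open>\<open>u = x - v\<close> lies in the block and vanishes in the first
    \<open>t\<close> coordinates, so \<open>tail\<close> applies to it. In the coordinates t+1, ...,
    q it agrees with \<open>x\<close>, because \<open>v\<close> vanishes there.\<close>
  define g where "g = (\<lambda>j. (if j \<le> t then a j else 0) - c j)"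
  define u where "u = comb (y l) g q"
  have u_eq: "u i = x i - v i" for i
    unfolding u_def g_def comb_diff comb_restrict[OF t'] by (simp add: x_def v_def)
  have "sqs {q<..N} u \<le> \<epsilon> * sqs {t<..q} u"
    unfolding u_def using x_eq by (intro tail) (simp add: u_def[symmetric] u_eq)
  also have "sqs {t<..q} u = sqs {t<..q} x"
    using v0 by (intro wsum_cong) (simp add: u_eq v_def)
  finally have u_tail: "sqs {q<..N} u \<le> \<epsilon> * sqs {t<..q} x" .
  define \<omega> where "\<omega> = (\<beta> 1 - \<beta> N) * \<epsilon>"
  have b1N: "0 < \<beta> 1 - \<beta> N" using beta_bounds[of 1] q by simp
  have \<omega>: "0 < \<omega>" using b1N \<epsilon> by (simp add: \<omega>_def)
  \<comment> \<open>Chosen such that \<open>(1 + 1 / s) * \<omega> = (1 + s) * \<gamma>\<close>: the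
    loss caused by \<open>u\<close> is cancelled by the surplus that the Ritz inequality for
    \<open>x\<close> has in the coordinates t+1, ..., q.\<close>
  define s where "s = \<omega> / \<gamma>"
  have s: "0 < s" using \<omega> \<gamma> by (simp add: s_def)
  have \<xi>_le: "\<xi> \<le> \<beta> 1" using run_le_beta[OF run t(1) t', of l] beta_bounds[OF t(1) t'] by (simp add: \<xi>_def)
  have low: "\<beta> i \<le> \<xi>" if "i \<in> {t<..N}" for i using le_Suc[OF that] \<gamma> by (simp add: \<xi>_def)
  have "wsum (\<lambda>i. \<xi> - \<beta> i) {q<..N} v
      \<le> (1 + s) * wsum (\<lambda>i. \<xi> - \<beta> i) {q<..N} x + (1 + 1 / s) * wsum (\<lambda>i. \<xi> - \<beta> i) {q<..N} u"
    unfolding wsum_def sum_distrib_left sum.distrib[symmetric]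
  proof (intro sum_mono)
    fix i assume i: "i \<in> {q<..N}"
    have "(cmod (v i))\<^sup>2 \<le> (1 + s) * (cmod (v i + u i))\<^sup>2 + (1 + 1 / s) * (cmod (u i))\<^sup>2"
      by (rule young_cmod[OF s])
    moreover have "0 \<le> \<xi> - \<beta> i" using low i t' by auto
    ultimately have "(\<xi> - \<beta> i) * (cmod (v i))\<^sup>2
      \<le> (\<xi> - \<beta> i) * ((1 + s) * (cmod (v i + u i))\<^sup>2 + (1 + 1 / s) * (cmod (u i))\<^sup>2)"
      by (rule mult_left_mono)
    then show "(\<xi> - \<beta> i) * (cmod (v i))\<^sup>2
      \<le> (1 + s) * ((\<xi> - \<beta> i) * (cmod (x i))\<^sup>2) + (1 + 1 / s) * ((\<xi> - \<beta> i) * (cmod (u i))\<^sup>2)"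
      by (simp add: u_eq distrib_left mult.left_commute)
  qed
  also have "wsum (\<lambda>i. \<xi> - \<beta> i) {q<..N} u \<le> \<omega> * sqs {t<..q} x"
  proof -
    have "wsum (\<lambda>i. \<xi> - \<beta> i) {q<..N} u \<le> wsum (\<lambda>i. \<beta> 1 - \<beta> N) {q<..N} u"
      using antimono[of _ N] \<xi>_le by (intro wsum_mono diff_mono) auto
    also have "\<dots> = (\<beta> 1 - \<beta> N) * sqs {q<..N} u" by (rule wsum_const)
    also have "\<dots> \<le> (\<beta> 1 - \<beta> N) * (\<epsilon> * sqs {t<..q} x)"
      using u_tail b1N by (intro mult_left_mono) auto
    finally show ?thesis by (simp add: \<omega>_def)
  qed
  also have "wsum (\<lambda>i. \<xi> - \<beta> i) {q<..N} x \<le> wsum (\<lambda>i. \<beta> i - \<xi>) {1..t} v - \<gamma> * sqs {t<..q} x"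
  proof -
    have "\<xi> * sqs {1..N} x \<le> wsum \<beta> {1..N} x" unfolding x_def by (rule ritz)
    then have "wsum (\<lambda>i. \<xi> - \<beta> i) {q<..N} x + wsum (\<lambda>i. \<xi> - \<beta> i) {t<..q} x
        \<le> wsum (\<lambda>i. \<beta> i - \<xi>) {1..t} x"
      using wsum_split[OF t', of N \<beta> x] wsum_split[OF t', of N "\<lambda>_. 1" x] q
      by (simp add: wsum_const_diff algebra_simps)
    moreover have "wsum (\<lambda>i. \<gamma>) {t<..q} x \<le> wsum (\<lambda>i. \<xi> - \<beta> i) {t<..q} x"
    proof (intro wsum_mono)
      fix i assume "i \<in> {t<..q}"
      then show "\<gamma> \<le> \<xi> - \<beta> i" using le_Suc[of i] \<gamma> q by (simp add: \<xi>_def)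
    qed
    moreover have "wsum (\<lambda>i. \<beta> i - \<xi>) {1..t} x = wsum (\<lambda>i. \<beta> i - \<xi>) {1..t} v"
      using x_eq by (intro wsum_cong)
    ultimately show ?thesis unfolding wsum_const[of \<gamma>] by linarith
  qed
  finally have "wsum (\<lambda>i. \<xi> - \<beta> i) {q<..N} v
      \<le> (1 + s) * (wsum (\<lambda>i. \<beta> i - \<xi>) {1..t} v - \<gamma> * sqs {t<..q} x) + (1 + 1 / s) * (\<omega> * sqs {t<..q} x)"
    using s by (simp add: mult_left_mono add_mono)
  also have "(1 + 1 / s) * (\<omega> * sqs {t<..q} x) = (1 + s) * (\<gamma> * sqs {t<..q} x)"
    using \<omega> \<gamma> by (simp add: s_def field_simps)
  finally show ?thesis by (simp add: algebra_simps s_def \<omega>_def \<xi>_def v_def)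
qed


text \<open>The gap makes the comparison with Ritz vectors possible. Its factor 1 +
  O(\<open>contr ^ l\<close>) is the perturbation in the recursion for the Ritz value.\<close>

lemma induction_step:
  assumes t: "1 \<le> t" "Suc t \<le> q" and lt: "\<beta> (Suc t) < \<beta> t"
    and low: "ritz_lower (Suc t)" and tail: "tail_small t"
  shows "ritz_lower t" "0 < rate t \<Longrightarrow> fast t"
proof -
  have t': "t \<le> q" using t by simp
  obtain \<gamma> L1 where \<gamma>: "0 < \<gamma>" "\<And>y \<eta> l. is_run y \<eta> \<Longrightarrow> L1 \<le> l \<Longrightarrow> \<beta> (Suc t) + \<gamma> \<le> \<eta> l t"
    using ritz_gap[OF t lt low] by blast
  from tail obtain C2 L2 where C2: "0 \<le> C2" "\<And>y \<eta> l c. is_run y \<eta> \<Longrightarrow> L2 \<le> l \<Longrightarrow>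
     \<forall>i\<in>{1..t}. comb (y l) c q i = 0 \<Longrightarrow>
     sqs {q<..N} (comb (y l) c q) \<le> C2 * contr ^ l * sqs {t<..q} (comb (y l) c q)"
    unfolding tail_small_def by blast
  have b1N: "0 < \<beta> 1 - \<beta> N" using beta_bounds[of 1] q by simp
  \<comment> \<open>C2 + 1 instead of C2, because \<open>ritz_comparison\<close> divides by its tail
    bound and wants it positive.\<close>
  define C where "C = (\<beta> 1 - \<beta> N) * (C2 + 1) / \<gamma>"
  have C: "0 \<le> C" using b1N C2 \<gamma> by (simp add: C_def)
  have compare: "wsum (\<lambda>i. \<eta> l t - \<beta> i) {q<..N} (comb (y l) c q)
      \<le> (1 + C * contr ^ l) * wsum (\<lambda>i. \<beta> i - \<eta> l t) {1..t} (comb (y l) c q)"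
    if run: "is_run y \<eta>" and l: "max L1 L2 \<le> l" and v0: "\<And>i. i \<in> {t<..q} \<Longrightarrow> comb (y l) c q i = 0"
    for y \<eta> l c
  proof -
    have "sqs {q<..N} (comb (y l) c' q) \<le> (C2 + 1) * contr ^ l * sqs {t<..q} (comb (y l) c' q)"
      if "\<forall>i\<in>{1..t}. comb (y l) c' q i = 0" for c'
    proof -
      have "0 \<le> contr ^ l * sqs {t<..q} (comb (y l) c' q)"
        using contr by (intro mult_nonneg_nonneg wsum_nonneg) auto
      then show ?thesis using C2(2)[OF run _ that] l by (simp add: algebra_simps)
    qed
    from ritz_comparison[OF run t \<gamma>(1) \<gamma>(2)[OF run] _ this v0] l C2 contr
    show ?thesis by (simp add: C_def mult.assoc)
  qed
  \<comment> \<open>From here on the perturbed factor stays at most 1, as \<open>filter_step\<close>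
    demands.\<close>
  obtain L3 where L3: "\<And>l. L3 \<le> l \<Longrightarrow> C * contr ^ l \<le> 1 - (rate t)\<^sup>2"
    using contr_eventually_small[of "1 - (rate t)\<^sup>2" C] rate_sq_le[OF t(1) t'] by auto
  define L where "L = max (max L1 L2) L3"
  have step: "(\<beta> t - \<eta> (Suc l) t) * (\<eta> l t - \<beta> (q + 1))
        \<le> (rate t)\<^sup>2 * (1 + C * contr ^ l) * (\<beta> t - \<eta> l t) * (\<eta> (Suc l) t - \<beta> (q + 1))"
    if run: "is_run y \<eta>" and l: "L \<le> l" for y \<eta> l
  proof (rule filter_step[OF run t(1) t'])
    show "\<beta> (q + 1) < \<eta> l t" "\<eta> l t \<le> \<beta> t"
      using run_ge_b[OF run t(1) t', of l] b run_le_beta[OF run t(1) t', of l] by auto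
    show "0 \<le> 1 + C * contr ^ l" using C contr by simp
    have "(rate t)\<^sup>2 * (C * contr ^ l) \<le> 1 * (C * contr ^ l)"
      using rate_sq_le[OF t(1) t'] C contr by (intro mult_right_mono) auto
    moreover have "C * contr ^ l \<le> 1 - (rate t)\<^sup>2" using L3 l by (simp add: L_def)
    ultimately show "(rate t)\<^sup>2 * (1 + C * contr ^ l) \<le> 1" by (simp add: distrib_left)
  qed (use compare[OF run] l in \<open>auto simp: L_def\<close>)
  show "0 < rate t \<Longrightarrow> fast t"
    by (rule ratio_recursion(1)[OF t(1) t' C, of L]) (use step in auto)
  have "\<exists>C\<ge>0. \<forall>y \<eta> l. is_run y \<eta> \<longrightarrow> \<beta> t - \<eta> l t \<le> C * contr ^ l"
    by (rule ratio_recursion(2)[OF t(1) t' C, of L]) (use step in auto)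
  then obtain C4 where
    C4: "0 \<le> C4" "\<And>y \<eta> l. is_run y \<eta> \<Longrightarrow> \<beta> t - \<eta> l t \<le> C4 * contr ^ l" by blast
  \<comment> \<open>C4 accounts for the distance of the Ritz value from \<open>\<beta> t\<close>.
    The other summand is the defect of the comparison, whose leading sum is at most
    \<open>\<beta> 1 - b\<close> times the squared norm.\<close>
  define C5 where "C5 = C4 + C * (\<beta> 1 - b)"
  have b1b: "0 \<le> \<beta> 1 - b" using beta_bounds[of 1] q by simp
  have "(\<beta> t - C5 * contr ^ l) * sqs {1..N} (comb (y l) c q) \<le> wsum \<beta> {1..N} (comb (y l) c q)"
    if run: "is_run y \<eta>" and l: "L \<le> l" and v0: "\<forall>i\<in>{t<..q}. comb (y l) c q i = 0" for y \<eta> l c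
  proof -
    define v where "v = comb (y l) c q"
    define \<xi> where "\<xi> = \<eta> l t"
    have z: "wsum w {t<..q} v = 0" for w using v0 by (intro wsum_zero) (auto simp: v_def)
    have "wsum (\<lambda>i. \<beta> i - \<xi>) {1..t} v \<le> wsum (\<lambda>i. \<beta> 1 - b) {1..t} v"
      using antimono[of 1] run_ge_b[OF run t(1) t', of l] t q by (intro wsum_mono diff_mono) (auto simp: \<xi>_def)
    also have "\<dots> = (\<beta> 1 - b) * sqs {1..t} v" by (rule wsum_const)
    also have "\<dots> \<le> (\<beta> 1 - b) * sqs {1..N} v"
      using wsum_split[OF t', of N "\<lambda>_. 1" v] q b1b z wsum_nonneg[of "{q<..N}" "\<lambda>_. 1" v]
      by (intro mult_left_mono) auto
    finally have F: "wsum (\<lambda>i. \<beta> i - \<xi>) {1..t} v \<le> (\<beta> 1 - b) * sqs {1..N} v" .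
    have "wsum (\<lambda>i. \<xi> - \<beta> i) {q<..N} v \<le> (1 + C * contr ^ l) * wsum (\<lambda>i. \<beta> i - \<xi>) {1..t} v"
      unfolding v_def \<xi>_def using compare[OF run] l v0 by (simp add: L_def)
    moreover have "C * contr ^ l * wsum (\<lambda>i. \<beta> i - \<xi>) {1..t} v
        \<le> C * contr ^ l * ((\<beta> 1 - b) * sqs {1..N} v)"
      using F C contr by (intro mult_left_mono) auto
    ultimately have "\<xi> * sqs {1..N} v - wsum \<beta> {1..N} v \<le> C * contr ^ l * ((\<beta> 1 - b) * sqs {1..N} v)"
      using wsum_split[OF t', of N \<beta> v] wsum_split[OF t', of N "\<lambda>_. 1" v] q z
      by (simp add: wsum_const_diff algebra_simps)
    moreover have "(\<beta> t - \<xi>) * sqs {1..N} v \<le> C4 * contr ^ l * sqs {1..N} v"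
      using C4(2)[OF run] by (intro mult_right_mono wsum_nonneg) (auto simp: \<xi>_def)
    ultimately show ?thesis unfolding v_def[symmetric] C5_def by (simp add: algebra_simps)
  qed
  moreover have "0 \<le> C5" using C4 C b1b by (simp add: C5_def)
  ultimately show "ritz_lower t" unfolding ritz_lower_def by blast
qed

text \<open>For equal eigenvalues the rates coincide, the larger Ritz value has the smaller ratio,
  and a leading part in the first \<open>t\<close> coordinates is also one in the first t+1.\<close>

lemma induction_step_cluster:
  assumes t: "1 \<le> t" "Suc t \<le> q" and eq: "\<beta> (Suc t) = \<beta> t"
    and low: "ritz_lower (Suc t)" and fast: "fast (Suc t)"
  shows "ritz_lower t" "fast t"
proof -
  from low obtain C L where C: "0 \<le> C" "\<And>y \<eta> l c. is_run y \<eta> \<Longrightarrow> L \<le> l \<Longrightarrow>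
     \<forall>i\<in>{Suc t<..q}. comb (y l) c q i = 0 \<Longrightarrow>
     (\<beta> (Suc t) - C * contr ^ l) * sqs {1..N} (comb (y l) c q) \<le> wsum \<beta> {1..N} (comb (y l) c q)"
    unfolding ritz_lower_def by blast
  have "(\<beta> t - C * contr ^ l) * sqs {1..N} (comb (y l) c q) \<le> wsum \<beta> {1..N} (comb (y l) c q)"
    if "is_run y \<eta>" "L \<le> l" "\<forall>i\<in>{t<..q}. comb (y l) c q i = 0" for y \<eta> l c
    using C(2)[OF that(1,2), of c] that(3) by (simp add: eq)
  with C(1) show "ritz_lower t" unfolding ritz_lower_def by blast
  from fast obtain D where D: "0 < D"
    "\<And>y \<eta> l. is_run y \<eta> \<Longrightarrow> ratio \<eta> (Suc t) l \<le> D * (rate (Suc t)) ^ (2 * l)"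
    unfolding fast_def by blast
  have "ratio \<eta> t l \<le> D * (rate t) ^ (2 * l)" if run: "is_run y \<eta>" for y \<eta> l
  proof -
    have "\<eta> l (Suc t) \<le> \<eta> l t" using run_mono[OF run, of t "Suc t" l] t by simp
    moreover have "b \<le> \<eta> l (Suc t)" "\<eta> l t \<le> \<beta> t"
      using run_ge_b[OF run, of "Suc t" l] run_le_beta[OF run, of t l] t by auto
    ultimately have "ratio \<eta> t l \<le> ratio \<eta> (Suc t) l"
      unfolding ratio_def eq using b by (intro frac_le) auto
    with D(2)[OF run, of l] show ?thesis by (simp add: rate_def eq)
  qed
  with D(1) show "fast t" unfolding fast_def by blast
qed

text \<open>\<open>tail_small\<close> at t needs both \<open>ritz_lower\<close> and
  \<open>tail_small\<close> at t+1, and is in turn needed for \<open>ritz_lower\<close> and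
  \<open>fast\<close> at t when the eigenvalues differ. So all three go through one
  induction.\<close>

theorem fast_convergence:
  assumes "1 \<le> t" "t \<le> q"
  shows "fast t"
proof -
  have fast_if: "fast s" if "1 \<le> s" "s \<le> q" "0 < rate s \<Longrightarrow> fast s" for s
    using that fast_rate_0 rate_bounds(1)[of s] by fastforce
  have "ritz_lower t \<and> fast t \<and> tail_small t"
    using assms(2,1)
  proof (induction t rule: inc_induct)
    case base
    then show ?case using base_case tail_small_top fast_if[of q] q by blast
  next
    case (step t)
    then have IH: "ritz_lower (Suc t)" "fast (Suc t)" "tail_small (Suc t)" and le: "Suc t \<le> q" by auto
    have tail: "tail_small t" by (rule tail_small_Suc[OF le IH(1,3)])
    have "\<beta> (Suc t) \<le> \<beta> t" using antimono[of t "Suc t"] step q by simp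
    then consider "\<beta> (Suc t) = \<beta> t" | "\<beta> (Suc t) < \<beta> t" by linarith
    then show ?case
      using induction_step_cluster[of t] induction_step[of t] IH tail le step.prems fast_if[of t]
      by cases auto
  qed
  then show ?thesis by blast
qed

end

section \<open>Sesquilinear forms and Hermitian definite pencils\<close>

lemma mat_adjoint_dim [simp]: "dim_row (mat_adjoint A) = dim_col A" "dim_col (mat_adjoint A) = dim_row A"
  by (auto simp: mat_adjoint_def)

lemma mat_adjoint_index:
  "i < dim_col A \<Longrightarrow> j < dim_row A \<Longrightarrow> mat_adjoint A $$ (i, j) = cnj (A $$ (j, i))"
  for A :: "complex mat"
  by (simp add: mat_adjoint_def mat_of_rows_def)

lemma mat_adjoint_carrier [simp]: "A \<in> carrier_mat n m \<Longrightarrow> mat_adjoint A \<in> carrier_mat m n"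
  by (auto intro: carrier_matI)

lemma cscalar_prod_sum: "x \<bullet>c y = (\<Sum>i<dim_vec y. x $ i * cnj (y $ i))" for x y :: "complex vec"
  by (simp add: scalar_prod_def atLeast0LessThan)

lemma cscalar_prod_commute:
  "x \<in> carrier_vec n \<Longrightarrow> y \<in> carrier_vec n \<Longrightarrow> y \<bullet>c x = cnj (x \<bullet>c y)" for x y :: "complex vec"
  by (auto simp: cscalar_prod_sum mult.commute)

lemma mult_mat_vec_sum:
  "A \<in> carrier_mat n m \<Longrightarrow> x \<in> carrier_vec m \<Longrightarrow> i < n \<Longrightarrow> (A *\<^sub>v x) $ i = (\<Sum>j<m. A $$ (i, j) * x $ j)"
  by (auto simp: scalar_prod_def atLeast0LessThan)

lemma cscalar_prod_adjoint:
  fixes W :: "complex mat"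
  assumes W: "W \<in> carrier_mat n m" and x: "x \<in> carrier_vec n" and y: "y \<in> carrier_vec m"
  shows "(mat_adjoint W *\<^sub>v x) \<bullet>c y = x \<bullet>c (W *\<^sub>v y)"
proof -
  have "(mat_adjoint W *\<^sub>v x) $ i = (\<Sum>j<n. cnj (W $$ (j, i)) * x $ j)" if "i < m" for i
    unfolding mult_mat_vec_sum[OF mat_adjoint_carrier[OF W] x that]
    using W that by (intro sum.cong refl) (simp add: mat_adjoint_index)
  then have "(mat_adjoint W *\<^sub>v x) \<bullet>c y = (\<Sum>i<m. (\<Sum>j<n. cnj (W $$ (j, i)) * x $ j) * cnj (y $ i))"
    unfolding cscalar_prod_sum carrier_vecD[OF y] by (intro sum.cong refl) simp
  also have "\<dots> = (\<Sum>i<m. \<Sum>j<n. x $ j * cnj (W $$ (j, i) * y $ i))"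
    by (simp add: sum_distrib_right mult.assoc mult.left_commute)
  also have "\<dots> = (\<Sum>j<n. \<Sum>i<m. x $ j * cnj (W $$ (j, i) * y $ i))" by (rule sum.swap)
  also have "\<dots> = (\<Sum>j<n. x $ j * cnj ((W *\<^sub>v y) $ j))"
    by (simp add: mult_mat_vec_sum[OF W y] sum_distrib_left)
  also have "\<dots> = x \<bullet>c (W *\<^sub>v y)" unfolding cscalar_prod_sum using W by simp
  finally show ?thesis .
qed

definition form :: "complex mat \<Rightarrow> complex vec \<Rightarrow> complex vec \<Rightarrow> complex" where
  "form A x y = (A *\<^sub>v x) \<bullet>c y"

lemma form_congruence:
  assumes W: "W \<in> carrier_mat n m" and A: "A \<in> carrier_mat n n"
    and g: "g \<in> carrier_vec m" and h: "h \<in> carrier_vec m"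
  shows "form (mat_adjoint W * A * W) g h = form A (W *\<^sub>v g) (W *\<^sub>v h)"
proof -
  have WA: "mat_adjoint W * A \<in> carrier_mat m n" by (rule mult_carrier_mat[OF mat_adjoint_carrier[OF W] A])
  have Wg: "W *\<^sub>v g \<in> carrier_vec n" using W g by simp
  have "(mat_adjoint W * A * W) *\<^sub>v g = mat_adjoint W *\<^sub>v (A *\<^sub>v (W *\<^sub>v g))"
    by (simp only: assoc_mult_mat_vec[OF WA W g] assoc_mult_mat_vec[OF mat_adjoint_carrier[OF W] A Wg])
  then show ?thesis unfolding form_def using cscalar_prod_adjoint[OF W _ h] A Wg by simp
qed

lemma form_hermitian:
  assumes A: "A \<in> carrier_mat n n" "hermitian_mat A" and "x \<in> carrier_vec n" "y \<in> carrier_vec n"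
  shows "form A y x = cnj (form A x y)"
proof -
  have "form A y x = cnj (x \<bullet>c (A *\<^sub>v y))"
    unfolding form_def using assms by (intro cscalar_prod_commute[of _ n]) auto
  also have "x \<bullet>c (A *\<^sub>v y) = form A x y"
    using cscalar_prod_adjoint[OF A(1) assms(3,4)] A(2) by (simp add: form_def hermitian_mat_def)
  finally show ?thesis .
qed

lemma form_real:
  assumes "A \<in> carrier_mat n n" "hermitian_mat A" "x \<in> carrier_vec n"
  shows "form A x x = complex_of_real (Re (form A x x))"
  using form_hermitian[OF assms assms(3)] by (simp add: complex_eq_iff)

lemma posdef_form:
  assumes "S \<in> carrier_mat n n" "posdef_mat S" "x \<in> carrier_vec n" "x \<noteq> 0\<^sub>v n"
  shows "0 < Re (form S x x)"
  using assms by (auto simp: posdef_mat_def form_def)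

definition vcomb :: "nat \<Rightarrow> (nat \<Rightarrow> complex vec) \<Rightarrow> (nat \<Rightarrow> complex) \<Rightarrow> nat \<Rightarrow> complex vec" where
  "vcomb n w c m = vec n (\<lambda>i. \<Sum>j\<in>{1..m}. c j * w j $ i)"

lemma vcomb_carrier [simp]: "vcomb n w c m \<in> carrier_vec n"
  by (simp add: vcomb_def)

lemma vcomb_cong:
  "(\<And>j. j \<in> {1..m} \<Longrightarrow> c j = c' j) \<Longrightarrow> (\<And>j. j \<in> {1..m} \<Longrightarrow> w j = w' j) \<Longrightarrow> vcomb n w c m = vcomb n w' c' m"
  unfolding vcomb_def by (intro eq_vecI) (auto intro: sum.cong)

lemma mult_mat_vcomb:
  assumes A: "A \<in> carrier_mat n' n" and w: "\<And>j. j \<in> {1..m} \<Longrightarrow> w j \<in> carrier_vec n"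
  shows "A *\<^sub>v vcomb n w c m = vcomb n' (\<lambda>j. A *\<^sub>v w j) c m"
proof (rule eq_vecI)
  show "dim_vec (A *\<^sub>v vcomb n w c m) = dim_vec (vcomb n' (\<lambda>j. A *\<^sub>v w j) c m)"
    using A by (simp add: vcomb_def)
  fix i assume "i < dim_vec (vcomb n' (\<lambda>j. A *\<^sub>v w j) c m)"
  then have i: "i < n'" by (simp add: vcomb_def)
  have "(A *\<^sub>v vcomb n w c m) $ i = (\<Sum>k<n. A $$ (i, k) * (\<Sum>j\<in>{1..m}. c j * w j $ k))"
    by (subst mult_mat_vec_sum[OF A vcomb_carrier i]) (simp add: vcomb_def)
  also have "\<dots> = (\<Sum>k<n. \<Sum>j\<in>{1..m}. c j * (A $$ (i, k) * w j $ k))"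
    by (simp add: sum_distrib_left mult.left_commute)
  also have "\<dots> = (\<Sum>j\<in>{1..m}. \<Sum>k<n. c j * (A $$ (i, k) * w j $ k))" by (rule sum.swap)
  also have "\<dots> = (\<Sum>j\<in>{1..m}. c j * (A *\<^sub>v w j) $ i)"
    by (intro sum.cong refl) (simp only: mult_mat_vec_sum[OF A w i] sum_distrib_left)
  finally show "(A *\<^sub>v vcomb n w c m) $ i = vcomb n' (\<lambda>j. A *\<^sub>v w j) c m $ i"
    using i by (simp add: vcomb_def)
qed

lemma vcomb_cscalar_prod:
  assumes y: "y \<in> carrier_vec n"
  shows "vcomb n w c m \<bullet>c y = (\<Sum>j\<in>{1..m}. c j * (w j \<bullet>c y))"
proof -
  have "vcomb n w c m \<bullet>c y = (\<Sum>i<n. \<Sum>j\<in>{1..m}. c j * (w j $ i * cnj (y $ i)))"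
    unfolding cscalar_prod_sum using y by (simp add: vcomb_def sum_distrib_right mult.assoc)
  also have "\<dots> = (\<Sum>j\<in>{1..m}. \<Sum>i<n. c j * (w j $ i * cnj (y $ i)))" by (rule sum.swap)
  finally show ?thesis unfolding cscalar_prod_sum using y by (simp add: sum_distrib_left)
qed

lemma form_vcomb_left:
  assumes "A \<in> carrier_mat n n" "\<And>j. j \<in> {1..m} \<Longrightarrow> w j \<in> carrier_vec n" "y \<in> carrier_vec n"
  shows "form A (vcomb n w c m) y = (\<Sum>j\<in>{1..m}. c j * form A (w j) y)"
proof -
  have "A *\<^sub>v vcomb n w c m = vcomb n (\<lambda>j. A *\<^sub>v w j) c m"
    by (rule mult_mat_vcomb[OF assms(1)]) (rule assms(2))
  then show ?thesis unfolding form_def by (simp only: vcomb_cscalar_prod[OF assms(3)])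
qed

lemma form_vcomb_right:
  assumes A: "A \<in> carrier_mat n n" and w: "\<And>j. j \<in> {1..m} \<Longrightarrow> w j \<in> carrier_vec n" and x: "x \<in> carrier_vec n"
  shows "form A x (vcomb n w c m) = (\<Sum>j\<in>{1..m}. cnj (c j) * form A x (w j))"
proof -
  have Ax: "A *\<^sub>v x \<in> carrier_vec n" using A x by simp
  have "form A x (vcomb n w c m) = cnj (vcomb n w c m \<bullet>c (A *\<^sub>v x))"
    unfolding form_def using Ax by (intro cscalar_prod_commute[of _ n]) auto
  also have "\<dots> = (\<Sum>j\<in>{1..m}. cnj (c j) * cnj (w j \<bullet>c (A *\<^sub>v x)))"
    unfolding vcomb_cscalar_prod[OF Ax] by simp
  also have "\<dots> = (\<Sum>j\<in>{1..m}. cnj (c j) * form A x (w j))"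
    unfolding form_def using w Ax by (intro sum.cong refl) (simp add: cscalar_prod_commute[of _ n "A *\<^sub>v x"])
  finally show ?thesis .
qed

lemma sum_delta_form:
  assumes "A \<in> carrier_mat n n" "\<And>j. j \<in> {1..m} \<Longrightarrow> w j \<in> carrier_vec n"
    and "\<And>a b. a \<in> {1..m} \<Longrightarrow> b \<in> {1..m} \<Longrightarrow> form A (w a) (w b) = (if a = b then complex_of_real (\<theta> a) else 0)"
  shows "form A (vcomb n w c m) (vcomb n w c m) = complex_of_real (\<Sum>j\<in>{1..m}. \<theta> j * (cmod (c j))\<^sup>2)"
proof -
  have "form A (vcomb n w c m) (vcomb n w c m)
      = (\<Sum>a\<in>{1..m}. c a * (\<Sum>b\<in>{1..m}. cnj (c b) * form A (w a) (w b)))"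
    using form_vcomb_right[OF assms(1,2)] assms(2)
    by (subst form_vcomb_left[OF assms(1,2) vcomb_carrier]) (auto intro!: sum.cong)
  also have "\<dots> = (\<Sum>a\<in>{1..m}. c a * (\<Sum>b\<in>{1..m}. if b = a then cnj (c b) * complex_of_real (\<theta> a) else 0))"
    by (intro sum.cong refl arg_cong2[of _ _ _ _ "(*)"]) (auto simp: assms(3))
  also have "\<dots> = (\<Sum>a\<in>{1..m}. complex_of_real (\<theta> a * (cmod (c a))\<^sup>2))"
    by (intro sum.cong refl) (simp add: complex_norm_square mult.left_commute mult.commute del: of_real_power)
  finally show ?thesis by (simp only: of_real_sum)
qed

text \<open>A polynomial that annihilates \<open>x\<close> splits into linear factors, one of which must be
  singular on the orbit of \<open>x\<close>.\<close>

lemma invariant_eigenvector: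
  fixes T :: "complex mat"
  assumes T: "T \<in> carrier_mat d d" and C: "C \<subseteq> carrier_vec d"
    and inv: "\<And>x. x \<in> C \<Longrightarrow> T *\<^sub>v x \<in> C"
    and lin: "\<And>x y \<mu>. x \<in> C \<Longrightarrow> y \<in> C \<Longrightarrow> x - \<mu> \<cdot>\<^sub>v y \<in> C"
    and x: "x \<in> C" "x \<noteq> 0\<^sub>v d"
  shows "\<exists>y \<mu>. y \<in> C \<and> y \<noteq> 0\<^sub>v d \<and> T *\<^sub>v y = \<mu> \<cdot>\<^sub>v y"
proof -
  define it where "it m x = (((*\<^sub>v) T) ^^ m) x" for m x
  have it_0: "it 0 x = x" and it_Suc: "it (Suc m) x = T *\<^sub>v it m x" for m x by (auto simp: it_def)
  have it_C: "it m x \<in> C" if "x \<in> C" for m x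
    by (induction m) (auto simp: it_0 it_Suc that intro: inv)
  then have it_carrier: "it m x \<in> carrier_vec d" if "x \<in> C" for m x using that C by blast
  have it_diff: "it m (T *\<^sub>v x - \<mu> \<cdot>\<^sub>v x) = it (Suc m) x - \<mu> \<cdot>\<^sub>v it m x" if x: "x \<in> C" for m x \<mu>
  proof (induction m)
    case 0
    show ?case by (simp add: it_0 it_Suc)
  next
    case (Suc m)
    have "it (Suc m) (T *\<^sub>v x - \<mu> \<cdot>\<^sub>v x) = T *\<^sub>v (it (Suc m) x - \<mu> \<cdot>\<^sub>v it m x)"
      by (simp only: it_Suc[of m "T *\<^sub>v x - \<mu> \<cdot>\<^sub>v x"] Suc.IH)
    also have "\<dots> = T *\<^sub>v it (Suc m) x - \<mu> \<cdot>\<^sub>v (T *\<^sub>v it m x)"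
      using it_carrier[OF x] T by (subst mult_minus_distrib_mat_vec[OF T]) (auto simp: mult_mat_vec[OF T])
    finally show ?case by (simp add: it_Suc)
  qed
  have const: False if "\<And>m. 0 < m \<Longrightarrow> coeff p m = 0" "p \<noteq> 0" "x \<in> C" "x \<noteq> 0\<^sub>v d"
      "\<And>i. i < d \<Longrightarrow> (\<Sum>m\<le>N. coeff p m * it m x $ i) = 0" for p :: "complex poly" and x N
  proof -
    have "coeff p 0 \<noteq> 0" using that(1,2) by (metis gr0I leading_coeff_0_iff)
    have "x $ i = 0" if "i < d" for i
    proof -
      have "(\<Sum>m\<le>N. coeff p m * it m x $ i) = (\<Sum>m\<in>{0}. coeff p m * it m x $ i)"
        using \<open>\<And>m. 0 < m \<Longrightarrow> coeff p m = 0\<close> by (intro sum.mono_neutral_right) auto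
      with \<open>i < d\<close> \<open>\<And>i. i < d \<Longrightarrow> _ = 0\<close>[OF \<open>i < d\<close>] \<open>coeff p 0 \<noteq> 0\<close> show ?thesis by (simp add: it_0)
    qed
    then have "x = 0\<^sub>v d" using \<open>x \<in> C\<close> C by (intro eq_vecI) auto
    with \<open>x \<noteq> 0\<^sub>v d\<close> show False ..
  qed
  have key: "\<exists>y \<mu>. y \<in> C \<and> y \<noteq> 0\<^sub>v d \<and> T *\<^sub>v y = \<mu> \<cdot>\<^sub>v y"
    if "p \<noteq> 0" "degree p \<le> N" "x \<in> C" "x \<noteq> 0\<^sub>v d"
      "\<And>i. i < d \<Longrightarrow> (\<Sum>m\<le>N. coeff p m * it m x $ i) = 0" for p :: "complex poly" and x N
    using that
  proof (induction N arbitrary: p x)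
    case 0
    have False using 0 by (intro const[of p x 0]) (auto simp: coeff_eq_0)
    then show ?case ..
  next
    case (Suc N)
    show ?case
    proof (cases "degree p = 0")
      case True
      have False using Suc.prems True by (intro const[of p x "Suc N"]) (auto simp: coeff_eq_0)
      then show ?thesis ..
    next
      case False
      then have "\<not> constant (poly p)" by (simp add: constant_degree)
      then obtain \<mu> where "poly p \<mu> = 0" using fundamental_theorem_of_algebra by blast
      then obtain q where p: "p = [:- \<mu>, 1:] * q" unfolding poly_eq_0_iff_dvd by (elim dvdE)
      have q0: "q \<noteq> 0" using p \<open>p \<noteq> 0\<close> by auto
      have "degree p = Suc (degree q)" unfolding p using q0 by (subst degree_mult_eq) auto
      then have deg: "degree q \<le> N" using Suc.prems by simp
      \<comment> \<open>Either \<open>x'\<close> vanishes and \<open>x\<close> is an eigenvector for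
        the root, or \<open>x'\<close> is a nonzero vector of \<open>C\<close> annihilated by the
        quotient \<open>q\<close>, whose degree is smaller.\<close>
      define x' where "x' = T *\<^sub>v x - \<mu> \<cdot>\<^sub>v x"
      have x': "x' \<in> C" unfolding x'_def using Suc.prems inv lin by blast
      have carr: "x \<in> carrier_vec d" using Suc.prems C by blast
      show ?thesis
      proof (cases "x' = 0\<^sub>v d")
        case True
        have "T *\<^sub>v x = \<mu> \<cdot>\<^sub>v x"
        proof (rule eq_vecI)
          fix i assume "i < dim_vec (\<mu> \<cdot>\<^sub>v x)"
          then have "i < d" using carr by simp
          then show "(T *\<^sub>v x) $ i = (\<mu> \<cdot>\<^sub>v x) $ i"
            using arg_cong[OF True, of "\<lambda>v. v $ i"] carr T by (simp add: x'_def)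
        qed (use carr T in auto)
        then show ?thesis using Suc.prems by blast
      next
        case False
        have "(\<Sum>m\<le>N. coeff q m * it m x' $ i) = 0" if i: "i < d" for i
        proof -
          let ?f = "\<lambda>m. it m x $ i"
          have "p = pCons 0 q - smult \<mu> q" unfolding p by simp
          then have "(\<Sum>m\<le>Suc N. coeff p m * ?f m)
              = (\<Sum>m\<le>Suc N. coeff (pCons 0 q) m * ?f m) - \<mu> * (\<Sum>m\<le>Suc N. coeff q m * ?f m)"
            by (simp only: coeff_diff coeff_smult left_diff_distrib sum_subtractf sum_distrib_left mult.assoc)
          also have "(\<Sum>m\<le>Suc N. coeff (pCons 0 q) m * ?f m) = (\<Sum>m\<le>N. coeff q m * ?f (Suc m))"
            by (subst sum.atMost_Suc_shift) simp
          also have "(\<Sum>m\<le>Suc N. coeff q m * ?f m) = (\<Sum>m\<le>N. coeff q m * ?f m)"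
            using deg by (simp add: coeff_eq_0)
          also have "(\<Sum>m\<le>N. coeff q m * ?f (Suc m)) - \<mu> * (\<Sum>m\<le>N. coeff q m * ?f m)
              = (\<Sum>m\<le>N. coeff q m * (?f (Suc m) - \<mu> * ?f m))"
            by (simp add: right_diff_distrib sum_subtractf sum_distrib_left mult.left_commute)
          also have "\<dots> = (\<Sum>m\<le>N. coeff q m * it m x' $ i)"
            unfolding x'_def it_diff[OF \<open>x \<in> C\<close>]
            using i carrier_vecD[OF it_carrier[OF \<open>x \<in> C\<close>]] by (intro sum.cong refl) simp
          finally show ?thesis using Suc.prems(5)[OF i] by simp
        qed
        from Suc.IH[OF q0 deg x' False this] show ?thesis .
      qed
    qed
  qed
  \<comment> \<open>The d + 1 vectors x, T x, ..., T^d x are dependent; the coefficients of a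
    relation form the annihilating polynomial.\<close>
  have card: "card {..<d} < card {..d}" by simp
  obtain c where c: "\<exists>m\<in>{..d}. c m \<noteq> 0" "\<forall>i\<in>{..<d}. (\<Sum>m\<in>{..d}. it m x $ i * c m) = 0"
    by (rule nontrivial_solution[OF finite_lessThan finite_atMost card, of "\<lambda>i m. it m x $ i"])
  define p where "p = (\<Sum>m\<le>d. monom (c m) m)"
  have coeff_p: "coeff p m = (if m \<le> d then c m else 0)" for m
    unfolding p_def by (simp add: coeff_sum)
  show ?thesis
  proof (rule key[OF _ _ x])
    show "p \<noteq> 0" using c(1) coeff_p by (metis atMost_iff coeff_0)
    show "degree p \<le> d" by (rule degree_le) (simp add: coeff_p)
    fix i assume "i < d"
    then have "(\<Sum>m\<in>{..d}. it m x $ i * c m) = 0" using c(2) by simp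
    then show "(\<Sum>m\<le>d. coeff p m * it m x $ i) = 0" by (simp add: coeff_p mult.commute)
  qed
qed

section \<open>Eigenbases of Hermitian definite pencils\<close>

lemma posdef_inverse:
  assumes M: "M \<in> carrier_mat d d" "posdef_mat M"
  obtains K where "K \<in> carrier_mat d d" "K * M = 1\<^sub>m d" "M * K = 1\<^sub>m d"
proof -
  have "det M \<noteq> 0"
  proof
    assume "det M = 0"
    then obtain v where v: "v \<in> carrier_vec d" "v \<noteq> 0\<^sub>v d" "M *\<^sub>v v = 0\<^sub>v d"
      using det_0_iff_vec_prod_zero[OF M(1)] by blast
    then show False using posdef_form[OF M v(1,2)] by (simp add: form_def cscalar_prod_sum)
  qed
  from det_non_zero_imp_unit[OF M(1) this, of undefined] that show ?thesis
    by (auto simp: Units_def ring_mat_def)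
qed

lemma smult_vec_cscalar_prod:
  "x \<in> carrier_vec n \<Longrightarrow> y \<in> carrier_vec n \<Longrightarrow> (a \<cdot>\<^sub>v x) \<bullet>c y = a * (x \<bullet>c y)" for x y :: "complex vec"
  by simp

lemma form_diff_smult:
  assumes A: "A \<in> carrier_mat n n" and x: "x \<in> carrier_vec n" and y: "y \<in> carrier_vec n" and z: "z \<in> carrier_vec n"
  shows "form A (x - \<mu> \<cdot>\<^sub>v y) z = form A x z - \<mu> * form A y z"
proof -
  have eq: "A *\<^sub>v (x - \<mu> \<cdot>\<^sub>v y) = A *\<^sub>v x - \<mu> \<cdot>\<^sub>v (A *\<^sub>v y)"
    using x y by (subst mult_minus_distrib_mat_vec[OF A]) (auto simp: mult_mat_vec[OF A])
  have d: "dim_vec (A *\<^sub>v x) = n" "dim_vec (A *\<^sub>v y) = n" "dim_vec z = n" using A z by auto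
  have "((A *\<^sub>v x) - \<mu> \<cdot>\<^sub>v (A *\<^sub>v y)) \<bullet>c z
      = (\<Sum>i<n. (A *\<^sub>v x) $ i * cnj (z $ i) - \<mu> * ((A *\<^sub>v y) $ i * cnj (z $ i)))"
    unfolding cscalar_prod_sum d(3)
  proof (intro sum.cong refl)
    fix i assume "i \<in> {..<n}"
    then have "((A *\<^sub>v x) - \<mu> \<cdot>\<^sub>v (A *\<^sub>v y)) $ i = (A *\<^sub>v x) $ i - \<mu> * (A *\<^sub>v y) $ i"
      using d by (simp del: index_mult_mat_vec)
    then show "((A *\<^sub>v x) - \<mu> \<cdot>\<^sub>v (A *\<^sub>v y)) $ i * cnj (z $ i)
        = (A *\<^sub>v x) $ i * cnj (z $ i) - \<mu> * ((A *\<^sub>v y) $ i * cnj (z $ i))"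
      by (simp only: left_diff_distrib mult.assoc)
  qed
  also have "\<dots> = form A x z - \<mu> * form A y z"
    by (simp only: form_def cscalar_prod_sum d(3) sum_subtractf sum_distrib_left)
  finally show ?thesis by (simp only: form_def eq)
qed

lemma form_smult:
  assumes A: "A \<in> carrier_mat n n" and x: "x \<in> carrier_vec n" and y: "y \<in> carrier_vec n"
  shows "form A (a \<cdot>\<^sub>v x) y = a * form A x y" "form A x (a \<cdot>\<^sub>v y) = cnj a * form A x y"
proof -
  have "A *\<^sub>v x \<in> carrier_vec n" using A x by simp
  then show "form A (a \<cdot>\<^sub>v x) y = a * form A x y"
    unfolding form_def mult_mat_vec[OF A x] using y by (simp add: smult_vec_cscalar_prod[of _ n])
  show "form A x (a \<cdot>\<^sub>v y) = cnj a * form A x y"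
    unfolding form_def using \<open>A *\<^sub>v x \<in> carrier_vec n\<close> y
    by (simp add: conjugate_smult_vec)
qed

text \<open>T = M^-1 A maps the M-orthogonal complement \<open>C\<close> of the eigenvectors already
  found into itself, since \<open>A\<close> is Hermitian. A dimension count shows that
  \<open>C\<close> is nontrivial, so it contains a further eigenvector; its eigenvalue is real as a
  quotient of two real form values.\<close>

lemma pencil_eigenvectors:
  fixes A M :: "complex mat"
  assumes A: "A \<in> carrier_mat d d" "hermitian_mat A" and M: "M \<in> carrier_mat d d" "posdef_mat M"
  shows "r \<le> d \<Longrightarrow> \<exists>g \<theta>. (\<forall>a<r. g a \<in> carrier_vec d) \<and>
      (\<forall>a<r. A *\<^sub>v g a = complex_of_real (\<theta> a) \<cdot>\<^sub>v (M *\<^sub>v g a)) \<and>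
      (\<forall>a<r. \<forall>b<r. form M (g a) (g b) = (if a = b then 1 else 0))"
proof (induction r)
  case 0
  then show ?case by simp
next
  case (Suc r)
  then have "r < d" "r \<le> d" by auto
  from Suc.IH[OF \<open>r \<le> d\<close>] obtain g \<theta> where g: "\<forall>a<r. g a \<in> carrier_vec d"
    and eig: "\<forall>a<r. A *\<^sub>v g a = complex_of_real (\<theta> a) \<cdot>\<^sub>v (M *\<^sub>v g a)"
    and orth: "\<forall>a<r. \<forall>b<r. form M (g a) (g b) = (if a = b then 1 else 0)" by (elim exE conjE)
  have herm: "hermitian_mat M" using M(2) by (simp add: posdef_mat_def)
  obtain K where K: "K \<in> carrier_mat d d" "K * M = 1\<^sub>m d" "M * K = 1\<^sub>m d" by (rule posdef_inverse[OF M])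
  define T where "T = K * A"
  have T: "T \<in> carrier_mat d d" using K A by (simp add: T_def)
  have MT: "M *\<^sub>v (T *\<^sub>v x) = A *\<^sub>v x" if "x \<in> carrier_vec d" for x
  proof -
    have "M *\<^sub>v (T *\<^sub>v x) = (M * (K * A)) *\<^sub>v x"
      unfolding T_def using M(1) K(1) A(1) that by (simp add: assoc_mult_mat_vec[of M d d "K * A" d])
    also have "M * (K * A) = A"
      using assoc_mult_mat[OF M(1) K(1) A(1)] K(3) A(1) by simp
    finally show ?thesis .
  qed
  define C where "C = {x \<in> carrier_vec d. \<forall>a<r. form M x (g a) = 0}"
  have card: "card {..<r} < card {..<d}" using \<open>r < d\<close> by simp
  obtain c where c: "\<exists>j\<in>{..<d}. c j \<noteq> 0"
    "\<forall>a\<in>{..<r}. (\<Sum>j\<in>{..<d}. cnj ((M *\<^sub>v g a) $ j) * c j) = 0"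
    by (rule nontrivial_solution[OF finite_lessThan finite_lessThan card, of "\<lambda>a j. cnj ((M *\<^sub>v g a) $ j)"])
  define x where "x = vec d c"
  have x: "x \<in> carrier_vec d" by (simp add: x_def)
  have "x \<noteq> 0\<^sub>v d"
  proof
    assume "x = 0\<^sub>v d"
    then have "x $ j = 0" if "j < d" for j using that by simp
    with c(1) show False by (auto simp: x_def)
  qed
  have "form M x (g a) = 0" if a: "a < r" for a
  proof -
    have ga: "g a \<in> carrier_vec d" using g a by simp
    have "form M x (g a) = cnj ((M *\<^sub>v g a) \<bullet>c x)"
      using form_hermitian[OF M(1) herm ga x] by (simp add: form_def)
    also have "\<dots> = x \<bullet>c (M *\<^sub>v g a)"
      using cscalar_prod_commute[of "M *\<^sub>v g a" d x] M(1) ga x by simp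
    also have "\<dots> = (\<Sum>j<d. x $ j * cnj ((M *\<^sub>v g a) $ j))"
      unfolding cscalar_prod_sum using M(1) by simp
    also have "\<dots> = (\<Sum>j<d. cnj ((M *\<^sub>v g a) $ j) * c j)"
      by (intro sum.cong refl) (simp add: x_def mult.commute)
    finally show ?thesis using c(2) a by simp
  qed
  then have "x \<in> C" using x by (simp add: C_def)
  have "\<exists>y \<mu>. y \<in> C \<and> y \<noteq> 0\<^sub>v d \<and> T *\<^sub>v y = \<mu> \<cdot>\<^sub>v y"
  proof (rule invariant_eigenvector[OF T _ _ _ \<open>x \<in> C\<close> \<open>x \<noteq> 0\<^sub>v d\<close>])
    show "C \<subseteq> carrier_vec d" by (auto simp: C_def)
    show "u - \<mu> \<cdot>\<^sub>v v \<in> C" if "u \<in> C" "v \<in> C" for u v \<mu>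
      using that g by (auto simp: C_def form_diff_smult[OF M(1)])
    show "T *\<^sub>v u \<in> C" if u: "u \<in> C" for u
    proof -
      have uc: "u \<in> carrier_vec d" using u by (simp add: C_def)
      have "form M (T *\<^sub>v u) (g a) = 0" if a: "a < r" for a
      proof -
        have ga: "g a \<in> carrier_vec d" using g a by simp
        have "form M (T *\<^sub>v u) (g a) = form A u (g a)" by (simp add: form_def MT[OF uc])
        also have "\<dots> = cnj (form A (g a) u)" by (rule form_hermitian[OF A ga uc])
        also have "form A (g a) u = complex_of_real (\<theta> a) * form M (g a) u"
          unfolding form_def using eig a M(1) ga uc by (simp add: smult_vec_cscalar_prod[of _ d])
        also have "form M (g a) u = cnj (form M u (g a))" by (rule form_hermitian[OF M(1) herm uc ga])
        also have "form M u (g a) = 0" using u a by (simp add: C_def)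
        finally show ?thesis by simp
      qed
      then show ?thesis using T uc by (simp add: C_def)
    qed
  qed
  then obtain y \<mu> where y: "y \<in> C" "y \<noteq> 0\<^sub>v d" "T *\<^sub>v y = \<mu> \<cdot>\<^sub>v y" by blast
  have yc: "y \<in> carrier_vec d" using y by (simp add: C_def)
  have Ay: "A *\<^sub>v y = \<mu> \<cdot>\<^sub>v (M *\<^sub>v y)" using MT[OF yc] y(3) mult_mat_vec[OF M(1) yc] by simp
  define \<nu> where "\<nu> = Re (form M y y)"
  have \<nu>: "0 < \<nu>" unfolding \<nu>_def by (rule posdef_form[OF M yc y(2)])
  have fy: "form M y y = complex_of_real \<nu>" unfolding \<nu>_def by (rule form_real[OF M(1) herm yc])
  have "form A y y = \<mu> * form M y y"
    unfolding form_def Ay using M(1) yc by (simp add: smult_vec_cscalar_prod[of _ d])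
  then have "\<mu> * complex_of_real \<nu> = complex_of_real (Re (form A y y))"
    using form_real[OF A yc] fy by simp
  then have "\<mu> = complex_of_real (Re (form A y y) / \<nu>)" using \<nu> by (simp add: field_simps)
  then obtain t where t: "\<mu> = complex_of_real t" ..
  define s where "s = complex_of_real (1 / sqrt \<nu>)"
  define z where "z = s \<cdot>\<^sub>v y"
  have zc: "z \<in> carrier_vec d" using yc by (simp add: z_def)
  have zz: "form M z z = 1"
  proof -
    have "form M z z = s * (cnj s * form M y y)"
      unfolding z_def using form_smult[OF M(1)] yc by simp
    also have "\<dots> = complex_of_real (1 / sqrt \<nu> * (1 / sqrt \<nu> * \<nu>))"
      unfolding fy s_def by (simp only: complex_cnj_complex_of_real of_real_mult)
    also have "1 / sqrt \<nu> * (1 / sqrt \<nu> * \<nu>) = 1" using \<nu> by (simp add: field_simps)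
    finally show ?thesis by simp
  qed
  have zg: "form M z (g a) = 0" "form M (g a) z = 0" if a: "a < r" for a
  proof -
    have ga: "g a \<in> carrier_vec d" using g a by simp
    show 1: "form M z (g a) = 0"
      unfolding z_def using form_smult(1)[OF M(1) yc ga] y(1) a by (simp add: C_def)
    show "form M (g a) z = 0" using form_hermitian[OF M(1) herm zc ga] 1 by simp
  qed
  have Az: "A *\<^sub>v z = complex_of_real t \<cdot>\<^sub>v (M *\<^sub>v z)"
    unfolding z_def mult_mat_vec[OF A(1) yc] mult_mat_vec[OF M(1) yc] Ay t
    by (simp add: smult_smult_assoc mult.commute)
  show ?case
  proof (intro exI[of _ "g(r := z)"] exI[of _ "\<theta>(r := t)"] conjI allI impI)
    fix a b assume "a < Suc r" "b < Suc r"
    then show "form M ((g(r := z)) a) ((g(r := z)) b) = (if a = b then 1 else 0)"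
      using orth zz zg by (auto simp: less_Suc_eq)
  qed (use g zc eig Az in \<open>auto simp: less_Suc_eq\<close>)
qed

lemma pencil_eigenbasis:
  fixes A M :: "complex mat"
  assumes A: "A \<in> carrier_mat d d" "hermitian_mat A" and M: "M \<in> carrier_mat d d" "posdef_mat M"
  obtains g \<theta> where "\<And>a. a \<in> {1..d} \<Longrightarrow> g a \<in> carrier_vec d"
    and "\<And>a. a \<in> {1..d} \<Longrightarrow> A *\<^sub>v g a = complex_of_real (\<theta> a) \<cdot>\<^sub>v (M *\<^sub>v g a)"
    and "\<And>a b. a \<in> {1..d} \<Longrightarrow> b \<in> {1..d} \<Longrightarrow> form M (g a) (g b) = (if a = b then 1 else 0)"
    and "\<And>a b. 1 \<le> a \<Longrightarrow> a \<le> b \<Longrightarrow> b \<le> d \<Longrightarrow> \<theta> a \<le> \<theta> b"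
proof -
  from pencil_eigenvectors[OF assms order_refl] obtain g \<theta> where g: "\<forall>a<d. g a \<in> carrier_vec d"
    and eig: "\<forall>a<d. A *\<^sub>v g a = complex_of_real (\<theta> a) \<cdot>\<^sub>v (M *\<^sub>v g a)"
    and orth: "\<forall>a<d. \<forall>b<d. form M (g a) (g b) = (if a = b then 1 else 0)" by (elim exE conjE)
  \<comment> \<open>A permutation of the indices that sorts the eigenvalues. Positions count from 0
    and eigenvalues from 1, hence the shifts by one.\<close>
  define ps where "ps = sort_key \<theta> [0..<d]"
  have ps: "length ps = d" "distinct ps" "set ps = {..<d}" "sorted (map \<theta> ps)"
    by (auto simp: ps_def)
  have lt: "ps ! (a - 1) < d" if "a \<in> {1..d}" for a
  proof -
    have "a - 1 < length ps" using that ps(1) by auto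
    then have "ps ! (a - 1) \<in> set ps" by (rule nth_mem)
    then show ?thesis unfolding ps(3) by simp
  qed
  show ?thesis
  proof (rule that[of "\<lambda>a. g (ps ! (a - 1))" "\<lambda>a. \<theta> (ps ! (a - 1))"])
    fix a b assume ab: "a \<in> {1..d}" "b \<in> {1..d}"
    then have "a - 1 < length ps" "b - 1 < length ps" unfolding ps(1) by auto
    then have "ps ! (a - 1) = ps ! (b - 1) \<longleftrightarrow> a - 1 = b - 1" by (rule nth_eq_iff_index_eq[OF ps(2)])
    also have "\<dots> \<longleftrightarrow> a = b" using ab by auto
    finally have "ps ! (a - 1) = ps ! (b - 1) \<longleftrightarrow> a = b" .
    then show "form M (g (ps ! (a - 1))) (g (ps ! (b - 1))) = (if a = b then 1 else 0)"
      using orth lt[OF ab(1)] lt[OF ab(2)] by simp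
  next
    fix a b assume ab: "1 \<le> a" "a \<le> b" "b \<le> d"
    then show "\<theta> (ps ! (a - 1)) \<le> \<theta> (ps ! (b - 1))"
      using sorted_nth_mono[OF ps(4), of "a - 1" "b - 1"] unfolding length_map ps(1) by (simp add: ps(1))
  next
    fix a assume "a \<in> {1..d}"
    from lt[OF this] g eig show "g (ps ! (a - 1)) \<in> carrier_vec d"
      "A *\<^sub>v g (ps ! (a - 1)) = complex_of_real (\<theta> (ps ! (a - 1))) \<cdot>\<^sub>v (M *\<^sub>v g (ps ! (a - 1)))" by blast+
  qed
qed

lemma form_unit_vec:
  assumes X: "X \<in> carrier_mat d d" and ab: "a < d" "b < d"
  shows "form X (unit_vec d a) (unit_vec d b) = X $$ (b, a)"
proof -
  have "form X (unit_vec d a) (unit_vec d b)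
      = (\<Sum>i<d. (X *\<^sub>v unit_vec d a) $ i * cnj (unit_vec d b $ i))"
    by (simp add: form_def cscalar_prod_sum del: index_mult_mat_vec)
  also have "\<dots> = (\<Sum>i<d. if i = b then (X *\<^sub>v unit_vec d a) $ i else 0)"
    by (intro sum.cong refl) (simp add: unit_vec_def del: index_mult_mat_vec)
  also have "\<dots> = (X *\<^sub>v unit_vec d a) $ b" using ab by (simp del: index_mult_mat_vec)
  also have "\<dots> = (\<Sum>j<d. X $$ (b, j) * unit_vec d a $ j)"
    by (rule mult_mat_vec_sum[OF X _ ab(2)]) simp
  also have "\<dots> = (\<Sum>j<d. if j = a then X $$ (b, j) else 0)"
    by (intro sum.cong refl) (simp add: unit_vec_def)
  finally show ?thesis using ab by simp
qed

definition basis_mat :: "nat \<Rightarrow> (nat \<Rightarrow> complex vec) \<Rightarrow> complex mat" where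
  "basis_mat d g = mat d d (\<lambda>(i, a). g (Suc a) $ i)"

lemma basis_mat_carrier [simp]: "basis_mat d g \<in> carrier_mat d d"
  by (simp add: basis_mat_def)

lemma basis_mat_congruence:
  assumes B: "B \<in> carrier_mat d d" and g: "\<And>a. a \<in> {1..d} \<Longrightarrow> g a \<in> carrier_vec d"
    and ab: "a < d" "b < d"
  shows "(mat_adjoint (basis_mat d g) * B * basis_mat d g) $$ (b, a) = form B (g (Suc a)) (g (Suc b))"
proof -
  let ?G = "basis_mat d g"
  let ?X = "mat_adjoint ?G * B * ?G"
  have G: "?G \<in> carrier_mat d d" and G': "mat_adjoint ?G \<in> carrier_mat d d" by simp_all
  have X: "?X \<in> carrier_mat d d" using G' B G by (meson mult_carrier_mat)
  have colG: "?G *\<^sub>v unit_vec d a = g (Suc a)" if "a < d" for a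
    using that g[of "Suc a"] by (intro eq_vecI) (auto simp: basis_mat_def)
  have "form ?X (unit_vec d a) (unit_vec d b) = form B (g (Suc a)) (g (Suc b))"
    by (subst form_congruence[OF G B]) (auto simp: colG ab)
  then show ?thesis using form_unit_vec[OF X ab] by simp
qed

lemma basis_mat_orthonormal:
  assumes M: "M \<in> carrier_mat d d" and g: "\<And>a. a \<in> {1..d} \<Longrightarrow> g a \<in> carrier_vec d"
    and orth: "\<And>a b. a \<in> {1..d} \<Longrightarrow> b \<in> {1..d} \<Longrightarrow> form M (g a) (g b) = (if a = b then 1 else 0)"
  shows "mat_adjoint (basis_mat d g) * M * basis_mat d g = 1\<^sub>m d"
proof (rule eq_matI)
  fix b a assume "b < dim_row (1\<^sub>m d :: complex mat)" "a < dim_col (1\<^sub>m d :: complex mat)"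
  then have ab: "a < d" "b < d" by auto
  have "(mat_adjoint (basis_mat d g) * M * basis_mat d g) $$ (b, a) = form M (g (Suc a)) (g (Suc b))"
    by (rule basis_mat_congruence[OF M _ ab]) (rule g)
  then show "(mat_adjoint (basis_mat d g) * M * basis_mat d g) $$ (b, a) = 1\<^sub>m d $$ (b, a)"
    using ab by (simp add: orth del: index_mult_mat)
qed (auto simp: basis_mat_def)

lemma sum_singleton_mset_upt: "(\<Sum>a<d. {#f a#}) = mset (map f [0..<d])"
  by (induction d) auto

text \<open>Connects the roots of the determinant with eigenvectors: congruence with the eigenvector
  matrix makes the pencil diagonal and multiplies its determinant by a nonzero constant. The roots
  with multiplicity are therefore the listed eigenvalues, already in order.\<close>

lemma pair_eigval_eigenbasis:
  fixes A M :: "complex mat"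
  assumes A: "A \<in> carrier_mat d d" and M: "M \<in> carrier_mat d d"
    and g: "\<And>a. a \<in> {1..d} \<Longrightarrow> g a \<in> carrier_vec d"
    and eig: "\<And>a. a \<in> {1..d} \<Longrightarrow> A *\<^sub>v g a = complex_of_real (\<theta> a) \<cdot>\<^sub>v (M *\<^sub>v g a)"
    and orth: "\<And>a b. a \<in> {1..d} \<Longrightarrow> b \<in> {1..d} \<Longrightarrow> form M (g a) (g b) = (if a = b then 1 else 0)"
    and mono: "\<And>a b. 1 \<le> a \<Longrightarrow> a \<le> b \<Longrightarrow> b \<le> d \<Longrightarrow> \<theta> a \<le> \<theta> b"
    and a: "a \<in> {1..d}"
  shows "pair_eigval A M a = \<theta> a"
proof -
  define G where "G = basis_mat d g"
  have G: "G \<in> carrier_mat d d" by (simp add: G_def)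
  have G': "mat_adjoint G \<in> carrier_mat d d" using G by simp
  have entry: "(mat_adjoint G * B * G) $$ (b, a) = form B (g (Suc a)) (g (Suc b))"
    if "B \<in> carrier_mat d d" "a < d" "b < d" for B a b
    unfolding G_def by (rule basis_mat_congruence[OF that(1) _ that(2,3)]) (rule g)
  define p where "p = pencil_poly A M"
  define \<gamma> where "\<gamma> = det (mat_adjoint G) * det G"
  have detprod: "det (mat_adjoint G * B * G) = \<gamma> * det B" if B: "B \<in> carrier_mat d d" for B
  proof -
    have GB: "mat_adjoint G * B \<in> carrier_mat d d" using G' B by (rule mult_carrier_mat)
    show ?thesis by (simp add: det_mult[OF GB G] det_mult[OF G' B] \<gamma>_def)
  qed
  have GM: "mat_adjoint G * M * G = 1\<^sub>m d"
    unfolding G_def by (rule basis_mat_orthonormal[OF M g orth])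
  have "\<gamma> * det M = 1" using detprod[OF M] GM by simp
  then have \<gamma>0: "\<gamma> \<noteq> 0" by auto
  have form_pencil: "form (A - x \<cdot>\<^sub>m M) (g a) (g b) = (if a = b then complex_of_real (\<theta> a) - x else 0)"
    if ab: "a \<in> {1..d}" "b \<in> {1..d}" for a b x
  proof -
    have ga: "g a \<in> carrier_vec d" and gb: "g b \<in> carrier_vec d" using g ab by auto
    have Mg: "M *\<^sub>v g a \<in> carrier_vec d" using M ga by simp
    have "(A - x \<cdot>\<^sub>m M) *\<^sub>v g a = (complex_of_real (\<theta> a) - x) \<cdot>\<^sub>v (M *\<^sub>v g a)"
    proof -
      have "(A - x \<cdot>\<^sub>m M) *\<^sub>v g a = A *\<^sub>v g a - (x \<cdot>\<^sub>m M) *\<^sub>v g a"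
        using A M ga by (intro minus_mult_distrib_mat_vec[of _ d d]) auto
      also have "(x \<cdot>\<^sub>m M) *\<^sub>v g a = x \<cdot>\<^sub>v (M *\<^sub>v g a)" using M ga by (intro eq_vecI) auto
      finally show ?thesis unfolding eig[OF ab(1)] using Mg
        by (intro eq_vecI) (auto simp: left_diff_distrib simp del: index_mult_mat_vec)
    qed
    then have "form (A - x \<cdot>\<^sub>m M) (g a) (g b) = (complex_of_real (\<theta> a) - x) * form M (g a) (g b)"
      unfolding form_def using Mg gb by (simp add: smult_vec_cscalar_prod[of _ d])
    then show ?thesis using orth[OF ab] by simp
  qed
  have "poly (smult \<gamma> p) x = poly (\<Prod>a<d. [:complex_of_real (\<theta> (Suc a)), -1:]) x" for x
  proof -
    let ?B = "A - x \<cdot>\<^sub>m M"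
    have B: "?B \<in> carrier_mat d d" using A M by (simp add: minus_carrier_mat)
    have X: "mat_adjoint G * ?B * G \<in> carrier_mat d d" using G' B G by (meson mult_carrier_mat)
    have "poly p x = det ?B"
      unfolding p_def pencil_poly_def
      by (rule poly_det_cong[OF B]) (use A M in auto)
    then have "poly (smult \<gamma> p) x = det (mat_adjoint G * ?B * G)" using detprod[OF B] by simp
    also have "\<dots> = prod_list (diag_mat (mat_adjoint G * ?B * G))"
    proof (rule det_upper_triangular[OF _ X])
      show "upper_triangular (mat_adjoint G * ?B * G)"
        unfolding upper_triangular_def
      proof (intro allI impI)
        fix i j assume "i < dim_row (mat_adjoint G * ?B * G)" "j < i"
        moreover from this have "i < d" using G by simp
        ultimately show "(mat_adjoint G * ?B * G) $$ (i, j) = 0"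
          by (simp add: entry[OF B] form_pencil del: index_mult_mat)
      qed
    qed
    also have "\<dots> = (\<Prod>a<d. (mat_adjoint G * ?B * G) $$ (a, a))"
      using X by (simp add: diag_mat_def prod.list_conv_set_nth atLeast0LessThan del: index_mult_mat)
    also have "\<dots> = (\<Prod>a<d. complex_of_real (\<theta> (Suc a)) - x)"
      by (intro prod.cong refl) (simp add: entry[OF B] form_pencil del: index_mult_mat)
    finally show ?thesis by (simp add: poly_prod)
  qed
  then have p_eq: "smult \<gamma> p = (\<Prod>a<d. [:complex_of_real (\<theta> (Suc a)), -1:])"
    by (simp add: poly_eq_poly_eq_iff[symmetric] fun_eq_iff)
  have "proots p = proots (smult \<gamma> p)" using \<gamma>0 by simp
  also have "\<dots> = (\<Sum>a<d. proots [:complex_of_real (\<theta> (Suc a)), -1:])"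
    unfolding p_eq by (rule proots_prod) simp
  also have "\<dots> = (\<Sum>a<d. {#complex_of_real (\<theta> (Suc a))#})"
  proof (intro sum.cong refl)
    fix a
    have "[:complex_of_real (\<theta> (Suc a)), -1:] = - [:- complex_of_real (\<theta> (Suc a)), 1:]" by simp
    then show "proots [:complex_of_real (\<theta> (Suc a)), -1:] = {#complex_of_real (\<theta> (Suc a))#}"
      by (simp only: proots_uminus proots_linear_factor minus_minus)
  qed
  also have "\<dots> = mset (map (\<lambda>a. complex_of_real (\<theta> (Suc a))) [0..<d])" by (rule sum_singleton_mset_upt)
  finally have roots: "image_mset Re (proots p) = mset (map (\<lambda>a. \<theta> (Suc a)) [0..<d])"
    by (simp add: multiset.map_comp comp_def)
  have "pair_eigvals A M = sort (map (\<lambda>a. \<theta> (Suc a)) [0..<d])"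
    unfolding pair_eigvals_def p_def[symmetric] roots by (rule sorted_list_of_multiset_mset)
  also have "\<dots> = map (\<lambda>a. \<theta> (Suc a)) [0..<d]"
    by (intro sorted_sort_id) (auto simp: sorted_iff_nth_mono intro: mono)
  finally show ?thesis using a by (cases a) (auto simp: pair_eigval_def)
qed


lemma eigenbasis_expansion:
  fixes M :: "complex mat"
  assumes M: "M \<in> carrier_mat d d"
    and g: "\<And>a. a \<in> {1..d} \<Longrightarrow> g a \<in> carrier_vec d"
    and orth: "\<And>a b. a \<in> {1..d} \<Longrightarrow> b \<in> {1..d} \<Longrightarrow> form M (g a) (g b) = (if a = b then 1 else 0)"
    and v: "v \<in> carrier_vec d"
  shows "v = vcomb d g (\<lambda>a. form M v (g a)) d"
proof -
  define G where "G = basis_mat d g"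
  have G: "G \<in> carrier_mat d d" by (simp add: G_def)
  have G': "mat_adjoint G \<in> carrier_mat d d" using G by simp
  have GM: "mat_adjoint G * M \<in> carrier_mat d d" using G' M by (rule mult_carrier_mat)
  have "mat_adjoint G * M * G = 1\<^sub>m d"
    unfolding G_def by (rule basis_mat_orthonormal[OF M g orth])
  then have inv: "G * (mat_adjoint G * M) = 1\<^sub>m d" by (rule mat_mult_left_right_inverse[OF GM G])
  have Mv: "M *\<^sub>v v \<in> carrier_vec d" using M v by simp
  define h where "h = mat_adjoint G *\<^sub>v (M *\<^sub>v v)"
  have h: "h \<in> carrier_vec d" unfolding h_def using G' Mv by (rule mult_mat_vec_carrier)
  have h_eq: "h $ a = form M v (g (Suc a))" if a: "a < d" for a
  proof -
    have ga: "g (Suc a) \<in> carrier_vec d" using g a by simp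
    have "h $ a = (\<Sum>i<d. mat_adjoint G $$ (a, i) * (M *\<^sub>v v) $ i)"
      unfolding h_def by (rule mult_mat_vec_sum[OF G' Mv a])
    also have "\<dots> = (\<Sum>i<d. (M *\<^sub>v v) $ i * cnj (g (Suc a) $ i))"
      using a G by (intro sum.cong refl)
        (simp add: mat_adjoint_index G_def basis_mat_def mult.commute del: index_mult_mat_vec)
    finally show ?thesis unfolding form_def cscalar_prod_sum using ga by simp
  qed
  have "v = (G * (mat_adjoint G * M)) *\<^sub>v v" unfolding inv using v by simp
  also have "\<dots> = G *\<^sub>v h"
    unfolding h_def assoc_mult_mat_vec[OF G GM v] assoc_mult_mat_vec[OF G' M v] ..
  also have "\<dots> = vcomb d g (\<lambda>a. form M v (g a)) d"
  proof (rule eq_vecI)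
    fix i assume "i < dim_vec (vcomb d g (\<lambda>a. form M v (g a)) d)"
    then have i: "i < d" by (simp add: vcomb_def)
    have "(G *\<^sub>v h) $ i = (\<Sum>a<d. G $$ (i, a) * h $ a)" by (rule mult_mat_vec_sum[OF G h i])
    also have "\<dots> = (\<Sum>a<d. form M v (g (Suc a)) * g (Suc a) $ i)"
      using i by (intro sum.cong refl) (simp add: h_eq G_def basis_mat_def)
    also have "\<dots> = (\<Sum>j\<in>{1..d}. form M v (g j) * g j $ i)" by (simp add: sum.atLeast1_atMost_eq)
    finally show "(G *\<^sub>v h) $ i = vcomb d g (\<lambda>a. form M v (g a)) d $ i" using i by (simp add: vcomb_def)
  qed (use G in \<open>simp add: vcomb_def\<close>)
  finally show ?thesis .
qed

section \<open>Ritz values of a subspace and their min-max bound\<close>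

lemma col_span_iff:
  fixes W :: "complex mat"
  assumes "W \<in> carrier_mat n d"
  shows "x \<in> col_span n W \<longleftrightarrow> (\<exists>g\<in>carrier_vec d. x = W *\<^sub>v g)"
  using vec_space.col_space_eq[OF assms] assms by auto

lemma col_span_vcomb:
  assumes W: "W \<in> carrier_mat n d" and x: "\<And>j. j \<in> {1..m} \<Longrightarrow> x j \<in> col_span n W"
  shows "vcomb n x c m \<in> col_span n W"
proof -
  have "\<forall>j\<in>{1..m}. \<exists>g. g \<in> carrier_vec d \<and> x j = W *\<^sub>v g"
    using x col_span_iff[OF W] by blast
  then obtain g where g: "\<forall>j\<in>{1..m}. g j \<in> carrier_vec d \<and> x j = W *\<^sub>v g j"
    unfolding bchoice_iff by blast
  have "vcomb n x c m = vcomb n (\<lambda>j. W *\<^sub>v g j) c m" using g by (intro vcomb_cong) auto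
  also have "\<dots> = W *\<^sub>v vcomb d g c m"
    by (rule mult_mat_vcomb[OF W, symmetric]) (use g in auto)
  finally show ?thesis unfolding col_span_iff[OF W] using vcomb_carrier by blast
qed

lemma full_col_rank_injective:
  fixes W :: "complex mat" and g :: "complex vec"
  assumes W: "full_col_rank n W" and g: "g \<in> carrier_vec (dim_col W)" and z: "W *\<^sub>v g = 0\<^sub>v n"
  shows "g = 0\<^sub>v (dim_col W)"
proof (rule ccontr)
  assume nz: "g \<noteq> 0\<^sub>v (dim_col W)"
  interpret vec_space "TYPE(complex)" n .
  have Wc: "W \<in> carrier_mat n (dim_col W)" and rank: "rank W = dim_col W"
    using W by (auto simp: full_col_rank_def)
  have cols: "set (cols W) \<subseteq> carrier_vec n" using Wc cols_dim by blast
  \<comment> \<open>The rank is the size of a maximal independent subset of the set of columns. A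
    repeated column would leave fewer than \<open>dim_col W\<close> vectors, and only distinct
    columns can be matched with coefficients.\<close>
  have dist: "distinct (cols W)"
  proof (rule ccontr)
    assume "\<not> distinct (cols W)"
    then have "card (set (cols W)) < dim_col W"
      by (metis card_distinct card_length cols_length le_neq_implies_less)
    moreover have "rank W \<le> card (set (cols W))"
    proof -
      obtain S where S: "maximal S (\<lambda>T. T \<subseteq> set (cols W) \<and> lin_indpt T)"
        using maximal_exists_superset[of "set (cols W)" "\<lambda>T. T \<subseteq> set (cols W) \<and> lin_indpt T" "{}"]
        by (auto simp: lin_dep_def)
      then have "S \<subseteq> set (cols W)" by (simp add: maximal_def)
      then show ?thesis using rank_card_indpt[OF Wc S] by (simp add: card_mono)
    qed
    ultimately show False using rank by simp
  qed
  from full_rank_lin_indpt[OF Wc rank dist] lin_depI[OF Wc g nz z dist] show False by simp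
qed

text \<open>Full rank makes the projected matrix of \<open>S\<close> positive definite. The
  eigenbasis of the projected pencil, mapped by \<open>W\<close>, diagonalises both forms on the
  subspace at once.\<close>

lemma ritz_basis:
  fixes H S W :: "complex mat"
  assumes H: "H \<in> carrier_mat n n" "hermitian_mat H" and S: "S \<in> carrier_mat n n" "posdef_mat S"
    and W: "full_col_rank n W" and d: "d = dim_col W"
  obtains w where "\<And>a. a \<in> {1..d} \<Longrightarrow> w a \<in> col_span n W"
    and "\<And>a b. a \<in> {1..d} \<Longrightarrow> b \<in> {1..d} \<Longrightarrow> form S (w a) (w b) = (if a = b then 1 else 0)"
    and "\<And>a b. a \<in> {1..d} \<Longrightarrow> b \<in> {1..d} \<Longrightarrow>
      form H (w a) (w b) = (if a = b then complex_of_real (ritz_value H S W a) else 0)"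
    and "\<And>x. x \<in> col_span n W \<Longrightarrow> x = vcomb n w (\<lambda>a. form S x (w a)) d"
    and "\<And>a b. 1 \<le> a \<Longrightarrow> a \<le> b \<Longrightarrow> b \<le> d \<Longrightarrow> ritz_value H S W a \<le> ritz_value H S W b"
proof -
  have Wc: "W \<in> carrier_mat n d" using W by (simp add: full_col_rank_def d)
  define A where "A = mat_adjoint W * H * W"
  define M where "M = mat_adjoint W * S * W"
  have carrier: "mat_adjoint W * B * W \<in> carrier_mat d d" if "B \<in> carrier_mat n n" for B
    using mat_adjoint_carrier[OF Wc] that Wc by (meson mult_carrier_mat)
  have A: "A \<in> carrier_mat d d" and M: "M \<in> carrier_mat d d"
    unfolding A_def M_def using H(1) S(1) carrier by auto
  have formA: "form A g h = form H (W *\<^sub>v g) (W *\<^sub>v h)"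
    and formM: "form M g h = form S (W *\<^sub>v g) (W *\<^sub>v h)"
    if "g \<in> carrier_vec d" "h \<in> carrier_vec d" for g h
    unfolding A_def M_def using form_congruence[OF Wc] H(1) S(1) that by auto
  have Wg: "W *\<^sub>v g \<in> carrier_vec n" if "g \<in> carrier_vec d" for g :: "complex vec" using Wc that by simp
  have herm: "hermitian_mat (mat_adjoint W * B * W)" if B: "B \<in> carrier_mat n n" "hermitian_mat B" for B
  proof -
    let ?X = "mat_adjoint W * B * W"
    note X = carrier[OF B(1)]
    have "mat_adjoint ?X = ?X"
    proof (rule eq_matI)
      fix i j assume "i < dim_row ?X" "j < dim_col ?X"
      then have ij: "i < d" "j < d" using X by auto
      have u: "unit_vec d i \<in> carrier_vec d" "unit_vec d j \<in> carrier_vec d" by auto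
      have "mat_adjoint ?X $$ (i, j) = cnj (form ?X (unit_vec d i) (unit_vec d j))"
        using ij carrier_matD[OF X] by (simp only: mat_adjoint_index form_unit_vec[OF X])
      also have "\<dots> = cnj (form B (W *\<^sub>v unit_vec d i) (W *\<^sub>v unit_vec d j))"
        by (simp only: form_congruence[OF Wc B(1) u])
      also have "\<dots> = form B (W *\<^sub>v unit_vec d j) (W *\<^sub>v unit_vec d i)"
        by (rule form_hermitian[OF B Wg[OF u(1)] Wg[OF u(2)], symmetric])
      also have "\<dots> = form ?X (unit_vec d j) (unit_vec d i)"
        by (simp only: form_congruence[OF Wc B(1) u(2,1)])
      also have "\<dots> = ?X $$ (i, j)" by (rule form_unit_vec[OF X ij(2,1)])
      finally show "mat_adjoint ?X $$ (i, j) = ?X $$ (i, j)" .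
    qed (use X in auto)
    then show ?thesis using X by (auto simp: hermitian_mat_def)
  qed
  have hA: "hermitian_mat A" unfolding A_def by (rule herm[OF H])
  have hM: "posdef_mat M"
    unfolding posdef_mat_def
  proof (intro conjI ballI impI)
    show "hermitian_mat M" unfolding M_def using S by (intro herm) (auto simp: posdef_mat_def)
    fix g :: "complex vec" assume "g \<in> carrier_vec (dim_row M)" "g \<noteq> 0\<^sub>v (dim_row M)"
    then have g: "g \<in> carrier_vec d" "g \<noteq> 0\<^sub>v d" using M by auto
    then have "W *\<^sub>v g \<noteq> 0\<^sub>v n" using full_col_rank_injective[OF W] d by blast
    then show "0 < Re ((M *\<^sub>v g) \<bullet>c g)"
      using posdef_form[OF S Wg[OF g(1)]] formM[OF g(1) g(1)] by (simp add: form_def)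
  qed
  obtain g \<theta> where g: "\<And>a. a \<in> {1..d} \<Longrightarrow> g a \<in> carrier_vec d"
    and eig: "\<And>a. a \<in> {1..d} \<Longrightarrow> A *\<^sub>v g a = complex_of_real (\<theta> a) \<cdot>\<^sub>v (M *\<^sub>v g a)"
    and orth: "\<And>a b. a \<in> {1..d} \<Longrightarrow> b \<in> {1..d} \<Longrightarrow> form M (g a) (g b) = (if a = b then 1 else 0)"
    and mono: "\<And>a b. 1 \<le> a \<Longrightarrow> a \<le> b \<Longrightarrow> b \<le> d \<Longrightarrow> \<theta> a \<le> \<theta> b"
    by (rule pencil_eigenbasis[OF A hA M hM]) blast
  have ritz: "ritz_value H S W a = \<theta> a" if "a \<in> {1..d}" for a
    unfolding ritz_value_def A_def[symmetric] M_def[symmetric]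
    by (rule pair_eigval_eigenbasis[OF A M g eig orth mono that])
  show ?thesis
  proof (rule that[of "\<lambda>a. W *\<^sub>v g a"])
    fix a assume "a \<in> {1..d}"
    then show "W *\<^sub>v g a \<in> col_span n W" unfolding col_span_iff[OF Wc] using g by blast
  next
    fix a b assume ab: "a \<in> {1..d}" "b \<in> {1..d}"
    show "form S (W *\<^sub>v g a) (W *\<^sub>v g b) = (if a = b then 1 else 0)"
      using formM[OF g[OF ab(1)] g[OF ab(2)]] orth[OF ab] by simp
    have "form H (W *\<^sub>v g a) (W *\<^sub>v g b) = form A (g a) (g b)"
      using formA[OF g[OF ab(1)] g[OF ab(2)]] by simp
    also have "\<dots> = complex_of_real (\<theta> a) * form M (g a) (g b)"
      unfolding form_def eig[OF ab(1)]
      by (rule smult_vec_cscalar_prod[of _ d]) (use M g[OF ab(1)] g[OF ab(2)] in auto)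
    finally show "form H (W *\<^sub>v g a) (W *\<^sub>v g b) = (if a = b then complex_of_real (ritz_value H S W a) else 0)"
      unfolding orth[OF ab] ritz[OF ab(1)] by simp
  next
    fix x assume "x \<in> col_span n W"
    then obtain h where h: "h \<in> carrier_vec d" "x = W *\<^sub>v h" unfolding col_span_iff[OF Wc] by blast
    have "x = W *\<^sub>v vcomb d g (\<lambda>a. form M h (g a)) d"
      using eigenbasis_expansion[OF M g orth h(1)] h(2) by simp
    also have "\<dots> = vcomb n (\<lambda>a. W *\<^sub>v g a) (\<lambda>a. form M h (g a)) d"
      by (rule mult_mat_vcomb[OF Wc]) (rule g)
    also have "\<dots> = vcomb n (\<lambda>a. W *\<^sub>v g a) (\<lambda>a. form S x (W *\<^sub>v g a)) d"
      using formM[OF h(1)] g h(2) by (intro vcomb_cong) auto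
    finally show "x = vcomb n (\<lambda>a. W *\<^sub>v g a) (\<lambda>a. form S x (W *\<^sub>v g a)) d" .
  next
    fix a b assume "1 \<le> a" "a \<le> b" "b \<le> d"
    then show "ritz_value H S W a \<le> ritz_value H S W b" using mono ritz by simp
  qed
qed

lemma form_eigenbasis:
  assumes S: "S \<in> carrier_mat n n" and H: "H \<in> carrier_mat n n"
    and w: "\<And>a. a \<in> {1..m} \<Longrightarrow> w a \<in> carrier_vec n"
    and orth: "\<And>a b. a \<in> {1..m} \<Longrightarrow> b \<in> {1..m} \<Longrightarrow> form S (w a) (w b) = (if a = b then 1 else 0)"
    and orthH: "\<And>a b. a \<in> {1..m} \<Longrightarrow> b \<in> {1..m} \<Longrightarrow>
      form H (w a) (w b) = (if a = b then complex_of_real (\<theta> a) else 0)"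
  shows "Re (form S (vcomb n w c m) (vcomb n w c m)) = (\<Sum>a\<in>{1..m}. (cmod (c a))\<^sup>2)"
    and "Re (form H (vcomb n w c m) (vcomb n w c m)) = (\<Sum>a\<in>{1..m}. \<theta> a * (cmod (c a))\<^sup>2)"
proof -
  have "form S (vcomb n w c m) (vcomb n w c m) = complex_of_real (\<Sum>a\<in>{1..m}. 1 * (cmod (c a))\<^sup>2)"
    by (rule sum_delta_form[OF S w]) (auto simp: orth)
  then show "Re (form S (vcomb n w c m) (vcomb n w c m)) = (\<Sum>a\<in>{1..m}. (cmod (c a))\<^sup>2)" by simp
  have "form H (vcomb n w c m) (vcomb n w c m) = complex_of_real (\<Sum>a\<in>{1..m}. \<theta> a * (cmod (c a))\<^sup>2)"
    by (rule sum_delta_form[OF H w]) (auto simp: orthH)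
  then show "Re (form H (vcomb n w c m) (vcomb n w c m)) = (\<Sum>a\<in>{1..m}. \<theta> a * (cmod (c a))\<^sup>2)"
    by (simp only: Re_complex_of_real)
qed

text \<open>The upper half of the Courant--Fischer principle. The test space, of dimension at least
  \<open>t\<close>, is given as the solution space of linear equations for the coefficients.\<close>

lemma ritz_value_le:
  fixes H S W :: "complex mat" and \<phi> :: "'e \<Rightarrow> nat \<Rightarrow> complex"
  assumes H: "H \<in> carrier_mat n n" "hermitian_mat H" and S: "S \<in> carrier_mat n n" "posdef_mat S"
    and W: "full_col_rank n W" and t: "1 \<le> t" "t \<le> dim_col W"
    and x: "\<And>j. j \<in> {1..m} \<Longrightarrow> x j \<in> col_span n W"
    and E: "finite E" "card E + t \<le> m"
    and bound: "\<And>c v. \<exists>j\<in>{1..m}. c j \<noteq> 0 \<Longrightarrow> \<forall>e\<in>E. (\<Sum>j\<in>{1..m}. \<phi> e j * c j) = 0 \<Longrightarrow>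
      v = vcomb n x c m \<Longrightarrow> v \<noteq> 0\<^sub>v n \<and> Re (form H v v) \<le> \<mu> * Re (form S v v)"
  shows "ritz_value H S W t \<le> \<mu>"
proof -
  define d where "d = dim_col W"
  have Wc: "W \<in> carrier_mat n d" using W by (simp add: full_col_rank_def d_def)
  have span_carrier: "y \<in> carrier_vec n" if "y \<in> col_span n W" for y
    using that Wc unfolding col_span_iff[OF Wc] by auto
  obtain w where w: "\<And>a. a \<in> {1..d} \<Longrightarrow> w a \<in> col_span n W"
    and orth: "\<And>a b. a \<in> {1..d} \<Longrightarrow> b \<in> {1..d} \<Longrightarrow> form S (w a) (w b) = (if a = b then 1 else 0)"
    and orthH: "\<And>a b. a \<in> {1..d} \<Longrightarrow> b \<in> {1..d} \<Longrightarrow>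
      form H (w a) (w b) = (if a = b then complex_of_real (ritz_value H S W a) else 0)"
    and expand: "\<And>x. x \<in> col_span n W \<Longrightarrow> x = vcomb n w (\<lambda>a. form S x (w a)) d"
    and mono: "\<And>a b. 1 \<le> a \<Longrightarrow> a \<le> b \<Longrightarrow> b \<le> d \<Longrightarrow> ritz_value H S W a \<le> ritz_value H S W b"
    by (rule ritz_basis[OF H S W d_def]) blast
  have wc: "w a \<in> carrier_vec n" if "a \<in> {1..d}" for a using span_carrier w that by blast
  \<comment> \<open>Two kinds of constraints on the \<open>m\<close> coefficients: those of the test
    space, and S-orthogonality to the first t - 1 Ritz vectors. Together they are fewer than
    \<open>m\<close>.\<close>
  have fin: "finite (E <+> {1..<t})" using E by simp
  have card: "card (E <+> {1..<t}) < card {1..m}" using E t by (simp add: card_Plus)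
  define \<psi> where "\<psi> = case_sum \<phi> (\<lambda>a j. form S (x j) (w a))"
  obtain c where c: "\<exists>j\<in>{1..m}. c j \<noteq> 0"
    "\<forall>e\<in>E <+> {1..<t}. (\<Sum>j\<in>{1..m}. \<psi> e j * c j) = 0"
    by (rule nontrivial_solution[OF fin finite_atLeastAtMost card, of \<psi>])
  define v where "v = vcomb n x c m"
  have "(\<Sum>j\<in>{1..m}. \<phi> e j * c j) = 0" if "e \<in> E" for e
    using bspec[OF c(2) InlI[OF that]] by (simp add: \<psi>_def)
  then have v: "v \<noteq> 0\<^sub>v n" "Re (form H v v) \<le> \<mu> * Re (form S v v)"
    using bound[OF c(1) _ v_def] by blast+
  have vW: "v \<in> col_span n W" unfolding v_def by (rule col_span_vcomb[OF Wc]) (rule x)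
  define b where "b = (\<lambda>a. form S v (w a))"
  have b0: "b a = 0" if a: "a \<in> {1..<t}" for a
  proof -
    have "w a \<in> carrier_vec n" using wc a t by (simp add: d_def)
    then have "b a = (\<Sum>j\<in>{1..m}. c j * form S (x j) (w a))"
      unfolding b_def v_def using x span_carrier by (intro form_vcomb_left[OF S(1)]) auto
    also have "\<dots> = (\<Sum>j\<in>{1..m}. form S (x j) (w a) * c j)" by (simp add: mult.commute)
    also have "\<dots> = 0" using bspec[OF c(2) InrI[OF a]] by (simp add: \<psi>_def)
    finally show ?thesis .
  qed
  have v_eq: "v = vcomb n w b d" unfolding b_def by (rule expand[OF vW])
  have forms: "Re (form S v v) = (\<Sum>a\<in>{1..d}. (cmod (b a))\<^sup>2)"
    "Re (form H v v) = (\<Sum>a\<in>{1..d}. ritz_value H S W a * (cmod (b a))\<^sup>2)"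
    unfolding v_eq by (rule form_eigenbasis[OF S(1) H(1) wc orth orthH]; assumption)+
  have "ritz_value H S W t * Re (form S v v) \<le> Re (form H v v)"
    unfolding forms sum_distrib_left
  proof (intro sum_mono)
    fix a assume a: "a \<in> {1..d}"
    show "ritz_value H S W t * (cmod (b a))\<^sup>2 \<le> ritz_value H S W a * (cmod (b a))\<^sup>2"
      using b0[of a] mono[of t a] a t by (cases "a < t") (auto intro: mult_right_mono)
  qed
  with v(2) have "ritz_value H S W t * Re (form S v v) \<le> \<mu> * Re (form S v v)" by simp
  moreover have "0 < Re (form S v v)" by (rule posdef_form[OF S span_carrier[OF vW] v(1)])
  ultimately show ?thesis by simp
qed

section \<open>Ritz pairs and coordinates on the deflated space\<close>

lemma orthonormal_cols_form:
  fixes Z :: "complex mat"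
  assumes S: "S \<in> carrier_mat n n" and Z: "Z \<in> carrier_mat n m" and orth: "orthonormal_cols S Z"
    and ab: "a < m" "b < m"
  shows "form S (col Z a) (col Z b) = (if a = b then 1 else 0)"
proof -
  have X: "mat_adjoint Z * S * Z \<in> carrier_mat m m"
    using mat_adjoint_carrier[OF Z] S Z by (meson mult_carrier_mat)
  have u: "unit_vec m a \<in> carrier_vec m" "unit_vec m b \<in> carrier_vec m" by auto
  have colZ: "Z *\<^sub>v unit_vec m a = col Z a" if "a < m" for a
    using Z that by (intro eq_vecI) auto
  have "form S (col Z a) (col Z b) = form (mat_adjoint Z * S * Z) (unit_vec m a) (unit_vec m b)"
    unfolding form_congruence[OF Z S u] colZ[OF ab(1)] colZ[OF ab(2)] ..
  also have "\<dots> = (mat_adjoint Z * S * Z) $$ (b, a)" by (rule form_unit_vec[OF X ab])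
  also have "\<dots> = 1\<^sub>m m $$ (b, a)" using orth Z by (simp add: orthonormal_cols_def)
  finally show ?thesis using ab by auto
qed

lemma mult_mat_vec_vcomb:
  fixes W :: "complex mat"
  assumes W: "W \<in> carrier_mat n d" and g: "g \<in> carrier_vec d"
  shows "W *\<^sub>v g = vcomb n (\<lambda>j. col W (j - 1)) (\<lambda>j. g $ (j - 1)) d"
proof (rule eq_vecI)
  fix r assume "r < dim_vec (vcomb n (\<lambda>j. col W (j - 1)) (\<lambda>j. g $ (j - 1)) d)"
  then have r: "r < n" by (simp add: vcomb_def)
  have "(W *\<^sub>v g) $ r = (\<Sum>j<d. W $$ (r, j) * g $ j)" by (rule mult_mat_vec_sum[OF W g r])
  also have "\<dots> = (\<Sum>j\<in>{1..d}. g $ (j - 1) * col W (j - 1) $ r)"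
    using W r by (simp add: sum.atLeast1_atMost_eq mult.commute)
  finally show "(W *\<^sub>v g) $ r = vcomb n (\<lambda>j. col W (j - 1)) (\<lambda>j. g $ (j - 1)) d $ r"
    using r by (simp add: vcomb_def)
qed (use W in \<open>simp add: vcomb_def\<close>)

lemma col_in_col_span: "W \<in> carrier_mat n d \<Longrightarrow> j < d \<Longrightarrow> col W j \<in> col_span n W"
  for W :: "complex mat"
  unfolding col_span_iff by (intro bexI[of _ "unit_vec d j"] eq_vecI) auto

lemma col_span_add_smult:
  fixes W :: "complex mat"
  assumes W: "W \<in> carrier_mat n d" and xy: "x \<in> col_span n W" "y \<in> col_span n W"
  shows "a \<cdot>\<^sub>v x + b \<cdot>\<^sub>v y \<in> col_span n W"
proof -
  obtain g h where gh: "g \<in> carrier_vec d" "x = W *\<^sub>v g" "h \<in> carrier_vec d" "y = W *\<^sub>v h"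
    using xy unfolding col_span_iff[OF W] by blast
  have "a \<cdot>\<^sub>v x + b \<cdot>\<^sub>v y = W *\<^sub>v (a \<cdot>\<^sub>v g + b \<cdot>\<^sub>v h)"
    using gh by (subst mult_add_distrib_mat_vec[OF W]) (auto simp: mult_mat_vec[OF W])
  then show ?thesis unfolding col_span_iff[OF W] using gh by (intro bexI[of _ "a \<cdot>\<^sub>v g + b \<cdot>\<^sub>v h"]) auto
qed

lemma col_span_carrier: "W \<in> carrier_mat n d \<Longrightarrow> x \<in> col_span n W \<Longrightarrow> x \<in> carrier_vec n"
  for W :: "complex mat"
  by (auto simp: col_span_iff)

lemma ritz_pair_form:
  assumes H: "H \<in> carrier_mat n n" and S: "S \<in> carrier_mat n n" and W: "W \<in> carrier_mat n d"
    and pair: "ritz_pair H S W \<theta> x" and y: "y \<in> col_span n W"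
  shows "x \<in> col_span n W" "form H x y = complex_of_real \<theta> * form S x y"
proof -
  obtain g where g: "g \<in> carrier_vec d" "x = W *\<^sub>v g"
    and eq: "(mat_adjoint W * H * W) *\<^sub>v g = complex_of_real \<theta> \<cdot>\<^sub>v ((mat_adjoint W * S * W) *\<^sub>v g)"
    using pair W unfolding ritz_pair_def by auto
  obtain h where h: "h \<in> carrier_vec d" "y = W *\<^sub>v h" using y unfolding col_span_iff[OF W] by blast
  show "x \<in> col_span n W" unfolding col_span_iff[OF W] using g by blast
  have M: "mat_adjoint W * S * W \<in> carrier_mat d d"
    using mat_adjoint_carrier[OF W] S W by (meson mult_carrier_mat)
  have "form H x y = form (mat_adjoint W * H * W) g h"
    unfolding g(2) h(2) form_congruence[OF W H g(1) h(1)] ..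
  also have "\<dots> = complex_of_real \<theta> * form (mat_adjoint W * S * W) g h"
    unfolding form_def eq by (rule smult_vec_cscalar_prod[OF mult_mat_vec_carrier[OF M g(1)] h(1)])
  also have "form (mat_adjoint W * S * W) g h = form S x y"
    unfolding g(2) h(2) form_congruence[OF W S g(1) h(1)] ..
  finally show "form H x y = complex_of_real \<theta> * form S x y" .
qed

text \<open>The Ritz vectors belonging to one basis matrix are test vectors for the other. This
  makes the initial Ritz values a function of the initial subspace, which is all that runs with
  different Z 0 share.\<close>

lemma ritz_value_cong_span:
  assumes H: "H \<in> carrier_mat n n" "hermitian_mat H" and S: "S \<in> carrier_mat n n" "posdef_mat S"
    and W: "full_col_rank n W" "dim_col W = d" and W': "full_col_rank n W'" "dim_col W' = d"
    and span: "col_span n W = col_span n W'" and t: "1 \<le> t" "t \<le> d"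
  shows "ritz_value H S W t = ritz_value H S W' t"
proof -
  have le: "ritz_value H S W t \<le> ritz_value H S W' t"
    if W: "full_col_rank n W" "dim_col W = d" and W': "full_col_rank n W'" "dim_col W' = d"
      and span: "col_span n W = col_span n W'" for W W'
  proof -
    have W'c: "W' \<in> carrier_mat n d" using W' by (simp add: full_col_rank_def)
    obtain w where w: "\<And>a. a \<in> {1..d} \<Longrightarrow> w a \<in> col_span n W'"
      and orth: "\<And>a b. a \<in> {1..d} \<Longrightarrow> b \<in> {1..d} \<Longrightarrow> form S (w a) (w b) = (if a = b then 1 else 0)"
      and orthH: "\<And>a b. a \<in> {1..d} \<Longrightarrow> b \<in> {1..d} \<Longrightarrow>
        form H (w a) (w b) = (if a = b then complex_of_real (ritz_value H S W' a) else 0)"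
      and mono: "\<And>a b. 1 \<le> a \<Longrightarrow> a \<le> b \<Longrightarrow> b \<le> d \<Longrightarrow> ritz_value H S W' a \<le> ritz_value H S W' b"
      by (rule ritz_basis[OF H S W'(1) W'(2)[symmetric]]) blast
    show ?thesis
    proof (rule ritz_value_le[OF H S W(1) t(1), where x = w and m = t and E = "{}" and \<phi> = "\<lambda>_ _. 0"])
      show "t \<le> dim_col W" using t W by simp
      show "w j \<in> col_span n W" if "j \<in> {1..t}" for j using w that t span by auto
      fix c v assume c: "\<exists>j\<in>{1..t}. c j \<noteq> 0" and v: "v = vcomb n w c t"
      have forms: "Re (form S v v) = (\<Sum>a\<in>{1..t}. (cmod (c a))\<^sup>2)"
        "Re (form H v v) = (\<Sum>a\<in>{1..t}. ritz_value H S W' a * (cmod (c a))\<^sup>2)"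
        unfolding v using t w orth orthH col_span_carrier[OF W'c]
        by (intro form_eigenbasis[OF S(1) H(1)]; auto)+
      have "0 < Re (form S v v)" unfolding forms using c by (auto intro!: sum_pos2)
      then have "v \<noteq> 0\<^sub>v n" using S(1) by (auto simp: form_def cscalar_prod_sum)
      moreover have "Re (form H v v) \<le> ritz_value H S W' t * Re (form S v v)"
        unfolding forms sum_distrib_left using mono t by (intro sum_mono mult_right_mono) auto
      ultimately show "v \<noteq> 0\<^sub>v n \<and> Re (form H v v) \<le> ritz_value H S W' t * Re (form S v v)" ..
    qed auto
  qed
  from le[OF W W' span] le[OF W' W span[symmetric]] show ?thesis by simp
qed

section \<open>Eigencoordinates of the pair and the action of the preconditioner\<close>

locale bpsd =
  fixes n i k :: nat and H S K :: "complex mat" and u :: "nat \<Rightarrow> complex vec"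
    and \<sigma> :: real and lam :: "nat \<Rightarrow> real"
  assumes H: "H \<in> carrier_mat n n" "hermitian_mat H"
    and S: "S \<in> carrier_mat n n" "posdef_mat S"
    and ik: "1 \<le> i" "1 \<le> k" "i + k \<le> n"
    and lam_def: "\<And>l. lam l = pair_eigval H S l"
    and u_carrier: "\<And>l. l \<in> {1..n} \<Longrightarrow> u l \<in> carrier_vec n"
    and u_orthonormal: "orthonormal_cols S (mat_of_cols n (map u [1..<n + 1]))"
    and u_eigen: "\<And>l. l \<in> {1..n} \<Longrightarrow> H *\<^sub>v u l = complex_of_real (lam l) \<cdot>\<^sub>v (S *\<^sub>v u l)"
    and \<sigma>: "\<sigma> < lam i"
    and K: "K \<in> carrier_mat n n"
      "inverts_mat K (H - complex_of_real \<sigma> \<cdot>\<^sub>m S)"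
      "inverts_mat (H - complex_of_real \<sigma> \<cdot>\<^sub>m S) K"
begin

lemma S_herm: "hermitian_mat S" using S(2) by (simp add: posdef_mat_def)

lemma u_form: "a \<in> {1..n} \<Longrightarrow> b \<in> {1..n} \<Longrightarrow> form S (u a) (u b) = (if a = b then 1 else 0)"
proof -
  let ?U = "mat_of_cols n (map u [1..<n + 1])"
  assume ab: "a \<in> {1..n}" "b \<in> {1..n}"
  have col: "col ?U (a - 1) = u a" if "a \<in> {1..n}" for a
    using that u_carrier[OF that] by (subst col_mat_of_cols) (auto simp del: upt_Suc)
  have "form S (col ?U (a - 1)) (col ?U (b - 1)) = (if a - 1 = b - 1 then 1 else 0)"
    using ab by (intro orthonormal_cols_form[OF S(1) _ u_orthonormal]) auto
  then show ?thesis using ab col by auto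
qed

lemma lam_mono: "1 \<le> a \<Longrightarrow> a \<le> b \<Longrightarrow> b \<le> n \<Longrightarrow> lam a \<le> lam b"
proof -
  assume ab: "1 \<le> a" "a \<le> b" "b \<le> n"
  obtain g \<theta> where g: "\<And>a. a \<in> {1..n} \<Longrightarrow> g a \<in> carrier_vec n"
    and eig: "\<And>a. a \<in> {1..n} \<Longrightarrow> H *\<^sub>v g a = complex_of_real (\<theta> a) \<cdot>\<^sub>v (S *\<^sub>v g a)"
    and orth: "\<And>a b. a \<in> {1..n} \<Longrightarrow> b \<in> {1..n} \<Longrightarrow> form S (g a) (g b) = (if a = b then 1 else 0)"
    and mono: "\<And>a b. 1 \<le> a \<Longrightarrow> a \<le> b \<Longrightarrow> b \<le> n \<Longrightarrow> \<theta> a \<le> \<theta> b"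
    by (rule pencil_eigenbasis[OF H S]) blast
  have "lam c = \<theta> c" if "c \<in> {1..n}" for c
    unfolding lam_def by (rule pair_eigval_eigenbasis[OF H(1) S(1) g eig orth mono that])
  then show ?thesis using mono[OF ab] ab by simp
qed

definition cf :: "complex vec \<Rightarrow> nat \<Rightarrow> complex" where
  "cf v j = form S v (u j)"

lemma u_form_H:
  assumes "a \<in> {1..n}" "x \<in> carrier_vec n"
  shows "form H (u a) x = complex_of_real (lam a) * form S (u a) x"
  unfolding form_def u_eigen[OF assms(1)]
  using mult_mat_vec_carrier[OF S(1) u_carrier[OF assms(1)]] assms(2) by (rule smult_vec_cscalar_prod)

lemma form_H_u:
  assumes "a \<in> {1..n}" "x \<in> carrier_vec n"
  shows "form H x (u a) = complex_of_real (lam a) * cf x a"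
  unfolding cf_def
  using form_hermitian[OF H u_carrier[OF assms(1)] assms(2)]
    form_hermitian[OF S(1) S_herm u_carrier[OF assms(1)] assms(2)] u_form_H[OF assms] by simp

lemma form_cf:
  assumes v: "v \<in> carrier_vec n"
  shows "Re (form S v v) = (\<Sum>j\<in>{1..n}. (cmod (cf v j))\<^sup>2)"
    and "Re (form H v v) = (\<Sum>j\<in>{1..n}. lam j * (cmod (cf v j))\<^sup>2)"
proof -
  have v_eq: "v = vcomb n u (cf v) n"
    unfolding cf_def by (rule eigenbasis_expansion[OF S(1) u_carrier u_form v])
  have uH: "form H (u a) (u b) = (if a = b then complex_of_real (lam a) else 0)"
    if "a \<in> {1..n}" "b \<in> {1..n}" for a b
    using u_form_H[OF that(1) u_carrier[OF that(2)]] u_form[OF that] by simp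
  note * = form_eigenbasis[OF S(1) H(1) u_carrier u_form uH, where c = "cf v" and m = n]
  show "Re (form S v v) = (\<Sum>j\<in>{1..n}. (cmod (cf v j))\<^sup>2)"
    by (subst v_eq, subst (2) v_eq) (rule *(1), assumption+)
  show "Re (form H v v) = (\<Sum>j\<in>{1..n}. lam j * (cmod (cf v j))\<^sup>2)"
    by (subst v_eq, subst (2) v_eq) (rule *(2), assumption+)
qed

lemma cf_vcomb:
  assumes "\<And>j. j \<in> {1..m} \<Longrightarrow> w j \<in> carrier_vec n" "l \<in> {1..n}"
  shows "cf (vcomb n w c m) l = (\<Sum>j\<in>{1..m}. c j * cf (w j) l)"
  unfolding cf_def by (rule form_vcomb_left[OF S(1) assms(1) u_carrier[OF assms(2)]])

text \<open>Deflation keeps the iterates in this space, on which \<open>N\<close>, \<open>\<mu>\<close> and \<open>\<beta>\<close> below describe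
  the spectrum: \<open>\<mu>\<close> lists the eigenvalues of \<open>(H, S)\<close>, and \<open>\<beta>\<close> those of \<open>(S, H - \<sigma> S)\<close>.\<close>

definition in_V :: "complex vec \<Rightarrow> bool" where
  "in_V v \<longleftrightarrow> v \<in> carrier_vec n \<and> (\<forall>j\<in>{1..<i}. cf v j = 0)"

definition N :: nat where "N = n - i + 1"
definition \<mu> :: "nat \<Rightarrow> real" where "\<mu> j = lam (i - 1 + j)"
definition \<beta> :: "nat \<Rightarrow> real" where "\<beta> j = 1 / (\<mu> j - \<sigma>)"
text \<open>The scaling turns the form of H - \<sigma> S into a plain sum of squares and that of
  \<open>S\<close> into a sum weighted by \<open>\<beta>\<close>. A Rayleigh quotient theta of the
  pair thus becomes 1 / (theta - \<sigma>) for the diagonal operator.\<close>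

definition yc :: "complex vec \<Rightarrow> nat \<Rightarrow> complex" where
  "yc v j = complex_of_real (sqrt (\<mu> j - \<sigma>)) * cf v (i - 1 + j)"

lemma N: "k < N" "N + i = n + 1" "i - 1 + N = n" using ik by (auto simp: N_def)

lemma mu_mono: "1 \<le> a \<Longrightarrow> a \<le> b \<Longrightarrow> b \<le> N \<Longrightarrow> \<mu> a \<le> \<mu> b"
  unfolding \<mu>_def using N ik by (intro lam_mono) auto

lemma mu_1: "\<mu> 1 = lam i" using ik by (simp add: \<mu>_def)

lemma mu_pos: "1 \<le> j \<Longrightarrow> j \<le> N \<Longrightarrow> 0 < \<mu> j - \<sigma>"
  using mu_mono[of 1 j] mu_1 \<sigma> by simp

lemma beta_antimono: "1 \<le> a \<Longrightarrow> a \<le> b \<Longrightarrow> b \<le> N \<Longrightarrow> \<beta> b \<le> \<beta> a"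
  unfolding \<beta>_def using mu_mono[of a b] mu_pos[of a] by (intro divide_left_mono) auto

lemma sum_split_V: "(\<Sum>j\<in>{1..n}. f j) = (\<Sum>j\<in>{1..<i}. f j) + (\<Sum>j\<in>{1..N}. f (i - 1 + j))"
  for f :: "nat \<Rightarrow> real"
proof -
  have "{1..n} = {1..<i} \<union> {i..n}" using ik by auto
  moreover have "(\<Sum>j\<in>{i..n}. f j) = (\<Sum>j\<in>{1..N}. f (i - 1 + j))"
    using N ik by (intro sum.reindex_bij_witness[of _ "\<lambda>j. i - 1 + j" "\<lambda>j. j - (i - 1)"]) auto
  moreover have "{1..<i} \<inter> {i..n} = {}" by auto
  ultimately show ?thesis by (simp add: sum.union_disjoint)
qed

lemma cmod_yc: "1 \<le> j \<Longrightarrow> j \<le> N \<Longrightarrow> (cmod (yc v j))\<^sup>2 = (\<mu> j - \<sigma>) * (cmod (cf v (i - 1 + j)))\<^sup>2"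
  using mu_pos[of j] by (simp add: yc_def norm_mult power_mult_distrib)

lemma form_yc:
  assumes "in_V v"
  shows "Re (form S v v) = wsum \<beta> {1..N} (yc v)"
    and "Re (form H v v) - \<sigma> * Re (form S v v) = sqs {1..N} (yc v)"
proof -
  have v: "v \<in> carrier_vec n" and z: "\<And>j. j \<in> {1..<i} \<Longrightarrow> cf v j = 0"
    using assms by (auto simp: in_V_def)
  have s: "Re (form S v v) = (\<Sum>j\<in>{1..N}. (cmod (cf v (i - 1 + j)))\<^sup>2)"
    unfolding form_cf[OF v] sum_split_V using z by simp
  have h: "Re (form H v v) = (\<Sum>j\<in>{1..N}. \<mu> j * (cmod (cf v (i - 1 + j)))\<^sup>2)"
    unfolding form_cf[OF v] sum_split_V using z by (simp add: \<mu>_def)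
  show "Re (form S v v) = wsum \<beta> {1..N} (yc v)"
    unfolding s wsum_def
  proof (intro sum.cong refl)
    fix j assume "j \<in> {1..N}"
    then have j: "1 \<le> j" "j \<le> N" by auto
    show "(cmod (cf v (i - 1 + j)))\<^sup>2 = \<beta> j * (cmod (yc v j))\<^sup>2"
      unfolding cmod_yc[OF j] \<beta>_def using mu_pos[OF j] by simp
  qed
  have "Re (form H v v) - \<sigma> * Re (form S v v) = (\<Sum>j\<in>{1..N}. (\<mu> j - \<sigma>) * (cmod (cf v (i - 1 + j)))\<^sup>2)"
    unfolding s h by (simp add: sum_distrib_left sum_subtractf left_diff_distrib)
  also have "\<dots> = sqs {1..N} (yc v)"
    unfolding wsum_def by (intro sum.cong refl) (simp add: cmod_yc)
  finally show "Re (form H v v) - \<sigma> * Re (form S v v) = sqs {1..N} (yc v)" .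
qed

lemma in_V_form_lower:
  assumes "in_V v"
  shows "lam i * Re (form S v v) \<le> Re (form H v v)"
proof -
  have v: "v \<in> carrier_vec n" and z: "\<And>j. j \<in> {1..<i} \<Longrightarrow> cf v j = 0"
    using assms by (auto simp: in_V_def)
  show ?thesis
    unfolding form_cf[OF v] sum_distrib_left
  proof (intro sum_mono)
    fix j assume "j \<in> {1..n}"
    then show "lam i * (cmod (cf v j))\<^sup>2 \<le> lam j * (cmod (cf v j))\<^sup>2"
      using z[of j] lam_mono[of i j] ik by (cases "j < i") (auto intro: mult_right_mono)
  qed
qed

lemma form_upper:
  assumes "v \<in> carrier_vec n"
  shows "Re (form H v v) \<le> lam n * Re (form S v v)"
  unfolding form_cf[OF assms] sum_distrib_left using lam_mono by (intro sum_mono mult_right_mono) auto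

lemma in_V_vcomb:
  assumes "\<And>j. j \<in> {1..m} \<Longrightarrow> in_V (w j)"
  shows "in_V (vcomb n w c m)"
proof -
  have w: "w j \<in> carrier_vec n" if "j \<in> {1..m}" for j using assms[OF that] by (simp add: in_V_def)
  have "cf (vcomb n w c m) l = 0" if l: "l \<in> {1..<i}" for l
  proof -
    have "l \<in> {1..n}" using l ik by auto
    have "cf (vcomb n w c m) l = (\<Sum>j\<in>{1..m}. c j * cf (w j) l)" by (rule cf_vcomb[OF w \<open>l \<in> {1..n}\<close>])
    also have "\<dots> = 0" using assms l by (intro sum.neutral) (auto simp: in_V_def)
    finally show ?thesis .
  qed
  then show ?thesis by (simp add: in_V_def)
qed

lemma yc_vcomb:
  assumes "\<And>j. j \<in> {1..m} \<Longrightarrow> w j \<in> carrier_vec n" "e \<in> {1..N}"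
  shows "yc (vcomb n w c m) e = comb (\<lambda>j. yc (w j)) c m e"
proof -
  have "i - 1 + e \<in> {1..n}" using assms(2) N ik by auto
  from cf_vcomb[OF assms(1) this] show ?thesis
    by (simp add: yc_def comb_def sum_distrib_left mult.left_commute)
qed

lemma K_inverse:
  assumes "x \<in> carrier_vec n"
  shows "K *\<^sub>v ((H - complex_of_real \<sigma> \<cdot>\<^sub>m S) *\<^sub>v x) = x"
    and "(H - complex_of_real \<sigma> \<cdot>\<^sub>m S) *\<^sub>v (K *\<^sub>v x) = x"
proof -
  let ?A = "H - complex_of_real \<sigma> \<cdot>\<^sub>m S"
  have A: "?A \<in> carrier_mat n n" using H S by (simp add: minus_carrier_mat)
  have "K * ?A = 1\<^sub>m n" "?A * K = 1\<^sub>m n" using K A by (auto simp: inverts_mat_def)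
  then show "K *\<^sub>v (?A *\<^sub>v x) = x" "?A *\<^sub>v (K *\<^sub>v x) = x"
    using assoc_mult_mat_vec[OF K(1) A assms] assoc_mult_mat_vec[OF A K(1) assms] assms by auto
qed

lemma shifted_mult: "x \<in> carrier_vec n \<Longrightarrow>
    (H - complex_of_real \<sigma> \<cdot>\<^sub>m S) *\<^sub>v x = H *\<^sub>v x - complex_of_real \<sigma> \<cdot>\<^sub>v (S *\<^sub>v x)"
proof -
  assume x: "x \<in> carrier_vec n"
  have "(H - complex_of_real \<sigma> \<cdot>\<^sub>m S) *\<^sub>v x = H *\<^sub>v x - (complex_of_real \<sigma> \<cdot>\<^sub>m S) *\<^sub>v x"
    using H S x by (intro minus_mult_distrib_mat_vec[of _ n n]) auto
  also have "(complex_of_real \<sigma> \<cdot>\<^sub>m S) *\<^sub>v x = complex_of_real \<sigma> \<cdot>\<^sub>v (S *\<^sub>v x)"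
    using S x by (intro eq_vecI) auto
  finally show ?thesis .
qed

text \<open>The equation (H - \<sigma> S) x = S z, paired with the eigenvector
  \<open>u j\<close>.\<close>

lemma cf_preconditioned:
  assumes z: "z \<in> carrier_vec n" and j: "j \<in> {1..n}"
  shows "complex_of_real (lam j - \<sigma>) * cf (K *\<^sub>v (S *\<^sub>v z)) j = cf z j"
proof -
  define x where "x = K *\<^sub>v (S *\<^sub>v z)"
  have Sz: "S *\<^sub>v z \<in> carrier_vec n" using S z by simp
  have x: "x \<in> carrier_vec n" unfolding x_def using K(1) Sz by (rule mult_mat_vec_carrier)
  have Hx: "H *\<^sub>v x \<in> carrier_vec n" and Sx: "S *\<^sub>v x \<in> carrier_vec n" using H S x by auto
  have uj: "u j \<in> carrier_vec n" by (rule u_carrier[OF j])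
  have "S *\<^sub>v z = H *\<^sub>v x - complex_of_real \<sigma> \<cdot>\<^sub>v (S *\<^sub>v x)"
    using K_inverse(2)[OF Sz] shifted_mult[OF x] by (simp add: x_def)
  then have "cf z j = (H *\<^sub>v x - complex_of_real \<sigma> \<cdot>\<^sub>v (S *\<^sub>v x)) \<bullet>c u j"
    by (simp add: cf_def form_def)
  also have "\<dots> = form (1\<^sub>m n) (H *\<^sub>v x - complex_of_real \<sigma> \<cdot>\<^sub>v (S *\<^sub>v x)) (u j)"
    using Hx Sx by (simp add: form_def)
  also have "\<dots> = form (1\<^sub>m n) (H *\<^sub>v x) (u j) - complex_of_real \<sigma> * form (1\<^sub>m n) (S *\<^sub>v x) (u j)"
    by (rule form_diff_smult[OF _ Hx Sx uj]) simp
  also have "\<dots> = form H x (u j) - complex_of_real \<sigma> * cf x j"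
    using Hx Sx by (simp add: form_def cf_def)
  finally show ?thesis unfolding form_H_u[OF j x] by (simp add: x_def left_diff_distrib)
qed

text \<open>The shift may lie among the deflated eigenvalues, as only
  \<open>\<sigma> < lam i\<close> is assumed. Invertibility keeps it from being one of them, which
  is what makes the preconditioner respect the deflated space.\<close>

lemma lam_neq_shift: "j \<in> {1..n} \<Longrightarrow> lam j \<noteq> \<sigma>"
proof
  assume j: "j \<in> {1..n}" and eq: "lam j = \<sigma>"
  have uj: "u j \<in> carrier_vec n" by (rule u_carrier[OF j])
  have Su: "S *\<^sub>v u j \<in> carrier_vec n" using S uj by simp
  have "(H - complex_of_real \<sigma> \<cdot>\<^sub>m S) *\<^sub>v u j = 0\<^sub>v n"
    unfolding shifted_mult[OF uj] u_eigen[OF j] eq using Su by simp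
  then have "u j = K *\<^sub>v 0\<^sub>v n" using K_inverse(1)[OF uj] by simp
  also have "\<dots> = 0\<^sub>v n" using K(1) by (intro eq_vecI) auto
  finally have "form S (u j) (u j) = 0" using S(1) by (simp add: form_def cscalar_prod_sum)
  with u_form[OF j j] show False by simp
qed

lemma in_V_preconditioned: "in_V z \<Longrightarrow> in_V (K *\<^sub>v (S *\<^sub>v z))"
  unfolding in_V_def
proof (intro conjI ballI)
  assume z: "z \<in> carrier_vec n \<and> (\<forall>j\<in>{1..<i}. cf z j = 0)"
  then show "K *\<^sub>v (S *\<^sub>v z) \<in> carrier_vec n" using K(1) S(1) by simp
  fix j assume j: "j \<in> {1..<i}"
  then have jn: "j \<in> {1..n}" using ik by auto
  then show "cf (K *\<^sub>v (S *\<^sub>v z)) j = 0"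
    using cf_preconditioned[of z j] lam_neq_shift[OF jn] z j by auto
qed

lemma cf_preconditioned_V:
  assumes "z \<in> carrier_vec n" "e \<in> {1..N}"
  shows "cf (K *\<^sub>v (S *\<^sub>v z)) (i - 1 + e) = complex_of_real (\<beta> e) * cf z (i - 1 + e)"
proof -
  have e: "i - 1 + e \<in> {1..n}" "1 \<le> e" "e \<le> N" using assms(2) N ik by auto
  have "complex_of_real (\<mu> e - \<sigma>) * cf (K *\<^sub>v (S *\<^sub>v z)) (i - 1 + e) = cf z (i - 1 + e)"
    using cf_preconditioned[OF assms(1) e(1)] by (simp add: \<mu>_def)
  moreover have "complex_of_real (\<mu> e - \<sigma>) \<noteq> 0" using mu_pos[OF e(2,3)] by (simp del: of_real_diff)
  ultimately show ?thesis by (simp add: \<beta>_def field_simps del: of_real_diff)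
qed

end

section \<open>The trial space of a step\<close>

lemma in_cols_col_span: "W \<in> carrier_mat n d \<Longrightarrow> x \<in> set (cols W) \<Longrightarrow> x \<in> col_span n W"
  for W :: "complex mat"
  by (auto simp: cols_def intro: col_in_col_span)

lemma col_minus:
  "A \<in> carrier_mat n m \<Longrightarrow> B \<in> carrier_mat n m \<Longrightarrow> j < m \<Longrightarrow> col (A - B) j = col A j - col B j"
  for A B :: "complex mat"
  by (intro eq_vecI) auto

text \<open>Guarantees that the trial space has at least i - 1 + k Ritz values, so that the indices
  used in a step are in range.\<close>

lemma orthonormal_family_bound:
  fixes W S :: "complex mat"
  assumes S: "S \<in> carrier_mat n n" and W: "W \<in> carrier_mat n d"
    and x: "\<And>j. j \<in> {1..m} \<Longrightarrow> x j \<in> col_span n W"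
    and orth: "\<And>a b. a \<in> {1..m} \<Longrightarrow> b \<in> {1..m} \<Longrightarrow> form S (x a) (x b) = (if a = b then 1 else 0)"
  shows "m \<le> d"
proof (rule ccontr)
  assume "\<not> m \<le> d"
  then have card: "card {..<d} < card {1..m}" by simp
  have "\<forall>j\<in>{1..m}. \<exists>g. g \<in> carrier_vec d \<and> x j = W *\<^sub>v g"
    using x col_span_iff[OF W] by blast
  then obtain g where g: "\<forall>j\<in>{1..m}. g j \<in> carrier_vec d \<and> x j = W *\<^sub>v g j"
    unfolding bchoice_iff by blast
  obtain c where c: "\<exists>j\<in>{1..m}. c j \<noteq> 0" "\<forall>e\<in>{..<d}. (\<Sum>j\<in>{1..m}. g j $ e * c j) = 0"
    by (rule nontrivial_solution[OF finite_lessThan finite_atLeastAtMost card, of "\<lambda>e j. g j $ e"])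
  have z: "vcomb d g c m = 0\<^sub>v d"
    using c(2) by (intro eq_vecI) (auto simp: vcomb_def mult.commute)
  have "vcomb n x c m = vcomb n (\<lambda>j. W *\<^sub>v g j) c m" using g by (intro vcomb_cong) auto
  also have "\<dots> = W *\<^sub>v vcomb d g c m" by (rule mult_mat_vcomb[OF W, symmetric]) (use g in auto)
  also have "\<dots> = 0\<^sub>v n" unfolding z using W by (intro eq_vecI) auto
  finally have v0: "vcomb n x c m = 0\<^sub>v n" .
  have "form S (vcomb n x c m) (vcomb n x c m) = complex_of_real (\<Sum>j\<in>{1..m}. 1 * (cmod (c j))\<^sup>2)"
    by (rule sum_delta_form[OF S]) (use x col_span_carrier[OF W] orth in auto)
  moreover have "form S (vcomb n x c m) (vcomb n x c m) = 0"
    unfolding v0 using S by (simp add: form_def cscalar_prod_sum)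
  moreover have "0 < (\<Sum>j\<in>{1..m}. 1 * (cmod (c j))\<^sup>2)" using c(1) by (auto intro!: sum_pos2)
  ultimately show False by (simp del: of_real_sum)
qed

context bpsd
begin

abbreviation Umat :: "complex mat" where "Umat \<equiv> mat_of_cols n (map u [1..<i])"
abbreviation Vmat :: "complex mat" where "Vmat \<equiv> mat_of_cols n (map u [i..<n + 1])"

lemma in_V_u: "a \<in> {i..n} \<Longrightarrow> in_V (u a)"
  using ik u_carrier[of a] by (auto simp: in_V_def cf_def u_form)

lemma col_Umat: "j \<in> {1..<i} \<Longrightarrow> u j \<in> set (cols Umat)"
proof -
  assume j: "j \<in> {1..<i}"
  have "set (map u [1..<i]) \<subseteq> carrier_vec n" using ik u_carrier by auto
  then have "cols Umat = map u [1..<i]" by (rule cols_mat_of_cols)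
  then show ?thesis using j by auto
qed

lemma in_V_span:
  assumes "x \<in> col_span n Vmat"
  shows "in_V x"
proof -
  have V: "Vmat \<in> carrier_mat n N" using N by (auto simp del: upt_Suc intro!: carrier_matI)
  obtain g where g: "g \<in> carrier_vec N" "x = Vmat *\<^sub>v g" using assms unfolding col_span_iff[OF V] by blast
  have "in_V (col Vmat (j - 1))" if j: "j \<in> {1..N}" for j
  proof -
    have ij: "i + (j - 1) \<in> {1..n}" using j N ik by auto
    have "col Vmat (j - 1) = u (i + (j - 1))"
      using j N u_carrier[OF ij] by (subst col_mat_of_cols) (auto simp del: upt_Suc)
    then show ?thesis using in_V_u[of "i + (j - 1)"] j N by auto
  qed
  then show ?thesis unfolding g(2) mult_mat_vec_vcomb[OF V g(1)] by (rule in_V_vcomb)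
qed

context
  fixes Z :: "complex mat"
  assumes iterate: "bpsd_iterate n H S Vmat k Z"
begin

lemma Z_carrier: "Z \<in> carrier_mat n k"
  and Z_full: "full_col_rank n Z"
  and Z_orth: "orthonormal_cols S Z"
  and Z_dim: "dim_col Z = k"
  using iterate by (auto simp: bpsd_iterate_def)

lemma Z_in_V:
  assumes "z \<in> col_span n Z"
  shows "in_V z"
proof -
  obtain g where g: "g \<in> carrier_vec k" "z = Z *\<^sub>v g"
    using assms unfolding col_span_iff[OF Z_carrier] by blast
  have "in_V (col Z (j - 1))" if "j \<in> {1..k}" for j
  proof -
    have "col Z (j - 1) \<in> set (cols Z)" using that Z_dim by (auto simp: cols_def)
    then show ?thesis using iterate in_V_span unfolding bpsd_iterate_def by blast
  qed
  then show ?thesis unfolding g(2) mult_mat_vec_vcomb[OF Z_carrier g(1)] by (rule in_V_vcomb)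
qed

text \<open>The residual of a Ritz pair is (H - \<sigma> S) z - (theta - \<sigma>) S z, and K undoes
  the first term. Because theta > \<sigma>, the trial space contains K S z.\<close>

lemma col_preconditioned_residual:
  assumes j: "j < k"
  shows "\<exists>\<theta>>\<sigma>. col (K * bpsd_residual H S Z) j
    = col Z j - complex_of_real (\<theta> - \<sigma>) \<cdot>\<^sub>v (K *\<^sub>v (S *\<^sub>v col Z j))"
proof -
  let ?z = "col Z j" and ?e = "unit_vec k j :: complex vec"
  define A where "A = mat_adjoint Z * H * Z"
  define M where "M = mat_adjoint Z * S * Z"
  have Z': "mat_adjoint Z \<in> carrier_mat k n" using Z_carrier by simp
  have A: "A \<in> carrier_mat k k" unfolding A_def using Z' H(1) Z_carrier by (meson mult_carrier_mat)
  have M: "M = 1\<^sub>m k" using Z_orth Z_dim by (simp add: M_def orthonormal_cols_def)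
  obtain \<theta> where pair: "ritz_pair H S Z \<theta> ?z" using iterate j unfolding bpsd_iterate_def by blast
  obtain g where g: "g \<in> carrier_vec k" "A *\<^sub>v g = complex_of_real \<theta> \<cdot>\<^sub>v (M *\<^sub>v g)" "?z = Z *\<^sub>v g"
    using pair Z_dim unfolding ritz_pair_def A_def M_def by auto
  have e: "?e \<in> carrier_vec k" by simp
  have Ze: "Z *\<^sub>v ?e = ?z" using Z_carrier j by (intro eq_vecI) auto
  have inv: "h = mat_adjoint Z *\<^sub>v (S *\<^sub>v (Z *\<^sub>v h))" if h: "h \<in> carrier_vec k" for h
  proof -
    have ZS: "mat_adjoint Z * S \<in> carrier_mat k n" using Z' S(1) by (rule mult_carrier_mat)
    have Zh: "Z *\<^sub>v h \<in> carrier_vec n" using Z_carrier h by simp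
    have "M *\<^sub>v h = mat_adjoint Z *\<^sub>v (S *\<^sub>v (Z *\<^sub>v h))"
      unfolding M_def assoc_mult_mat_vec[OF ZS Z_carrier h] assoc_mult_mat_vec[OF Z' S(1) Zh] ..
    then show ?thesis using h by (simp add: M)
  qed
  \<comment> \<open>The columns of \<open>Z\<close> are Ritz vectors, but a priori for unspecified
    coefficients \<open>g\<close>. S-orthonormality identifies \<open>g\<close> with the unit
    vector, so that the projected matrix is diagonal.\<close>
  have "g = ?e" using inv[OF g(1)] inv[OF e] unfolding g(3)[symmetric] Ze by simp
  then have colA: "col A j = complex_of_real \<theta> \<cdot>\<^sub>v ?e"
  proof -
    have "A *\<^sub>v ?e = col A j" using A j by (intro eq_vecI) auto
    then show ?thesis using g(2) \<open>g = ?e\<close> by (simp add: M)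
  qed
  have z: "?z \<in> carrier_vec n" using Z_carrier by auto
  have zspan: "?z \<in> col_span n Z" by (rule col_in_col_span[OF Z_carrier j])
  have Sz: "S *\<^sub>v ?z \<in> carrier_vec n" and Hz: "H *\<^sub>v ?z \<in> carrier_vec n" using S H z by auto
  have zz: "form S ?z ?z = 1" using orthonormal_cols_form[OF S(1) Z_carrier Z_orth j j] by simp
  have "form H ?z ?z = complex_of_real \<theta>"
    using ritz_pair_form(2)[OF H(1) S(1) Z_carrier pair zspan] zz by simp
  then have "lam i \<le> \<theta>" using in_V_form_lower[OF Z_in_V[OF zspan]] zz by simp
  then have "\<sigma> < \<theta>" using \<sigma> by simp
  have HZ: "H * Z \<in> carrier_mat n k" and SZ: "S * Z \<in> carrier_mat n k"
    using H S Z_carrier by auto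
  have SZA: "S * Z * A \<in> carrier_mat n k" using SZ A by simp
  have R: "bpsd_residual H S Z \<in> carrier_mat n k"
    unfolding bpsd_residual_def A_def[symmetric] using HZ SZA by (simp add: minus_carrier_mat)
  have "col (bpsd_residual H S Z) j = col (H * Z) j - col (S * Z * A) j"
    unfolding bpsd_residual_def A_def[symmetric] by (rule col_minus[OF HZ SZA j])
  also have "col (H * Z) j = H *\<^sub>v ?z" by (rule col_mult2[OF H(1) Z_carrier j])
  also have "col (S * Z * A) j = (S * Z) *\<^sub>v col A j" by (rule col_mult2[OF SZ A j])
  also have "\<dots> = S *\<^sub>v (Z *\<^sub>v col A j)"
    using A j by (intro assoc_mult_mat_vec[OF S(1) Z_carrier]) auto
  also have "\<dots> = complex_of_real \<theta> \<cdot>\<^sub>v (S *\<^sub>v ?z)"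
    unfolding colA mult_mat_vec[OF Z_carrier e] Ze by (rule mult_mat_vec[OF S(1) z])
  also have "H *\<^sub>v ?z - complex_of_real \<theta> \<cdot>\<^sub>v (S *\<^sub>v ?z)
      = (H - complex_of_real \<sigma> \<cdot>\<^sub>m S) *\<^sub>v ?z - complex_of_real (\<theta> - \<sigma>) \<cdot>\<^sub>v (S *\<^sub>v ?z)"
    unfolding shifted_mult[OF z] using Hz Sz
    by (intro eq_vecI) (auto simp: left_diff_distrib simp del: index_mult_mat_vec)
  finally have colR: "col (bpsd_residual H S Z) j
      = (H - complex_of_real \<sigma> \<cdot>\<^sub>m S) *\<^sub>v ?z - complex_of_real (\<theta> - \<sigma>) \<cdot>\<^sub>v (S *\<^sub>v ?z)" .
  have Az: "(H - complex_of_real \<sigma> \<cdot>\<^sub>m S) *\<^sub>v ?z \<in> carrier_vec n"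
    using H S z by (intro mult_mat_vec_carrier[of _ n n]) (auto simp: minus_carrier_mat)
  have "col (K * bpsd_residual H S Z) j = K *\<^sub>v col (bpsd_residual H S Z) j"
    by (rule col_mult2[OF K(1) R j])
  also have "\<dots> = K *\<^sub>v ((H - complex_of_real \<sigma> \<cdot>\<^sub>m S) *\<^sub>v ?z)
      - K *\<^sub>v (complex_of_real (\<theta> - \<sigma>) \<cdot>\<^sub>v (S *\<^sub>v ?z))"
    unfolding colR using Az Sz by (intro mult_minus_distrib_mat_vec[OF K(1)]) auto
  also have "\<dots> = ?z - complex_of_real (\<theta> - \<sigma>) \<cdot>\<^sub>v (K *\<^sub>v (S *\<^sub>v ?z))"
    unfolding K_inverse(1)[OF z] mult_mat_vec[OF K(1) Sz] ..
  finally show ?thesis using \<open>\<sigma> < \<theta>\<close> by blast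
qed

end

text \<open>The trial space of a step contains the Krylov space spanned by \<open>z\<close> and
  \<open>(H - \<sigma> S)\<^sup>-\<^sup>1 S z\<close> for every \<open>z\<close> in the current subspace.\<close>

lemma step_space:
  assumes iterate: "bpsd_iterate n H S Vmat k Z" and iterate': "bpsd_iterate n H S Vmat k Z'"
    and step: "bpsd_id_step n H S K Umat k Z Z'"
  obtains W where "full_col_rank n W" and "i - 1 + k \<le> dim_col W"
    and "\<And>j. j \<in> {1..<i} \<Longrightarrow> u j \<in> col_span n W"
    and "\<And>z. z \<in> col_span n Z \<Longrightarrow> z \<in> col_span n W"
    and "\<And>z. z \<in> col_span n Z \<Longrightarrow> K *\<^sub>v (S *\<^sub>v z) \<in> col_span n W"
    and "\<And>t. t \<in> {1..k} \<Longrightarrow> ritz_value H S Z' t \<le> ritz_value H S W (i - 1 + t)"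
proof -
  let ?P = "K * bpsd_residual H S Z"
  define B where "B = hcat3 n Umat Z ?P"
  have dimU: "dim_col Umat = i - 1" by simp
  obtain W p where W: "basis_matrix n W (col_span n B)" and p: "p permutes {..<k}"
    and pairs: "\<And>j. j < k \<Longrightarrow> ritz_pair H S W (ritz_value H S W (i - 1 + 1 + p j)) (col Z' j)"
    using step dimU unfolding bpsd_id_step_def B_def by metis
  have full: "full_col_rank n W" and span: "col_span n W = col_span n B"
    using W by (auto simp: basis_matrix_def)
  define d where "d = dim_col W"
  have Wc: "W \<in> carrier_mat n d" using full by (simp add: full_col_rank_def d_def)
  note Zc = Z_carrier[OF iterate]
  have Rc: "bpsd_residual H S Z \<in> carrier_mat n k"
    unfolding bpsd_residual_def using H S Zc by (auto intro!: minus_carrier_mat)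
  then have Pc: "?P \<in> carrier_mat n k" using K(1) by simp
  have Uc: "Umat \<in> carrier_mat n (i - 1)" by (auto intro!: carrier_matI)
  have cols: "set (cols Umat @ cols Z @ cols ?P) \<subseteq> carrier_vec n"
    using Uc Zc Pc cols_dim by (metis carrier_matD(1) le_sup_iff set_append)
  have Bc: "B \<in> carrier_mat n (length (cols Umat @ cols Z @ cols ?P))"
    unfolding B_def hcat3_def by (rule mat_of_cols_carrier)
  have colsB: "cols B = cols Umat @ cols Z @ cols ?P"
    unfolding B_def hcat3_def by (rule cols_mat_of_cols[OF cols])
  have inB: "x \<in> col_span n W" if "x \<in> set (cols Umat) \<or> x \<in> set (cols Z) \<or> x \<in> set (cols ?P)" for x
    unfolding span using that by (intro in_cols_col_span[OF Bc]) (auto simp: colsB)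
  have colZ: "col Z (j - 1) \<in> col_span n W" and colP: "col ?P (j - 1) \<in> col_span n W"
    if "j \<in> {1..k}" for j
  proof -
    have "col Z (j - 1) \<in> set (cols Z)" "col ?P (j - 1) \<in> set (cols ?P)"
      using that Zc Pc by (auto simp: cols_def)
    then show "col Z (j - 1) \<in> col_span n W" "col ?P (j - 1) \<in> col_span n W" using inB by blast+
  qed
  have KS: "K *\<^sub>v (S *\<^sub>v col Z (j - 1)) \<in> col_span n W" if j: "j \<in> {1..k}" for j
  proof -
    let ?z = "col Z (j - 1)"
    have "j - 1 < k" using j by auto
    from col_preconditioned_residual[OF iterate this] obtain \<theta> where \<theta>: "\<sigma> < \<theta>"
      and P: "col ?P (j - 1) = ?z - complex_of_real (\<theta> - \<sigma>) \<cdot>\<^sub>v (K *\<^sub>v (S *\<^sub>v ?z))" by blast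
    have z: "?z \<in> carrier_vec n" using col_span_carrier[OF Wc colZ[OF j]] .
    then have KSz: "K *\<^sub>v (S *\<^sub>v ?z) \<in> carrier_vec n" using K S by simp
    \<comment> \<open>Solves the formula for the column of the preconditioned residual for K S
      z.\<close>
    define a where "a = complex_of_real (1 / (\<theta> - \<sigma>))"
    have a: "a * complex_of_real (\<theta> - \<sigma>) = 1" using \<theta> unfolding a_def of_real_mult[symmetric] by simp
    have "K *\<^sub>v (S *\<^sub>v ?z) = a \<cdot>\<^sub>v ?z + (- a) \<cdot>\<^sub>v col ?P (j - 1)"
    proof (rule eq_vecI)
      fix r assume "r < dim_vec (a \<cdot>\<^sub>v ?z + (- a) \<cdot>\<^sub>v col ?P (j - 1))"
      then have r: "r < n" using K(1) by simp
      let ?x = "(K *\<^sub>v (S *\<^sub>v ?z)) $ r"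
      have "(a \<cdot>\<^sub>v ?z + (- a) \<cdot>\<^sub>v col ?P (j - 1)) $ r
          = a * ?z $ r - a * (?z $ r - complex_of_real (\<theta> - \<sigma>) * ?x)"
        unfolding P using r z KSz carrier_matD[OF K(1)] carrier_matD[OF Zc]
        by (simp del: index_mult_mat_vec index_col of_real_diff)
      also have "\<dots> = (a * complex_of_real (\<theta> - \<sigma>)) * ?x"
        by (simp add: right_diff_distrib mult.assoc del: of_real_diff)
      finally show "?x = (a \<cdot>\<^sub>v ?z + (- a) \<cdot>\<^sub>v col ?P (j - 1)) $ r" unfolding a by simp
    qed (use KSz Pc K in auto)
    then show ?thesis using col_span_add_smult[OF Wc colZ[OF j] colP[OF j]] by simp
  qed
  have inW: "z \<in> col_span n W" and KSW: "K *\<^sub>v (S *\<^sub>v z) \<in> col_span n W" if z: "z \<in> col_span n Z" for z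
  proof -
    obtain g where g: "g \<in> carrier_vec k" "z = Z *\<^sub>v g" using z unfolding col_span_iff[OF Zc] by blast
    have z_eq: "z = vcomb n (\<lambda>j. col Z (j - 1)) (\<lambda>j. g $ (j - 1)) k"
      unfolding g(2) by (rule mult_mat_vec_vcomb[OF Zc g(1)])
    show "z \<in> col_span n W" unfolding z_eq by (rule col_span_vcomb[OF Wc colZ])
    have cc: "col Z (j - 1) \<in> carrier_vec n" for j using Zc by auto
    have Sc: "S *\<^sub>v col Z (j - 1) \<in> carrier_vec n" for j using S(1) cc by simp
    have "K *\<^sub>v (S *\<^sub>v z) = vcomb n (\<lambda>j. K *\<^sub>v (S *\<^sub>v col Z (j - 1))) (\<lambda>j. g $ (j - 1)) k"
      unfolding z_eq by (simp only: mult_mat_vcomb[OF S(1) cc] mult_mat_vcomb[OF K(1) Sc])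
    also have "\<dots> \<in> col_span n W" by (rule col_span_vcomb[OF Wc KS])
    finally show "K *\<^sub>v (S *\<^sub>v z) \<in> col_span n W" .
  qed
  have uW: "u j \<in> col_span n W" if "j \<in> {1..<i}" for j using inB col_Umat[OF that] by blast
  \<comment> \<open>The deflated eigenvectors and the columns of \<open>Z\<close> form an
    S-orthonormal family in the trial space.\<close>
  have dim: "i - 1 + k \<le> d"
  proof (rule orthonormal_family_bound[OF S(1) Wc, where x = "\<lambda>j. if j < i then u j else col Z (j - i)"])
    fix j assume j: "j \<in> {1..i - 1 + k}"
    show "(if j < i then u j else col Z (j - i)) \<in> col_span n W"
      using uW[of j] colZ[of "j - i + 1"] j ik by auto
  next
    have uZ: "form S (col Z b) (u a) = 0" "form S (u a) (col Z b) = 0" if ab: "a \<in> {1..<i}" "b < k" for a b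
    proof -
      have zV: "in_V (col Z b)" by (rule Z_in_V[OF iterate col_in_col_span[OF Zc ab(2)]])
      then show 0: "form S (col Z b) (u a) = 0" using ab by (auto simp: in_V_def cf_def)
      have "u a \<in> carrier_vec n" using u_carrier[of a] ab ik by auto
      from form_hermitian[OF S(1) S_herm _ this, of "col Z b"] zV 0
      show "form S (u a) (col Z b) = 0" by (simp add: in_V_def)
    qed
    fix a b assume ab: "a \<in> {1..i - 1 + k}" "b \<in> {1..i - 1 + k}"
    show "form S (if a < i then u a else col Z (a - i)) (if b < i then u b else col Z (b - i))
        = (if a = b then 1 else 0)"
      using ab ik u_form[of a b] uZ[of a "b - i"] uZ[of b "a - i"]
        orthonormal_cols_form[OF S(1) Zc Z_orth[OF iterate], of "a - i" "b - i"] by auto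
  qed
  have le: "ritz_value H S Z' t \<le> ritz_value H S W (i - 1 + t)" if t: "t \<in> {1..k}" for t
  proof -
    obtain w where mono: "\<And>a b. 1 \<le> a \<Longrightarrow> a \<le> b \<Longrightarrow> b \<le> d \<Longrightarrow> ritz_value H S W a \<le> ritz_value H S W b"
      by (rule ritz_basis[OF H S full d_def]) blast
    note Z'c = Z_carrier[OF iterate']
    \<comment> \<open>Undoes the free order of columns: column \<open>pi j\<close> of the new
      iterate belongs to the Ritz value number i - 1 + j of the trial space. On the span of the
      first \<open>t\<close> of these, Rayleigh quotients are at most the Ritz value number i - 1 +
      t.\<close>
    define pi where "pi j = inv_into UNIV p (j - 1)" for j
    have pi: "pi j < k" "p (pi j) = j - 1" if "j \<in> {1..t}" for j
    proof -
      have "j - 1 \<in> {..<k}" using that t by auto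
      then show "pi j < k" unfolding pi_def using permutes_in_image[OF permutes_inv[OF p]] by auto
      show "p (pi j) = j - 1" unfolding pi_def by (rule permutes_inverses(1)[OF p])
    qed
    have pair: "ritz_pair H S W (ritz_value H S W (i - 1 + j)) (col Z' (pi j))" if "j \<in> {1..t}" for j
    proof -
      have eq: "i - 1 + 1 + p (pi j) = i - 1 + j" using pi[OF that] that by auto
      show ?thesis using pairs[OF pi(1)[OF that]] by (simp only: eq)
    qed
    have inZ': "col Z' (pi j) \<in> col_span n Z'" if "j \<in> {1..t}" for j
      by (rule col_in_col_span[OF Z'c pi(1)[OF that]])
    have carr: "col Z' (pi j) \<in> carrier_vec n" if "j \<in> {1..t}" for j
      using col_span_carrier[OF Z'c inZ'[OF that]] .
    have pi_eq: "pi a = pi b \<longleftrightarrow> a = b" if "a \<in> {1..t}" "b \<in> {1..t}" for a b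
      using pi[OF that(1)] pi[OF that(2)] that by auto
    have orth: "form S (col Z' (pi a)) (col Z' (pi b)) = (if a = b then 1 else 0)"
      if "a \<in> {1..t}" "b \<in> {1..t}" for a b
      using orthonormal_cols_form[OF S(1) Z'c Z_orth[OF iterate'] pi(1)[OF that(1)] pi(1)[OF that(2)]]
        pi_eq[OF that] by simp
    have orthH: "form H (col Z' (pi a)) (col Z' (pi b))
        = (if a = b then complex_of_real (ritz_value H S W (i - 1 + a)) else 0)"
      if ab: "a \<in> {1..t}" "b \<in> {1..t}" for a b
    proof -
      have "col Z' (pi b) \<in> col_span n W"
        using ritz_pair_form(1)[OF H(1) S(1) Wc pair[OF ab(2)] inW[OF col_in_col_span[OF Zc]], of 0] ik
        by auto
      then show ?thesis
        using ritz_pair_form(2)[OF H(1) S(1) Wc pair[OF ab(1)]] orth[OF ab] by simp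
    qed
    show ?thesis
    proof (rule ritz_value_le[OF H S Z_full[OF iterate'], where x = "\<lambda>j. col Z' (pi j)" and m = t
          and E = "{}" and \<phi> = "\<lambda>_ _. 0"])
      show "1 \<le> t" "t \<le> dim_col Z'" using t Z'c by auto
      show "col Z' (pi j) \<in> col_span n Z'" if "j \<in> {1..t}" for j by (rule inZ'[OF that])
      fix c v assume c: "\<exists>j\<in>{1..t}. c j \<noteq> 0" and v: "v = vcomb n (\<lambda>j. col Z' (pi j)) c t"
      have forms: "Re (form S v v) = (\<Sum>a\<in>{1..t}. (cmod (c a))\<^sup>2)"
        "Re (form H v v) = (\<Sum>a\<in>{1..t}. ritz_value H S W (i - 1 + a) * (cmod (c a))\<^sup>2)"
        unfolding v by (rule form_eigenbasis[OF S(1) H(1) carr orth orthH]; assumption)+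
      have "0 < Re (form S v v)" unfolding forms using c by (auto intro!: sum_pos2)
      then have "v \<noteq> 0\<^sub>v n" using S(1) by (auto simp: form_def cscalar_prod_sum)
      moreover have "Re (form H v v) \<le> ritz_value H S W (i - 1 + t) * Re (form S v v)"
        unfolding forms sum_distrib_left using t dim by (intro sum_mono mult_right_mono mono) auto
      ultimately show "v \<noteq> 0\<^sub>v n \<and> Re (form H v v) \<le> ritz_value H S W (i - 1 + t) * Re (form S v v)" ..
    qed auto
  qed
  show ?thesis using that[OF full _ uW inW KSW le] dim unfolding d_def by blast
qed


text \<open>Realises the last condition of \<open>is_run\<close>. The test space is spanned by the
  deflated eigenvectors and the filtered Ritz vectors \<open>z a\<close>. Its two components are
  orthogonal for both forms, so the quotient can be bounded on each: by \<open>hyp\<close> on the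
  filtered part, and by \<open>lam i \<le> \<sigma> + 1 / x\<close> on the deflated part.\<close>

lemma step_bound:
  assumes iterate: "bpsd_iterate n H S Vmat k Z" and iterate': "bpsd_iterate n H S Vmat k Z'"
    and step: "bpsd_id_step n H S K Umat k Z Z'"
    and w: "\<And>a. a \<in> {1..k} \<Longrightarrow> w a \<in> col_span n Z"
    and t: "1 \<le> t" "t \<le> m" "m \<le> k" and x: "0 < x" "x \<le> \<beta> 1"
    and hyp: "\<And>c v. (\<exists>j\<in>{1..m}. c j \<noteq> 0) \<Longrightarrow> (\<forall>e\<in>{t<..m}. comb (\<lambda>j. yc (w j)) c m e = 0) \<Longrightarrow>
      v = (\<lambda>e. complex_of_real (p0 + p1 * \<beta> e) * comb (\<lambda>j. yc (w j)) c m e) \<Longrightarrow>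
      (\<exists>e\<in>{1..N}. v e \<noteq> 0) \<and> x * sqs {1..N} v \<le> wsum \<beta> {1..N} v"
  shows "ritz_value H S Z' t \<le> \<sigma> + 1 / x"
proof -
  obtain W where full: "full_col_rank n W" and dim: "i - 1 + k \<le> dim_col W"
    and uW: "\<And>j. j \<in> {1..<i} \<Longrightarrow> u j \<in> col_span n W"
    and ZW: "\<And>z. z \<in> col_span n Z \<Longrightarrow> z \<in> col_span n W"
    and KSW: "\<And>z. z \<in> col_span n Z \<Longrightarrow> K *\<^sub>v (S *\<^sub>v z) \<in> col_span n W"
    and le: "\<And>t. t \<in> {1..k} \<Longrightarrow> ritz_value H S Z' t \<le> ritz_value H S W (i - 1 + t)"
    by (rule step_space[OF iterate iterate' step]) blast
  have Wc: "W \<in> carrier_mat n (dim_col W)" using full by (simp add: full_col_rank_def)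
  have wV: "in_V (w a)" if "a \<in> {1..k}" for a by (rule Z_in_V[OF iterate w[OF that]])
  define z where "z a = complex_of_real p0 \<cdot>\<^sub>v w a + complex_of_real p1 \<cdot>\<^sub>v (K *\<^sub>v (S *\<^sub>v w a))" for a
  have zW: "z a \<in> col_span n W" if "a \<in> {1..k}" for a
    unfolding z_def by (rule col_span_add_smult[OF Wc ZW[OF w[OF that]] KSW[OF w[OF that]]])
  have cf_z: "cf (z a) l = complex_of_real p0 * cf (w a) l + complex_of_real p1 * cf (K *\<^sub>v (S *\<^sub>v w a)) l"
    if a: "a \<in> {1..k}" and l: "l \<in> {1..n}" for a l
  proof -
    have c: "w a \<in> carrier_vec n" "K *\<^sub>v (S *\<^sub>v w a) \<in> carrier_vec n"
      using wV[OF a] in_V_preconditioned[OF wV[OF a]] by (auto simp: in_V_def)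
    have "z a = complex_of_real p0 \<cdot>\<^sub>v w a - (- complex_of_real p1) \<cdot>\<^sub>v (K *\<^sub>v (S *\<^sub>v w a))"
      unfolding z_def using c by (intro eq_vecI) (auto simp del: index_mult_mat_vec)
    then have "cf (z a) l = form S (complex_of_real p0 \<cdot>\<^sub>v w a) (u l)
        - (- complex_of_real p1) * form S (K *\<^sub>v (S *\<^sub>v w a)) (u l)"
      unfolding cf_def using c u_carrier[OF l] by (simp only: form_diff_smult[OF S(1)] smult_carrier_vec)
    then show ?thesis using form_smult(1)[OF S(1) c(1) u_carrier[OF l]] by (simp add: cf_def)
  qed
  have cf_z_low: "cf (z a) l = 0" if "a \<in> {1..k}" "l \<in> {1..<i}" for a l
  proof -
    have "l \<in> {1..n}" using that ik by auto
    then show ?thesis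
      using cf_z[OF that(1)] wV[OF that(1)] in_V_preconditioned[OF wV[OF that(1)]] that(2) by (simp add: in_V_def)
  qed
  have cf_z_high: "cf (z a) (i - 1 + e) = complex_of_real (p0 + p1 * \<beta> e) * cf (w a) (i - 1 + e)"
    if "a \<in> {1..k}" "e \<in> {1..N}" for a e
  proof -
    have "i - 1 + e \<in> {1..n}" using that N ik by auto
    then show ?thesis
      using cf_z[OF that(1)] cf_preconditioned_V[OF _ that(2), of "w a"] wV[OF that(1)]
      by (simp add: in_V_def distrib_right)
  qed
  define X where "X j = (if j < i then u j else z (j - (i - 1)))" for j
  have XW: "X j \<in> col_span n W" if "j \<in> {1..i - 1 + m}" for j
  proof (cases "j < i")
    case True
    then show ?thesis using uW[of j] that by (simp add: X_def)
  next
    case False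
    then have "j - (i - 1) \<in> {1..k}" using that t ik by auto
    then show ?thesis using zW False by (simp add: X_def)
  qed
  have "ritz_value H S W (i - 1 + t) \<le> \<sigma> + 1 / x"
  \<comment> \<open>The m - t equations involve only the coefficients of the block part, in its
    coordinates before filtering; with i - 1 + m unknowns they leave dimension i - 1 + t.\<close>
  proof (rule ritz_value_le[OF H S full, where x = X and m = "i - 1 + m" and E = "{t<..m}"
        and \<phi> = "\<lambda>e j. if j < i then 0 else yc (w (j - (i - 1))) e"])
    show "1 \<le> i - 1 + t" "i - 1 + t \<le> dim_col W" using t dim by auto
    show "X j \<in> col_span n W" if "j \<in> {1..i - 1 + m}" for j by (rule XW[OF that])
    show "finite {t<..m}" "card {t<..m} + (i - 1 + t) \<le> i - 1 + m" using t by auto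
    fix c v
    assume nz: "\<exists>j\<in>{1..i - 1 + m}. c j \<noteq> 0"
      and eqs: "\<forall>e\<in>{t<..m}. (\<Sum>j\<in>{1..i - 1 + m}. (if j < i then 0 else yc (w (j - (i - 1))) e) * c j) = 0"
      and v: "v = vcomb n X c (i - 1 + m)"
    have vc: "v \<in> carrier_vec n" by (simp add: v)
    define c' where "c' j = c (i - 1 + j)" for j
    have split: "(\<Sum>j\<in>{1..i - 1 + m}. f j) = (\<Sum>j\<in>{1..<i}. f j) + (\<Sum>j\<in>{1..m}. f (i - 1 + j))"
      for f :: "nat \<Rightarrow> complex"
    proof -
      have "{1..i - 1 + m} = {1..<i} \<union> {i..i - 1 + m}" using ik by auto
      moreover have "(\<Sum>j\<in>{i..i - 1 + m}. f j) = (\<Sum>j\<in>{1..m}. f (i - 1 + j))"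
        using ik by (intro sum.reindex_bij_witness[of _ "\<lambda>j. i - 1 + j" "\<lambda>j. j - (i - 1)"]) auto
      moreover have "{1..<i} \<inter> {i..i - 1 + m} = {}" by auto
      ultimately show ?thesis by (simp add: sum.union_disjoint)
    qed
    have Xl: "X j = u j" if "j \<in> {1..<i}" for j using that by (simp add: X_def)
    have Xh: "X (i - 1 + j) = z j" if "j \<in> {1..m}" for j using that ik by (auto simp: X_def)
    have cf_v: "cf v l = (\<Sum>j\<in>{1..<i}. c j * cf (u j) l) + (\<Sum>j\<in>{1..m}. c' j * cf (z j) l)"
      if l: "l \<in> {1..n}" for l
    proof -
      have "cf v l = (\<Sum>j\<in>{1..i - 1 + m}. c j * cf (X j) l)"
        unfolding v by (rule cf_vcomb[OF col_span_carrier[OF Wc XW] l])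
      also have "\<dots> = (\<Sum>j\<in>{1..<i}. c j * cf (X j) l) + (\<Sum>j\<in>{1..m}. c' j * cf (X (i - 1 + j)) l)"
        unfolding c'_def by (rule split)
      also have "\<dots> = (\<Sum>j\<in>{1..<i}. c j * cf (u j) l) + (\<Sum>j\<in>{1..m}. c' j * cf (z j) l)"
        by (intro arg_cong2[of _ _ _ _ "(+)"] sum.cong refl) (simp_all add: Xl Xh del: One_nat_def)
      finally show ?thesis .
    qed
    have cf_u: "cf (u j) l = (if j = l then 1 else 0)" if "j \<in> {1..n}" "l \<in> {1..n}" for j l
      unfolding cf_def by (rule u_form[OF that])
    have cf_low: "cf v l = c l" if l: "l \<in> {1..<i}" for l
    proof -
      have ln: "l \<in> {1..n}" using l ik by auto
      have "(\<Sum>j\<in>{1..<i}. c j * cf (u j) l) = (\<Sum>j\<in>{1..<i}. if j = l then c j else 0)"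
        using ik ln by (intro sum.cong refl) (auto simp: cf_u)
      moreover have "(\<Sum>j\<in>{1..m}. c' j * cf (z j) l) = 0"
        using cf_z_low[OF _ l] t by (intro sum.neutral) auto
      ultimately show ?thesis unfolding cf_v[OF ln] using l by simp
    qed
    \<comment> \<open>The filtered coordinates, which the next fact recognises as the scaled
      eigencoordinates of \<open>v\<close> on the deflated space.\<close>
    define Y where "Y = (\<lambda>e. complex_of_real (p0 + p1 * \<beta> e) * comb (\<lambda>j. yc (w j)) c' m e)"
    have Y: "Y e = complex_of_real (sqrt (\<mu> e - \<sigma>)) * cf v (i - 1 + e)" if e: "e \<in> {1..N}" for e
    proof -
      have en: "i - 1 + e \<in> {1..n}" using e N ik by auto
      have "(\<Sum>j\<in>{1..<i}. c j * cf (u j) (i - 1 + e)) = 0"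
      proof (intro sum.neutral ballI)
        fix j assume j: "j \<in> {1..<i}"
        then have "j \<in> {1..n}" "j \<noteq> i - 1 + e" using ik e by auto
        then show "c j * cf (u j) (i - 1 + e) = 0" using cf_u[OF _ en] by simp
      qed
      then have "cf v (i - 1 + e) = (\<Sum>j\<in>{1..m}. c' j * cf (z j) (i - 1 + e))" using cf_v[OF en] by simp
      also have "\<dots> = (\<Sum>j\<in>{1..m}. complex_of_real (p0 + p1 * \<beta> e) * (c' j * cf (w j) (i - 1 + e)))"
      proof (intro sum.cong refl)
        fix j assume "j \<in> {1..m}"
        then have "j \<in> {1..k}" using t by auto
        from cf_z_high[OF this e] show "c' j * cf (z j) (i - 1 + e)
            = complex_of_real (p0 + p1 * \<beta> e) * (c' j * cf (w j) (i - 1 + e))"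
          by (simp only: mult.left_commute)
      qed
      finally have "cf v (i - 1 + e) = complex_of_real (p0 + p1 * \<beta> e) * (\<Sum>j\<in>{1..m}. c' j * cf (w j) (i - 1 + e))"
        by (simp only: sum_distrib_left)
      then show ?thesis
        by (simp add: Y_def comb_def yc_def sum_distrib_left mult.left_commute del: of_real_add of_real_mult)
    qed
    have comb0: "\<forall>e\<in>{t<..m}. comb (\<lambda>j. yc (w j)) c' m e = 0"
    proof
      fix e assume "e \<in> {t<..m}"
      with eqs have "(\<Sum>j\<in>{1..i - 1 + m}. (if j < i then 0 else yc (w (j - (i - 1))) e) * c j) = 0" by blast
      then have "(\<Sum>j\<in>{1..<i}. (if j < i then 0 else yc (w (j - (i - 1))) e) * c j)
          + (\<Sum>j\<in>{1..m}. (if i - 1 + j < i then 0 else yc (w (i - 1 + j - (i - 1))) e) * c (i - 1 + j)) = 0"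
        by (subst (asm) split)
      moreover have "(\<Sum>j\<in>{1..<i}. (if j < i then 0 else yc (w (j - (i - 1))) e) * c j) = 0"
        by (intro sum.neutral) auto
      moreover have "(\<Sum>j\<in>{1..m}. (if i - 1 + j < i then 0 else yc (w (i - 1 + j - (i - 1))) e) * c (i - 1 + j))
          = comb (\<lambda>j. yc (w j)) c' m e"
        unfolding comb_def c'_def using ik by (intro sum.cong refl) auto
      ultimately show "comb (\<lambda>j. yc (w j)) c' m e = 0" by simp
    qed
    have Y_zero: "\<forall>e\<in>{1..N}. Y e = 0" if "\<forall>j\<in>{1..m}. c' j = 0"
      using that by (simp add: Y_def comb_def)
    have ineq: "x * sqs {1..N} Y \<le> wsum \<beta> {1..N} Y"
    proof (cases "\<exists>j\<in>{1..m}. c' j \<noteq> 0")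
      case True
      from hyp[OF this comb0 Y_def] show ?thesis ..
    next
      case False
      then have "\<forall>e\<in>{1..N}. Y e = 0" using Y_zero by blast
      then have "wsum f {1..N} Y = 0" for f by (intro wsum_zero) auto
      then show ?thesis by simp
    qed
    have "v \<noteq> 0\<^sub>v n"
    proof
      assume "v = 0\<^sub>v n"
      then have cf0: "cf v l = 0" if "l \<in> {1..n}" for l
        using S(1) u_carrier[OF that] by (simp add: cf_def form_def cscalar_prod_sum)
      then have "c l = 0" if "l \<in> {1..<i}" for l using cf_low[OF that] that ik by simp
      then obtain j where j: "j \<in> {1..i - 1 + m}" "c j \<noteq> 0" "\<not> j < i" using nz by force
      then have "c' (j - (i - 1)) \<noteq> 0" "j - (i - 1) \<in> {1..m}" using ik by (auto simp: c'_def)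
      then have "\<exists>j\<in>{1..m}. c' j \<noteq> 0" by blast
      from hyp[OF this comb0 Y_def] obtain e where "e \<in> {1..N}" "Y e \<noteq> 0" by blast
      moreover from this have "i - 1 + e \<in> {1..n}" using N ik by auto
      ultimately show False using Y cf0 by simp
    qed
    moreover have "Re (form H v v) \<le> (\<sigma> + 1 / x) * Re (form S v v)"
    proof -
      have cY: "(cmod (Y e))\<^sup>2 = (\<mu> e - \<sigma>) * (cmod (cf v (i - 1 + e)))\<^sup>2" if "e \<in> {1..N}" for e
        using Y[OF that] mu_pos[of e] that by (simp add: norm_mult power_mult_distrib)
      have sY: "sqs {1..N} Y = (\<Sum>e\<in>{1..N}. (\<mu> e - \<sigma>) * (cmod (cf v (i - 1 + e)))\<^sup>2)"
        unfolding wsum_def using cY by (intro sum.cong refl) simp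
      have wY: "wsum \<beta> {1..N} Y = (\<Sum>e\<in>{1..N}. (cmod (cf v (i - 1 + e)))\<^sup>2)"
        unfolding wsum_def
      proof (intro sum.cong refl)
        fix e assume e: "e \<in> {1..N}"
        then show "\<beta> e * (cmod (Y e))\<^sup>2 = (cmod (cf v (i - 1 + e)))\<^sup>2"
          unfolding cY[OF e] \<beta>_def using mu_pos[of e] by simp
      qed
      \<comment> \<open>The place where \<open>x \<le> \<beta> 1\<close> is used.\<close>
      have inv: "lam i - \<sigma> \<le> 1 / x"
        unfolding mu_1[symmetric] using x mu_pos[of 1] N by (simp add: \<beta>_def field_simps)
      have high: "(\<Sum>e\<in>{1..N}. \<mu> e * (cmod (cf v (i - 1 + e)))\<^sup>2)
          \<le> (\<sigma> + 1 / x) * (\<Sum>e\<in>{1..N}. (cmod (cf v (i - 1 + e)))\<^sup>2)"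
      proof -
        have "sqs {1..N} Y \<le> 1 / x * wsum \<beta> {1..N} Y" using ineq x(1) by (simp add: field_simps)
        then show ?thesis unfolding sY wY
          by (simp add: left_diff_distrib sum_subtractf distrib_right sum_distrib_left)
      qed
      have low: "(\<Sum>l\<in>{1..<i}. lam l * (cmod (cf v l))\<^sup>2) \<le> (\<sigma> + 1 / x) * (\<Sum>l\<in>{1..<i}. (cmod (cf v l))\<^sup>2)"
        unfolding sum_distrib_left
      proof (intro sum_mono mult_right_mono)
        fix l assume "l \<in> {1..<i}"
        then have "lam l \<le> lam i" using lam_mono[of l i] ik by auto
        then show "lam l \<le> \<sigma> + 1 / x" using inv by simp
      qed auto
      show ?thesis unfolding form_cf[OF vc] sum_split_V
        using high low by (simp add: \<mu>_def distrib_left)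
    qed
    ultimately show "v \<noteq> 0\<^sub>v n \<and> Re (form H v v) \<le> (\<sigma> + 1 / x) * Re (form S v v)" ..
  qed
  with le[of t] t show ?thesis by simp
qed

end

section \<open>Convergence of the Ritz values\<close>

context bpsd
begin

text \<open>Ritz vectors ordered by their Ritz values. The columns of an iterate cannot be taken,
  since their order is free.\<close>

definition ritz_basis_of :: "complex mat \<Rightarrow> (nat \<Rightarrow> complex vec) \<Rightarrow> bool" where
  "ritz_basis_of Z w \<longleftrightarrow> (\<forall>a\<in>{1..k}. w a \<in> col_span n Z) \<and>
     (\<forall>a\<in>{1..k}. \<forall>b\<in>{1..k}. form S (w a) (w b) = (if a = b then 1 else 0)) \<and>
     (\<forall>a\<in>{1..k}. \<forall>b\<in>{1..k}.
        form H (w a) (w b) = (if a = b then complex_of_real (ritz_value H S Z a) else 0))"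

context
  fixes Z :: "complex mat"
  assumes iterate: "bpsd_iterate n H S Vmat k Z"
begin

lemma ritz_basis_exists: "\<exists>w. ritz_basis_of Z w"
proof -
  obtain w where "\<And>a. a \<in> {1..k} \<Longrightarrow> w a \<in> col_span n Z"
    and "\<And>a b. a \<in> {1..k} \<Longrightarrow> b \<in> {1..k} \<Longrightarrow> form S (w a) (w b) = (if a = b then 1 else 0)"
    and "\<And>a b. a \<in> {1..k} \<Longrightarrow> b \<in> {1..k} \<Longrightarrow>
      form H (w a) (w b) = (if a = b then complex_of_real (ritz_value H S Z a) else 0)"
    by (rule ritz_basis[OF H S Z_full[OF iterate] Z_dim[OF iterate, symmetric]]) blast
  then show ?thesis unfolding ritz_basis_of_def by blast
qed

lemma ritz_mono: "1 \<le> a \<Longrightarrow> a \<le> b \<Longrightarrow> b \<le> k \<Longrightarrow> ritz_value H S Z a \<le> ritz_value H S Z b"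
  by (rule ritz_basis[OF H S Z_full[OF iterate] Z_dim[OF iterate, symmetric]]) blast

context
  fixes w :: "nat \<Rightarrow> complex vec"
  assumes w: "ritz_basis_of Z w"
begin

lemma basis_in_V: "a \<in> {1..k} \<Longrightarrow> in_V (w a)"
  using w Z_in_V[OF iterate] unfolding ritz_basis_of_def by blast

lemma basis_carrier: "a \<in> {1..k} \<Longrightarrow> w a \<in> carrier_vec n"
  using basis_in_V by (simp add: in_V_def)

lemma basis_vcomb_in_V: "t \<le> k \<Longrightarrow> in_V (vcomb n w c t)"
  by (rule in_V_vcomb) (auto intro: basis_in_V)

lemma basis_forms:
  assumes "t \<le> k"
  shows "Re (form S (vcomb n w c t) (vcomb n w c t)) = (\<Sum>a\<in>{1..t}. (cmod (c a))\<^sup>2)"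
    and "Re (form H (vcomb n w c t) (vcomb n w c t)) = (\<Sum>a\<in>{1..t}. ritz_value H S Z a * (cmod (c a))\<^sup>2)"
proof -
  have 1: "w a \<in> carrier_vec n" if "a \<in> {1..t}" for a using that assms by (intro basis_carrier) auto
  have 2: "form S (w a) (w b) = (if a = b then 1 else 0)"
    and 3: "form H (w a) (w b) = (if a = b then complex_of_real (ritz_value H S Z a) else 0)"
    if "a \<in> {1..t}" "b \<in> {1..t}" for a b
  proof -
    have "a \<in> {1..k}" "b \<in> {1..k}" using that assms by auto
    then show "form S (w a) (w b) = (if a = b then 1 else 0)"
      "form H (w a) (w b) = (if a = b then complex_of_real (ritz_value H S Z a) else 0)"
      using w unfolding ritz_basis_of_def by blast+
  qed
  show "Re (form S (vcomb n w c t) (vcomb n w c t)) = (\<Sum>a\<in>{1..t}. (cmod (c a))\<^sup>2)"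
    by (rule form_eigenbasis(1)[OF S(1) H(1) 1 2 3])
  show "Re (form H (vcomb n w c t) (vcomb n w c t)) = (\<Sum>a\<in>{1..t}. ritz_value H S Z a * (cmod (c a))\<^sup>2)"
    by (rule form_eigenbasis(2)[OF S(1) H(1) 1 2 3])
qed

lemma basis_form_le:
  assumes "1 \<le> t" "t \<le> k"
  shows "Re (form H (vcomb n w c t) (vcomb n w c t))
    \<le> ritz_value H S Z t * Re (form S (vcomb n w c t) (vcomb n w c t))"
  unfolding basis_forms[OF assms(2)] sum_distrib_left
  using ritz_mono assms by (intro sum_mono mult_right_mono) auto

lemma basis_comb:
  assumes "t \<le> k" "e \<in> {1..N}"
  shows "comb (\<lambda>j. yc (w j)) c t e = yc (vcomb n w c t) e"
  by (rule yc_vcomb[symmetric, OF _ assms(2)]) (use assms(1) in \<open>auto intro: basis_carrier\<close>)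

lemma basis_wsum_comb:
  assumes "t \<le> k"
  shows "wsum f {1..N} (comb (\<lambda>j. yc (w j)) c t) = wsum f {1..N} (yc (vcomb n w c t))"
  using basis_comb[OF assms] by (intro wsum_cong)

lemma basis_indep:
  assumes "t \<le> k" "\<And>e. e \<in> {1..N} \<Longrightarrow> comb (\<lambda>j. yc (w j)) c t e = 0" "j \<in> {1..t}"
  shows "c j = 0"
proof -
  have "wsum \<beta> {1..N} (comb (\<lambda>j. yc (w j)) c t) = 0" using assms(2) by (rule wsum_zero)
  then have "(\<Sum>a\<in>{1..t}. (cmod (c a))\<^sup>2) = 0"
    unfolding basis_wsum_comb[OF assms(1)] form_yc(1)[OF basis_vcomb_in_V[OF assms(1)], symmetric]
      basis_forms[OF assms(1)] .
  then have "(cmod (c j))\<^sup>2 = 0"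
    by (subst (asm) sum_nonneg_eq_0_iff) (use assms(3) in auto)
  then show ?thesis by simp
qed

text \<open>Courant-Fischer on the deflated space: a combination of the first \<open>t\<close> Ritz
  vectors is S-orthogonal to the t - 1 lowest eigenvectors left there.\<close>

lemma ritz_ge_mu:
  assumes t: "1 \<le> t" "t \<le> k"
  shows "\<mu> t \<le> ritz_value H S Z t"
proof -
  have card: "card {1..<t} < card {1..t}" using t by simp
  obtain c where c: "\<exists>j\<in>{1..t}. c j \<noteq> 0"
    "\<forall>e\<in>{1..<t}. (\<Sum>j\<in>{1..t}. cf (w j) (i - 1 + e) * c j) = 0"
    by (rule nontrivial_solution[OF finite_atLeastLessThan finite_atLeastAtMost card,
          of "\<lambda>e j. cf (w j) (i - 1 + e)"])
  define v where "v = vcomb n w c t"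
  have vV: "in_V v" unfolding v_def by (rule basis_vcomb_in_V[OF t(2)])
  then have vc: "v \<in> carrier_vec n" by (simp add: in_V_def)
  have low: "cf v l = 0" if l: "l \<in> {1..<i - 1 + t}" for l
  proof (cases "l < i")
    case True
    then show ?thesis using vV l by (simp add: in_V_def)
  next
    case False
    then obtain e where e: "e \<in> {1..<t}" "l = i - 1 + e" using l ik
      by (intro that[of "l - (i - 1)"]) auto
    have "l \<in> {1..n}" using l t ik by auto
    then have "cf v l = (\<Sum>j\<in>{1..t}. c j * cf (w j) l)"
      unfolding v_def using t by (intro cf_vcomb basis_carrier) auto
    also have "\<dots> = (\<Sum>j\<in>{1..t}. cf (w j) (i - 1 + e) * c j)" by (simp add: e mult.commute)
    also have "\<dots> = 0" using c(2) e(1) by blast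
    finally show ?thesis .
  qed
  have "\<mu> t * Re (form S v v) \<le> Re (form H v v)"
    unfolding form_cf[OF vc] sum_distrib_left
  proof (intro sum_mono)
    fix l assume l: "l \<in> {1..n}"
    show "\<mu> t * (cmod (cf v l))\<^sup>2 \<le> lam l * (cmod (cf v l))\<^sup>2"
    proof (cases "l < i - 1 + t")
      case True
      then show ?thesis using low[of l] l by simp
    next
      case False
      then have "\<mu> t \<le> lam l" unfolding \<mu>_def using l t ik by (intro lam_mono) auto
      then show ?thesis by (rule mult_right_mono) simp
    qed
  qed
  also have "\<dots> \<le> ritz_value H S Z t * Re (form S v v)" unfolding v_def by (rule basis_form_le[OF t])
  finally have "\<mu> t * Re (form S v v) \<le> ritz_value H S Z t * Re (form S v v)" .
  moreover have "0 < Re (form S v v)"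
    unfolding v_def basis_forms[OF t(2)] using c(1) by (auto intro!: sum_pos2)
  ultimately show ?thesis by simp
qed

lemma ritz_le_lam_n:
  assumes t: "1 \<le> t" "t \<le> k"
  shows "ritz_value H S Z t \<le> lam n"
proof -
  have "t \<in> {1..k}" using t by simp
  then have "form H (w t) (w t) = complex_of_real (ritz_value H S Z t)" "form S (w t) (w t) = 1"
    using w unfolding ritz_basis_of_def by auto
  then show ?thesis using form_upper[OF basis_carrier[OF \<open>t \<in> {1..k}\<close>]] by simp
qed

lemma ritz_gt_shift: "1 \<le> t \<Longrightarrow> t \<le> k \<Longrightarrow> \<sigma> < ritz_value H S Z t"
  using ritz_ge_mu[of t] mu_pos[of t] N by simp

lemma basis_ritz_ineq:
  assumes t: "1 \<le> t" "t \<le> k"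
  shows "1 / (ritz_value H S Z t - \<sigma>) * sqs {1..N} (comb (\<lambda>j. yc (w j)) c t)
    \<le> wsum \<beta> {1..N} (comb (\<lambda>j. yc (w j)) c t)"
proof -
  let ?v = "vcomb n w c t"
  have "sqs {1..N} (yc ?v) \<le> (ritz_value H S Z t - \<sigma>) * wsum \<beta> {1..N} (yc ?v)"
    using basis_form_le[OF t, of c] unfolding form_yc[OF basis_vcomb_in_V[OF t(2)], symmetric]
    by (simp add: algebra_simps)
  then show ?thesis
    unfolding basis_wsum_comb[OF t(2)] using ritz_gt_shift[OF t] by (simp add: field_simps)
qed

end

end

lemma run_iterate: "bpsd_id_run n H S K u i k X Z \<Longrightarrow> bpsd_iterate n H S Vmat k (Z l)"
  and run_step_id: "bpsd_id_run n H S K u i k X Z \<Longrightarrow> bpsd_id_step n H S K Umat k (Z l) (Z (Suc l))"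
  by (auto simp: bpsd_id_run_def)

lemma iterate_ritz_bounds:
  assumes "bpsd_iterate n H S Vmat k Z" "1 \<le> t" "t \<le> k"
  shows "\<mu> t \<le> ritz_value H S Z t" "ritz_value H S Z t \<le> lam n" "\<sigma> < ritz_value H S Z t"
  using ritz_basis_exists[OF assms(1)] ritz_ge_mu[OF assms(1) _ assms(2,3)]
    ritz_le_lam_n[OF assms(1) _ assms(2,3)] ritz_gt_shift[OF assms(1) _ assms(2,3)] by blast+

lemma inverse_shift_le_beta:
  assumes "bpsd_iterate n H S Vmat k Z" "1 \<le> t" "t \<le> k"
  shows "1 / (ritz_value H S Z t - \<sigma>) \<le> \<beta> 1"
proof -
  have "\<mu> 1 \<le> \<mu> t" using mu_mono[of 1 t] assms N by simp
  then show ?thesis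
    unfolding \<beta>_def using iterate_ritz_bounds[OF assms] mu_pos[of 1] N by (intro divide_left_mono) auto
qed

lemma ritz_decreasing:
  assumes run: "bpsd_id_run n H S K u i k X Z" and t: "1 \<le> t" "t \<le> k"
  shows "ritz_value H S (Z (Suc l)) t \<le> ritz_value H S (Z l) t"
proof -
  note it = run_iterate[OF run, of l]
  obtain w where w: "ritz_basis_of (Z l) w" using ritz_basis_exists[OF it] by blast
  let ?x = "1 / (ritz_value H S (Z l) t - \<sigma>)"
  have "ritz_value H S (Z (Suc l)) t \<le> \<sigma> + 1 / ?x"
  proof (rule step_bound[OF it run_iterate[OF run] run_step_id[OF run], where w = w and m = t
        and ?p0.0 = 1 and ?p1.0 = 0])
    show "w a \<in> col_span n (Z l)" if "a \<in> {1..k}" for a using w that by (auto simp: ritz_basis_of_def)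
    show "0 < ?x" using iterate_ritz_bounds[OF it t] by simp
    show "?x \<le> \<beta> 1" by (rule inverse_shift_le_beta[OF it t])
    fix c v assume c: "\<exists>j\<in>{1..t}. c j \<noteq> 0"
      and v: "v = (\<lambda>e. complex_of_real (1 + 0 * \<beta> e) * comb (\<lambda>j. yc (w j)) c t e)"
    have "v = comb (\<lambda>j. yc (w j)) c t" unfolding v by simp
    then show "(\<exists>e\<in>{1..N}. v e \<noteq> 0) \<and> ?x * sqs {1..N} v \<le> wsum \<beta> {1..N} v"
      using basis_indep[OF it w t(2), of c] c basis_ritz_ineq[OF it w t, of c] by blast
  qed (use t in auto)
  then show ?thesis by simp
qed

lemma ritz_decreasing':
  assumes "bpsd_id_run n H S K u i k X Z" "1 \<le> t" "t \<le> k" "l \<le> l'"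
  shows "ritz_value H S (Z l') t \<le> ritz_value H S (Z l) t"
  using lift_Suc_antimono_le[of "\<lambda>l. ritz_value H S (Z l) t"] ritz_decreasing[OF assms(1-3)] assms(4) by blast

text \<open>The link to the abstract iteration. It is started at iterate \<open>m\<close> because
  the threshold need not be reached earlier.\<close>

lemma run_block:
  assumes run: "bpsd_id_run n H S K u i k X Z" and blk: "block_iteration N q \<beta> b" and q: "1 \<le> q" "q \<le> k"
    and start: "b \<le> 1 / (ritz_value H S (Z m) q - \<sigma>)"
  shows "\<exists>y. block_iteration.is_run N q \<beta> b y (\<lambda>l t. 1 / (ritz_value H S (Z (m + l)) t - \<sigma>))"
proof -
  note it = run_iterate[OF run]
  have "\<forall>l. \<exists>w. ritz_basis_of (Z (m + l)) w" using ritz_basis_exists[OF it] by blast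
  then obtain w where w: "ritz_basis_of (Z (m + l)) (w l)" for l by metis
  show ?thesis
    unfolding block_iteration.is_run_def[OF blk]
  proof (intro exI[of _ "\<lambda>l j. yc (w l j)"] conjI allI impI ballI)
    show "b \<le> 1 / (ritz_value H S (Z (m + 0)) q - \<sigma>)" using start by simp
  next
    fix l s t assume "1 \<le> s \<and> s \<le> t \<and> t \<le> q"
    then have st: "1 \<le> s" "s \<le> t" "t \<le> k" "s \<le> k" using q by auto
    show "1 / (ritz_value H S (Z (m + l)) t - \<sigma>) \<le> 1 / (ritz_value H S (Z (m + l)) s - \<sigma>)"
      using ritz_mono[OF it[of "m + l"] st(1-3)] iterate_ritz_bounds(3)[OF it[of "m + l"] st(1,4)]
      by (intro frac_le) auto
  next
    fix l c j assume "\<forall>e\<in>{1..N}. comb (\<lambda>j. yc (w l j)) c q e = 0" "j \<in> {1..q}"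
    then show "c j = 0" using basis_indep[OF it w q(2)] by blast
  next
    fix l t c assume "1 \<le> t \<and> t \<le> q"
    then have "1 \<le> t" "t \<le> k" using q by auto
    then show "1 / (ritz_value H S (Z (m + l)) t - \<sigma>) * sqs {1..N} (comb (\<lambda>j. yc (w l j)) c t)
        \<le> wsum \<beta> {1..N} (comb (\<lambda>j. yc (w l j)) c t)"
      by (rule basis_ritz_ineq[OF it w])
  next
    fix l t r p0 p1 x
    assume *: "1 \<le> t \<and> t \<le> r \<and> r \<le> q \<and> x \<le> \<beta> 1 \<and>
      (\<forall>c v. (\<exists>j\<in>{1..r}. c j \<noteq> 0) \<and> (\<forall>e\<in>{t<..r}. comb (\<lambda>j. yc (w l j)) c r e = 0) \<and>
          v = (\<lambda>e. complex_of_real (p0 + p1 * \<beta> e) * comb (\<lambda>j. yc (w l j)) c r e) \<longrightarrow>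
          (\<exists>e\<in>{1..N}. v e \<noteq> 0) \<and> x * sqs {1..N} v \<le> wsum \<beta> {1..N} v)"
    then have t: "1 \<le> t" "t \<le> r" "r \<le> k" "t \<le> k" using q by auto
    have gt: "\<sigma> < ritz_value H S (Z (m + Suc l)) t" by (rule iterate_ritz_bounds(3)[OF it t(1,4)])
    show "x \<le> 1 / (ritz_value H S (Z (m + Suc l)) t - \<sigma>)"
    proof (cases "0 < x")
      case False
      moreover have "0 < 1 / (ritz_value H S (Z (m + Suc l)) t - \<sigma>)" using gt by simp
      ultimately show ?thesis by linarith
    next
      case True
      have step: "bpsd_id_step n H S K Umat k (Z (m + l)) (Z (m + Suc l))"
        using run_step_id[OF run, of "m + l"] by simp
      have "ritz_value H S (Z (m + Suc l)) t \<le> \<sigma> + 1 / x"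
      proof (rule step_bound[OF it it step, where w = "w l" and m = r and ?p0.0 = p0 and ?p1.0 = p1])
        show "w l a \<in> col_span n (Z (m + l))" if "a \<in> {1..k}" for a
          using w that by (auto simp: ritz_basis_of_def)
      qed (use * t True in blast)+
      then show ?thesis using True gt by (simp add: field_simps)
    qed
  qed
qed


section \<open>Return to the eigenvalues of the pair and the constants of the estimate\<close>

definition kap :: "nat \<Rightarrow> real" where
  "kap t = ((lam (i - 1 + t) - \<sigma>) / (lam (i + k) - \<sigma>)) * ((lam n - lam (i + k)) / (lam n - lam (i - 1 + t)))"

lemma mu_k: "\<mu> (k + 1) = lam (i + k)" and mu_N: "\<mu> N = lam n"
  using ik N by (auto simp: \<mu>_def)

lemma ritz_initial:
  assumes "bpsd_id_run n H S K u i k X Z" "bpsd_id_run n H S K u i k X Z'" "1 \<le> t" "t \<le> k"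
  shows "ritz_value H S (Z 0) t = ritz_value H S (Z' 0) t"
proof (rule ritz_value_cong_span[OF H S])
  note it = run_iterate[OF assms(1), of 0] run_iterate[OF assms(2), of 0]
  show "full_col_rank n (Z 0)" "dim_col (Z 0) = k" by (rule Z_full[OF it(1)], rule Z_dim[OF it(1)])
  show "full_col_rank n (Z' 0)" "dim_col (Z' 0) = k" by (rule Z_full[OF it(2)], rule Z_dim[OF it(2)])
  show "col_span n (Z 0) = col_span n (Z' 0)" using assms(1,2) by (simp add: bpsd_id_run_def)
qed (use assms in auto)

text \<open>With a, b, c for \<open>lam (i - 1 + t)\<close>, \<open>lam (i + k)\<close>,
  \<open>lam n\<close>, each reduced by the shift, this is the origin of kappa / (2 - kappa): the
  Chebyshev damping factor of the reciprocals.\<close>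

lemma rate_identity:
  fixes a b c :: real
  assumes "0 < a" "a < b" "b \<le> c"
  defines "\<kappa> \<equiv> (a / b) * ((c - b) / (c - a))"
  shows "(1 / b - 1 / c) / (2 * (1 / a) - 1 / c - 1 / b) = \<kappa> / (2 - \<kappa>)"
proof -
  define D where "D = b * (c - a) + c * (b - a)"
  have D: "0 < D" using assms by (auto simp: D_def intro!: add_pos_pos)
  have 1: "1 / b - 1 / c = (c - b) / (b * c)" using assms by (simp add: field_simps)
  have 2: "2 * (1 / a) - 1 / c - 1 / b = D / (a * (b * c))"
    using assms by (simp add: D_def field_simps)
  have 3: "\<kappa> = a * (c - b) / (b * (c - a))" by (simp add: \<kappa>_def)
  have "b * (c - a) \<noteq> 0" using assms by simp
  then have 4: "2 - \<kappa> = D / (b * (c - a))" unfolding 3 by (simp add: D_def field_simps)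
  have "b * (c - a) \<noteq> 0" "b * c \<noteq> 0" "a \<noteq> 0" using assms by auto
  then show ?thesis unfolding 1 2 unfolding 4 unfolding 3 using D by (simp add: divide_simps)
qed

text \<open>The source of the factor (lambda_(i-1+t) - \<sigma>) / (lambda_n - \<sigma>) in the
  estimate.\<close>

lemma ratio_identity:
  fixes a c x :: real
  assumes "0 < a" "a \<le> x" "x < c"
  shows "(x - a) / (c - x) = a / c * ((1 / a - 1 / x) / (1 / x - 1 / c))"
proof -
  have 1: "1 / a - 1 / x = (x - a) / (a * x)" "1 / x - 1 / c = (c - x) / (x * c)"
    using assms by (auto simp: field_simps)
  have "a \<noteq> 0" "x \<noteq> 0" "c \<noteq> 0" "c - x \<noteq> 0" using assms by auto
  then show ?thesis unfolding 1 by (simp add: divide_simps)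
qed

text \<open>The case kappa < 1. The exponent counts from iterate \<open>m\<close>, where the
  abstract run starts; the shift is absorbed into the constant afterwards.\<close>

lemma convergence_separated:
  assumes X: "admissible_start n H S K u i k X" and t: "1 \<le> t" "t \<le> k"
    and run0: "bpsd_id_run n H S K u i k X Z0" and sep: "lam (i - 1 + t) < lam (i + k)"
  shows "\<exists>m C. 0 < C \<and> (lam (i + k) = lam n \<longrightarrow> m = 0) \<and>
    (\<forall>Z l. bpsd_id_run n H S K u i k X Z \<longrightarrow> ritz_value H S (Z (m + l)) t < lam n \<and>
      (ritz_value H S (Z (m + l)) t - lam (i - 1 + t)) / (lam n - ritz_value H S (Z (m + l)) t)
        \<le> (lam (i - 1 + t) - \<sigma>) / (lam n - \<sigma>) * (C * (kap t / (2 - kap t)) ^ (2 * l)))"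
proof -
  define T where "T = {s \<in> {1..k}. \<mu> s < lam (i + k)}"
  define q where "q = Max T"
  have finT: "finite T" by (simp add: T_def)
  have tT: "t \<in> T" using t sep by (simp add: T_def \<mu>_def)
  have "q \<in> T" unfolding q_def using finT tT by (intro Max_in) auto
  then have q: "1 \<le> q" "q \<le> k" and mu_q: "\<mu> q < lam (i + k)" by (auto simp: T_def)
  have tq: "t \<le> q" unfolding q_def using finT tT by (rule Max_ge)
  \<comment> \<open>With ties, \<open>q\<close> can be smaller than \<open>k\<close>, yet the tail
    starts at the same eigenvalue, so the abstract rate is the one given by kappa.\<close>
  have mu_Suc_q: "\<mu> (q + 1) = lam (i + k)"
  proof (cases "q = k")
    case True
    then show ?thesis using mu_k by simp
  next
    case False
    then have "q + 1 \<in> {1..k}" using q by simp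
    have "q + 1 \<notin> T"
    proof
      assume "q + 1 \<in> T"
      then have "q + 1 \<le> q" unfolding q_def using finT by (intro Max_ge)
      then show False by simp
    qed
    then have "lam (i + k) \<le> \<mu> (q + 1)" using \<open>q + 1 \<in> {1..k}\<close> by (simp add: T_def)
    moreover have "\<mu> (q + 1) \<le> lam (i + k)"
      unfolding mu_k[symmetric] using q False N by (intro mu_mono) auto
    ultimately show ?thesis by simp
  qed
  have ik_n: "lam (i + k) \<le> lam n" using ik by (intro lam_mono) auto
  \<comment> \<open>If \<open>lam (i + k) = lam n\<close>, then kappa = 0 and no constant could make
    up for a delay \<open>m\<close>. In that case the first condition on the start already gives the
    threshold at iterate 0.\<close>
  have "\<exists>m c. c < lam (i + k) \<and> (lam (i + k) = lam n \<longrightarrow> m = 0) \<and>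
      (\<forall>Z. bpsd_id_run n H S K u i k X Z \<longrightarrow> ritz_value H S (Z m) q \<le> c)"
  proof (cases "lam (i + k) = lam n")
    case True
    have qk: "q \<in> {1..k}" using q by simp
    have "lam (i - 1 + q) < lam n" using mu_q True by (simp add: \<mu>_def)
    then have "ritz_value H S (Z0 0) q < lam n"
      using X run0 qk unfolding admissible_start_def lam_def by blast
    then show ?thesis using ritz_initial[OF _ run0 q] True by (intro exI[of _ 0] exI[of _ "ritz_value H S (Z0 0) q"]) auto
  next
    case False
    obtain m c where c: "c < lam (i + k)"
      "\<forall>Z. bpsd_id_run n H S K u i k X Z \<longrightarrow> (\<forall>t\<in>{1..k}. lam (i - 1 + t) < lam (i + k) \<longrightarrow> ritz_value H S (Z m) t \<le> c)"
      using X unfolding admissible_start_def lam_def by blast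
    have "q \<in> {1..k}" "lam (i - 1 + q) < lam (i + k)" using q mu_q by (auto simp: \<mu>_def)
    then have "\<forall>Z. bpsd_id_run n H S K u i k X Z \<longrightarrow> ritz_value H S (Z m) q \<le> c" using c(2) by blast
    then show ?thesis using False c(1) by blast
  qed
  then obtain m c where c: "c < lam (i + k)" and m: "lam (i + k) = lam n \<longrightarrow> m = 0"
    and start: "\<And>Z. bpsd_id_run n H S K u i k X Z \<Longrightarrow> ritz_value H S (Z m) q \<le> c" by blast
  \<comment> \<open>The maximum with \<open>\<mu> q\<close> ensures
    \<open>b \<le> \<beta> q\<close>.\<close>
  define b where "b = 1 / (max c (\<mu> q) - \<sigma>)"
  have mu_q_pos: "0 < \<mu> q - \<sigma>" using mu_pos[of q] q N by simp
  have blk: "block_iteration N q \<beta> b"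
  proof
    show "1 \<le> q" "q < N" using q N by auto
    show "\<beta> j \<le> \<beta> a" if "1 \<le> a" "a \<le> j" "j \<le> N" for a j using beta_antimono that .
    show "\<beta> (q + 1) < b" unfolding \<beta>_def b_def mu_Suc_q
      using c mu_q mu_q_pos by (intro divide_strict_left_mono mult_pos_pos) auto
    show "b \<le> \<beta> q" unfolding \<beta>_def b_def using mu_q_pos by (intro divide_left_mono mult_pos_pos) auto
  qed
  have "block_iteration.fast N q \<beta> b t"
    by (rule block_iteration.fast_convergence[OF blk t(1) tq])
  then obtain C where C: "0 < C" "\<And>y \<eta> l. block_iteration.is_run N q \<beta> b y \<eta> \<Longrightarrow>
      block_iteration.ratio q \<beta> \<eta> t l \<le> C * block_iteration.rate N q \<beta> t ^ (2 * l)"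
    unfolding block_iteration.fast_def[OF blk] by blast
  define a where "a = \<mu> t - \<sigma>"
  define d where "d = lam n - \<sigma>"
  have a: "0 < a" using mu_pos[of t] t N by (simp add: a_def)
  have ad: "a < lam (i + k) - \<sigma>" "lam (i + k) - \<sigma> \<le> d" using sep ik_n by (auto simp: a_def d_def \<mu>_def)
  have rate: "block_iteration.rate N q \<beta> t = kap t / (2 - kap t)"
    using rate_identity[OF a ad]
    unfolding block_iteration.rate_def[OF blk] \<beta>_def mu_Suc_q mu_N kap_def
    by (simp add: a_def d_def \<mu>_def)
  have "ritz_value H S (Z (m + l)) t < lam n \<and>
      (ritz_value H S (Z (m + l)) t - lam (i - 1 + t)) / (lam n - ritz_value H S (Z (m + l)) t)
        \<le> (lam (i - 1 + t) - \<sigma>) / (lam n - \<sigma>) * (C * (kap t / (2 - kap t)) ^ (2 * l))"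
    if run: "bpsd_id_run n H S K u i k X Z" for Z l
  proof -
    note it = run_iterate[OF run]
    define \<eta> where "\<eta> = (\<lambda>l t. 1 / (ritz_value H S (Z (m + l)) t - \<sigma>))"
    have "b \<le> 1 / (ritz_value H S (Z m) q - \<sigma>)"
      unfolding b_def using iterate_ritz_bounds(3)[OF it[of m] q] start[OF run] by (intro frac_le) auto
    from run_block[OF run blk q this] obtain y where y: "block_iteration.is_run N q \<beta> b y \<eta>"
      unfolding \<eta>_def by blast
    define x where "x = ritz_value H S (Z (m + l)) t - \<sigma>"
    have x: "a \<le> x" using iterate_ritz_bounds(1)[OF it[of "m + l"] t] by (simp add: a_def x_def)
    have "b \<le> 1 / x"
      using block_iteration.run_ge_b[OF blk y t(1) tq, of l] by (simp add: \<eta>_def x_def)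
    then have gap: "\<beta> (q + 1) < 1 / x" using block_iteration.b(1)[OF blk] by simp
    have bN: "\<beta> N \<le> \<beta> (q + 1)" using q N by (intro beta_antimono) auto
    then have "1 / d < 1 / x" using gap by (simp add: \<beta>_def mu_N d_def)
    then have xd: "x < d" using a x ad by (simp add: field_simps)
    have "(x - a) / (d - x) = a / d * ((1 / a - 1 / x) / (1 / x - 1 / d))"
      by (rule ratio_identity[OF a x xd])
    \<comment> \<open>Replacing 1 / d, which is \<open>\<beta> N\<close>, by
      \<open>\<beta> (q + 1)\<close> shrinks the denominator and leads to
      \<open>ratio\<close>.\<close>
    also have "\<dots> \<le> a / d * ((1 / a - 1 / x) / (1 / x - \<beta> (q + 1)))"
    proof (intro mult_left_mono frac_le)
      show "0 \<le> 1 / a - 1 / x" using a x by (simp add: field_simps)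
      show "0 < 1 / x - \<beta> (q + 1)" using gap by simp
      show "1 / x - \<beta> (q + 1) \<le> 1 / x - 1 / d" using bN by (simp add: \<beta>_def mu_N d_def)
      show "0 \<le> a / d" using a ad by simp
    qed auto
    also have "(1 / a - 1 / x) / (1 / x - \<beta> (q + 1)) = block_iteration.ratio q \<beta> \<eta> t l"
      unfolding block_iteration.ratio_def[OF blk] by (simp add: \<eta>_def x_def \<beta>_def a_def)
    also have "a / d * block_iteration.ratio q \<beta> \<eta> t l \<le> a / d * (C * (kap t / (2 - kap t)) ^ (2 * l))"
      using C(2)[OF y, of l] a ad unfolding rate by (intro mult_left_mono) auto
    finally show ?thesis using xd by (simp add: x_def a_def d_def \<mu>_def)
  qed
  with C(1) m show ?thesis by blast
qed

lemma convergence_constant: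
  assumes X: "admissible_start n H S K u i k X" and t: "1 \<le> t" "t \<le> k"
    and run0: "bpsd_id_run n H S K u i k X Z0"
  shows "\<exists>\<tau>>0. \<forall>Z l. bpsd_id_run n H S K u i k X Z \<longrightarrow>
    (lam (i - 1 + t) < lam n \<longrightarrow> ritz_value H S (Z l) t < lam n) \<and>
    (ritz_value H S (Z l) t - lam (i - 1 + t)) / (lam n - ritz_value H S (Z l) t)
      \<le> (kap t / (2 - kap t)) ^ (2 * l) * ((lam (i - 1 + t) - \<sigma>) / (lam n - \<sigma>)) * \<tau>"
proof -
  let ?lt = "lam (i - 1 + t)" and ?r = "kap t / (2 - kap t)"
  have lower: "?lt \<le> ritz_value H S (Z l) t" and upper: "ritz_value H S (Z l) t \<le> lam n"
    if "bpsd_id_run n H S K u i k X Z" for Z l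
    using iterate_ritz_bounds[OF run_iterate[OF that, of l] t] by (auto simp: \<mu>_def)
  have pos: "0 < ?lt - \<sigma>" using mu_pos[of t] t N by (simp add: \<mu>_def)
  have lt_ik: "?lt \<le> lam (i + k)" "lam (i + k) \<le> lam n" using t ik by (auto intro!: lam_mono)
  define \<rho> where "\<rho> = (?lt - \<sigma>) / (lam n - \<sigma>)"
  have \<rho>: "0 < \<rho>" unfolding \<rho>_def using pos lt_ik by (intro divide_pos_pos) auto
  show ?thesis
  proof (cases "?lt = lam n")
    case True
    have "(ritz_value H S (Z l) t - ?lt) / (lam n - ritz_value H S (Z l) t) \<le> ?r ^ (2 * l) * \<rho> * 1"
      if run: "bpsd_id_run n H S K u i k X Z" for Z l
    proof -
      \<comment> \<open>All eigenvalues from lambda_(i-1+t) on coincide, and the left-hand side is 0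
        / 0, that is 0.\<close>
      have "ritz_value H S (Z l) t = lam n" using lower[OF run, of l] upper[OF run, of l] True by simp
      then have "(ritz_value H S (Z l) t - ?lt) / (lam n - ritz_value H S (Z l) t) = 0" by simp
      also have "\<dots> \<le> ?r ^ (2 * l) * \<rho> * 1" using \<rho> by (simp add: power_mult)
      finally show ?thesis .
    qed
    then show ?thesis using True unfolding \<rho>_def[symmetric] by (intro exI[of _ 1]) simp
  next
    case False
    then have lt_n: "?lt < lam n" using lt_ik by simp
    define \<theta>0 where "\<theta>0 = ritz_value H S (Z0 0) t"
    have \<theta>0: "\<theta>0 < lam n"
      using X run0 t lt_n unfolding admissible_start_def lam_def \<theta>0_def by auto
    have dec: "ritz_value H S (Z l) t \<le> \<theta>0" if run: "bpsd_id_run n H S K u i k X Z" for Z l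
      using ritz_decreasing'[OF run t le0, of l] ritz_initial[OF run run0 t] by (simp add: \<theta>0_def)
    define B where "B = (\<theta>0 - ?lt) / (lam n - \<theta>0)"
    have B: "0 \<le> B" using \<theta>0 lower[OF run0, of 0] by (simp add: B_def \<theta>0_def)
    have init: "(ritz_value H S (Z l) t - ?lt) / (lam n - ritz_value H S (Z l) t) \<le> B"
      if run: "bpsd_id_run n H S K u i k X Z" for Z l
      unfolding B_def using dec[OF run, of l] \<theta>0 lower[OF run, of l] lower[OF run0, of 0]
      by (intro frac_le) (auto simp: \<theta>0_def)
    have below: "ritz_value H S (Z l) t < lam n" if "bpsd_id_run n H S K u i k X Z" for Z l
      using dec[OF that, of l] \<theta>0 by simp
    show ?thesis
    proof (cases "?lt = lam (i + k)")
      case True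
      \<comment> \<open>No decay is asserted here, so the bound \<open>B\<close> from the start
        suffices.\<close>
      have "kap t = 1" unfolding kap_def True[symmetric] using pos lt_n by simp
      then have r: "?r = 1" by simp
      have "B \<le> \<rho> * ((B + 1) / \<rho>)" using \<rho> B by simp
      then have "(ritz_value H S (Z l) t - ?lt) / (lam n - ritz_value H S (Z l) t)
          \<le> ?r ^ (2 * l) * \<rho> * ((B + 1) / \<rho>)" if "bpsd_id_run n H S K u i k X Z" for Z l
        using init[OF that, of l] unfolding r by simp
      moreover have "0 < (B + 1) / \<rho>" using B \<rho> by simp
      ultimately show ?thesis using below unfolding \<rho>_def[symmetric] by blast
    next
      case False
      then have sep: "?lt < lam (i + k)" using lt_ik by simp
      obtain m C where C: "0 < C" and m: "lam (i + k) = lam n \<longrightarrow> m = 0"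
        and conv: "\<And>Z l. bpsd_id_run n H S K u i k X Z \<Longrightarrow>
          (ritz_value H S (Z (m + l)) t - ?lt) / (lam n - ritz_value H S (Z (m + l)) t)
            \<le> \<rho> * (C * ?r ^ (2 * l))"
        using convergence_separated[OF X t run0 sep] unfolding \<rho>_def by blast
      have a: "0 < (?lt - \<sigma>) / (lam (i + k) - \<sigma>)" "(?lt - \<sigma>) / (lam (i + k) - \<sigma>) < 1"
        using pos sep by auto
      have f: "0 \<le> (lam n - lam (i + k)) / (lam n - ?lt)" "(lam n - lam (i + k)) / (lam n - ?lt) < 1"
        using lt_ik sep lt_n by auto
      have kap: "0 \<le> kap t" "kap t < 1"
        unfolding kap_def using mult_nonneg_nonneg[OF less_imp_le[OF a(1)] f(1)]
          mult_strict_mono[OF a(2) f(2) _ f(1)] by simp_all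
      then have r: "0 \<le> ?r" "?r \<le> 1" by auto
      have rm: "0 < ?r ^ (2 * m)"
      proof (cases "lam (i + k) = lam n")
        case True
        then show ?thesis using m by simp
      next
        case False
        then have "0 < kap t" unfolding kap_def using pos sep lt_ik lt_n by (intro mult_pos_pos divide_pos_pos) auto
        then show ?thesis using kap by simp
      qed
      \<comment> \<open>The summand \<open>B / \<rho>\<close> covers the iterates before
        \<open>m\<close>, where only the bound from the start is known. The division makes up for
        counting the exponent from 0 instead of \<open>m\<close>.\<close>
      define \<tau> where "\<tau> = (C + B / \<rho>) / ?r ^ (2 * m)"
      have \<tau>: "0 < \<tau>" unfolding \<tau>_def using C B \<rho> rm by (intro divide_pos_pos add_pos_nonneg) auto
      have "(ritz_value H S (Z l) t - ?lt) / (lam n - ritz_value H S (Z l) t) \<le> ?r ^ (2 * l) * \<rho> * \<tau>"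
        if run: "bpsd_id_run n H S K u i k X Z" for Z l
      proof (cases "m \<le> l")
        case True
        have "2 * l = 2 * (l - m) + 2 * m" using True by simp
        then have "?r ^ (2 * (l - m)) * ?r ^ (2 * m) = ?r ^ (2 * l)" by (simp only: power_add)
        then have split: "?r ^ (2 * (l - m)) = ?r ^ (2 * l) / ?r ^ (2 * m)"
          by (rule eq_divide_imp[OF less_imp_neq[OF rm, symmetric]])
        have "\<rho> * (C * ?r ^ (2 * (l - m))) \<le> \<rho> * ((C + B / \<rho>) * ?r ^ (2 * (l - m)))"
          using \<rho> B r by (intro mult_left_mono mult_right_mono) auto
        also have "\<dots> = ?r ^ (2 * l) * \<rho> * \<tau>" unfolding split \<tau>_def by (simp add: mult_ac)
        finally have "\<rho> * (C * ?r ^ (2 * (l - m))) \<le> ?r ^ (2 * l) * \<rho> * \<tau>" .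
        moreover have "(ritz_value H S (Z l) t - ?lt) / (lam n - ritz_value H S (Z l) t)
            \<le> \<rho> * (C * ?r ^ (2 * (l - m)))" using conv[OF run, of "l - m"] True by simp
        ultimately show ?thesis by simp
      next
        case False
        then have "?r ^ (2 * m) \<le> ?r ^ (2 * l)" using r by (intro power_decreasing) auto
        then have one: "1 \<le> ?r ^ (2 * l) / ?r ^ (2 * m)" using rm by simp
        have "B \<le> \<rho> * (C + B / \<rho>)" using C \<rho> by (simp add: distrib_left)
        also have "\<dots> \<le> \<rho> * (C + B / \<rho>) * (?r ^ (2 * l) / ?r ^ (2 * m))"
          using mult_left_mono[OF one, of "\<rho> * (C + B / \<rho>)"] \<rho> B C by simp
        also have "\<dots> = ?r ^ (2 * l) * \<rho> * \<tau>" unfolding \<tau>_def by (simp add: mult_ac)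
        finally have "B \<le> ?r ^ (2 * l) * \<rho> * \<tau>" .
        with init[OF run, of l] show ?thesis by simp
      qed
      with \<tau> below show ?thesis unfolding \<rho>_def[symmetric] by blast
    qed
  qed
qed

theorem convergence:
  assumes X: "admissible_start n H S K u i k X"
  shows "\<exists>\<tau>>0. \<forall>Z. bpsd_id_run n H S K u i k X Z \<longrightarrow> (\<forall>t\<in>{1..k}. \<forall>l.
    (lam (i - 1 + t) < lam n \<longrightarrow> ritz_value H S (Z l) t < lam n) \<and>
    (ritz_value H S (Z l) t - lam (i - 1 + t)) / (lam n - ritz_value H S (Z l) t)
      \<le> (kap t / (2 - kap t)) ^ (2 * l) * ((lam (i - 1 + t) - \<sigma>) / (lam n - \<sigma>)) * \<tau>)"
proof (cases "\<exists>Z. bpsd_id_run n H S K u i k X Z")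
  case False
  then show ?thesis by (intro exI[of _ 1]) simp
next
  case True
  then obtain Z0 where run0: "bpsd_id_run n H S K u i k X Z0" by blast
  have "\<forall>t\<in>{1..k}. \<exists>\<tau>>0. \<forall>Z l. bpsd_id_run n H S K u i k X Z \<longrightarrow>
    (lam (i - 1 + t) < lam n \<longrightarrow> ritz_value H S (Z l) t < lam n) \<and>
    (ritz_value H S (Z l) t - lam (i - 1 + t)) / (lam n - ritz_value H S (Z l) t)
      \<le> (kap t / (2 - kap t)) ^ (2 * l) * ((lam (i - 1 + t) - \<sigma>) / (lam n - \<sigma>)) * \<tau>"
    using convergence_constant[OF X _ _ run0] by simp
  then obtain \<tau> where \<tau>: "\<And>t. t \<in> {1..k} \<Longrightarrow> 0 < \<tau> t"
    "\<And>t Z l. t \<in> {1..k} \<Longrightarrow> bpsd_id_run n H S K u i k X Z \<Longrightarrow>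
    (lam (i - 1 + t) < lam n \<longrightarrow> ritz_value H S (Z l) t < lam n) \<and>
    (ritz_value H S (Z l) t - lam (i - 1 + t)) / (lam n - ritz_value H S (Z l) t)
      \<le> (kap t / (2 - kap t)) ^ (2 * l) * ((lam (i - 1 + t) - \<sigma>) / (lam n - \<sigma>)) * \<tau> t"
    unfolding bchoice_iff by blast
  \<comment> \<open>The sum of the positive constants dominates each of them and serves all
    \<open>t\<close> at once.\<close>
  define s where "s = (\<Sum>t\<in>{1..k}. \<tau> t)"
  have \<tau>s: "\<tau> t \<le> s" if "t \<in> {1..k}" for t
    unfolding s_def using \<tau>(1) that by (intro member_le_sum) (auto intro: less_imp_le)
  have s: "0 < s" using \<tau>(1)[of 1] \<tau>s[of 1] ik by force
  have "(kap t / (2 - kap t)) ^ (2 * l) * ((lam (i - 1 + t) - \<sigma>) / (lam n - \<sigma>)) * \<tau> t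
      \<le> (kap t / (2 - kap t)) ^ (2 * l) * ((lam (i - 1 + t) - \<sigma>) / (lam n - \<sigma>)) * s"
    if t: "t \<in> {1..k}" for t l
  proof (intro mult_left_mono[OF \<tau>s[OF t]] mult_nonneg_nonneg divide_nonneg_nonneg)
    show "0 \<le> (kap t / (2 - kap t)) ^ (2 * l)" by (simp add: power_mult)
    show "0 \<le> lam (i - 1 + t) - \<sigma>" using mu_pos[of t] t N by (simp add: \<mu>_def)
    show "0 \<le> lam n - \<sigma>" using mu_pos[of N] mu_N N by simp
  qed
  with s \<tau>(2) show ?thesis by (intro exI[of _ s]) (meson order_trans)
qed

end

theorem theorem4p1:
  fixes n i k :: nat
    and H S K :: "complex mat"
    and u :: "nat \<Rightarrow> complex vec"
    and \<sigma> :: real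
    and X :: "complex vec set"
    and lam \<kappa> :: "nat \<Rightarrow> real"
    and \<theta> :: "(nat \<Rightarrow> complex mat) \<Rightarrow> nat \<Rightarrow> nat \<Rightarrow> real"
  assumes H: "H \<in> carrier_mat n n" "hermitian_mat H"
    and S: "S \<in> carrier_mat n n" "posdef_mat S"
    and ik: "1 \<le> i" "1 \<le> k" "i + k \<le> n"
    and lam_def: "\<And>l. lam l = pair_eigval H S l"
    and u_carrier: "\<And>l. l \<in> {1..n} \<Longrightarrow> u l \<in> carrier_vec n"
    and u_orthonormal: "orthonormal_cols S (mat_of_cols n (map u [1..<n + 1]))"
    and u_eigen: "\<And>l. l \<in> {1..n} \<Longrightarrow> H *\<^sub>v u l = complex_of_real (lam l) \<cdot>\<^sub>v (S *\<^sub>v u l)"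
    and \<sigma>: "\<sigma> < lam i"
    and K: "K \<in> carrier_mat n n"
      "inverts_mat K (H - complex_of_real \<sigma> \<cdot>\<^sub>m S)"
      "inverts_mat (H - complex_of_real \<sigma> \<cdot>\<^sub>m S) K"
    and \<theta>_def: "\<And>Z l t. \<theta> Z l t = ritz_value H S (Z l) t"
    and \<kappa>_def: "\<And>t. \<kappa> t = ((lam (i - 1 + t) - \<sigma>) / (lam (i + k) - \<sigma>))
                        * ((lam n - lam (i + k)) / (lam n - lam (i - 1 + t)))"
    and X: "admissible_start n H S K u i k X"
  shows "\<exists>\<tau> > 0. \<forall>Z. bpsd_id_run n H S K u i k X Z \<longrightarrow>
           (\<forall>t \<in> {1..k}. \<forall>l.
              (lam (i - 1 + t) < lam n \<longrightarrow> \<theta> Z l t < lam n) \<and>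
              (\<theta> Z l t - lam (i - 1 + t)) / (lam n - \<theta> Z l t)
                \<le> (\<kappa> t / (2 - \<kappa> t)) ^ (2 * l)
                   * ((lam (i - 1 + t) - \<sigma>) / (lam n - \<sigma>)) * \<tau>)"
proof -
  interpret bpsd n i k H S K u \<sigma> lam
    by unfold_locales (fact H S ik lam_def u_carrier u_orthonormal u_eigen \<sigma> K)+
  have "\<kappa> t = kap t" for t by (simp add: \<kappa>_def kap_def)
  then show ?thesis using convergence[OF X] by (simp only: \<theta>_def)
qed

end
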